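(* For integers $n\ge 1$ and $0\le k\le n!$, let $T(n,k)$ denote the number of orbits of the action of $\mathfrak{S}_n\times\mathfrak{S}_n$ on the family of $k$-element subsets of $\mathfrak{S}_n$ given by $(g_1,g_2)\cdot\{x_1,\dots,x_k\}=\{g_1x_1g_2,\dots,g_1x_kg_2\}$, and let $\Lambda_n(k)=\frac{1}{n!^2}\binom{n!}{k}$. Then, as $n\to\infty$, \[T(n,k)=\Lambda_n(k)\,(1+o_n(1))\] uniformly for $3\le k\le n!-3$. Moreover, the $o_n(1)$ term can be taken to be $O(n^{-2})$: there is a constant $C>0$ such that for all $n$ and all $3\le k\le n!-3$, \[\left|\frac{T(n,k)}{\Lambda_n(k)}-1\right|\le \frac{C}{n^2}.\] In this statement, neither the range $[3,n!-3]$ nor the quadratic rate can be improved: the asymptotic $T(n,k)\sim\Lambda_n(k)$ fails for $k=2$ (and $k=n!-2$), and $n^{-2}$ cannot be replaced by $n^{-a}$ with $a>2$ uniformly over $3\le k\le n!-3$.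
   Context: $\mathfrak{S}_n$ is the symmetric group on $\{1,\dots,n\}$. Products $g_1x_ig_2$ are products in $\mathfrak{S}_n$. *)

theory Defs
  imports
    "HOL-Algebra.Sym_Groups"
    "HOL-Algebra.Group_Action"
    "HOL-Library.Landau_Symbols"
    Complex_Main
begin

(* With the product taken in the direct product group, g2 acts from the right, so this is an
   action of the first factor times the opposite of the second. The orbits do not depend on that
   choice, since g2 and its inverse range over the same group; below only the orbits are used. *)
definition two_sided_act ::
    "nat \<Rightarrow> (nat \<Rightarrow> nat) \<times> (nat \<Rightarrow> nat) \<Rightarrow> (nat \<Rightarrow> nat) set \<Rightarrow> (nat \<Rightarrow> nat) set" where
  "two_sided_act n g X =
     (\<lambda>x. fst g \<otimes>\<^bsub>sym_group n\<^esub> x \<otimes>\<^bsub>sym_group n\<^esub> snd g) ` X"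

definition k_subsets :: "nat \<Rightarrow> nat \<Rightarrow> (nat \<Rightarrow> nat) set set" where
  "k_subsets n k = {X. X \<subseteq> carrier (sym_group n) \<and> card X = k}"

definition T :: "nat \<Rightarrow> nat \<Rightarrow> nat" where
  "T n k = card (orbits (sym_group n \<times>\<times> sym_group n) (k_subsets n k) (two_sided_act n))"

definition Lambda :: "nat \<Rightarrow> nat \<Rightarrow> real" where
  "Lambda n k = 1 / (fact n)\<^sup>2 * real (fact n choose k)"

end

theory Submission
  imports Defs "HOL-Combinatorics.Permutations" "HOL-Real_Asymp.Real_Asymp"
begin

text \<open>
  Write \<open>N = n!\<close>. By Burnside's lemma, \<open>T n k / Lambda n k\<close> is the sum, over all pairs \<open>(a, b)\<close> of
  permutations, of the proportion of \<open>k\<close>-subsets invariant under \<open>x \<mapsto> a x b\<^sup>-\<^sup>1\<close>. The trivial pair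
  contributes \<open>1\<close>. A non-trivial pair has fixed points only if \<open>a\<close> and \<open>b\<close> are conjugate, and then it
  has as many as the centralizer \<open>C(a)\<close> has elements.

  For \<open>k\<close> at most polynomial in \<open>n\<close>, an invariant \<open>k\<close>-set consists of \<open>k - j\<close> fixed points and a
  union of non-trivial cycles of total length \<open>j\<close>, which is determined by at most \<open>j / 2\<close> points. The
  dominating term is \<open>j = 0\<close>: for \<open>k = 3\<close> it is \<open>\<Sum>\<^bsub>a \<noteq> 1\<^esub> |C(a)|\<^sup>2 / N\<^sup>2\<close>, which is of order \<open>n\<^sup>-\<^sup>2\<close>
  because of the transpositions. To bound this sum, permutations with small support are treated
  by an explicit estimate of \<open>|C(a)|\<close>, and those with large support by \<open>|C(a)| \<le> n ^ c(a)\<close>, where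
  \<open>c(a)\<close> is the number of cycles, combined with \<open>\<Sum>\<^sub>a x ^ c(a) = x (x + 1) \<cdots> (x + n - 1)\<close>.

  For larger \<open>k \<le> N / 2\<close> the generating function of invariant subsets shows that each proportion
  is at most \<open>(N + 1) exp (- k / 4)\<close>, and \<open>k > N / 2\<close> is reduced to this by taking complements.
\<close>

section \<open>Invariant subsets of a permutation\<close>

text \<open>What shapes the proof is the number of pairs, N^2 with N = n!: a bound for a single
  proportion helps only if it survives multiplication by N^2. Cycles of total length j contribute
  roughly (2k / sqrt N)^j, which for polynomial k wins against N^2 only from j = 5 on. Everything
  else has to be controlled on average: x is fixed by the pair (a, b) exactly when b is the
  conjugate of a by x, so sums over pairs turn into sums over single permutations, and a point on an
  l-cycle is a fixed point of the pair of l-th powers.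

  All terms of Burnside's sum are nonnegative, so the relative error is itself the sum over the
  non-trivial pairs, and lower bounds follow by keeping only the subsets made of fixed points.

  Permutations are never decomposed into cycles. The proof works with sets of points whose forward
  iterates cover a given set: such a set determines an invariant set or a commuting permutation, and
  exhibiting one bounds the number of cycles from above.\<close>

definition generates :: "('a \<Rightarrow> 'a) \<Rightarrow> 'a set \<Rightarrow> 'a set \<Rightarrow> bool" where
  "generates p R X \<longleftrightarrow> (\<forall>y\<in>X. \<exists>r\<in>R. \<exists>i. y = (p ^^ i) r)"

definition fixpts :: "('a \<Rightarrow> 'a) \<Rightarrow> 'a set \<Rightarrow> 'a set" where
  "fixpts p U = {x\<in>U. p x = x}"

definition moved :: "('a \<Rightarrow> 'a) \<Rightarrow> 'a set \<Rightarrow> 'a set" where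
  "moved p U = {x\<in>U. p x \<noteq> x}"

definition inv_subsets :: "('a \<Rightarrow> 'a) \<Rightarrow> 'a set \<Rightarrow> nat \<Rightarrow> 'a set set" where
  "inv_subsets p U k = {X. X \<subseteq> U \<and> card X = k \<and> p ` X = X}"

lemma generates_self: "generates p X X"
  unfolding generates_def by (metis funpow_0)

lemma generates_Un: "generates p R X \<Longrightarrow> generates p R' Y \<Longrightarrow> generates p (R \<union> R') (X \<union> Y)"
  unfolding generates_def by blast

lemma finite_fixpts: "finite U \<Longrightarrow> finite (fixpts p U)"
  by (simp add: fixpts_def)

lemma finite_moved: "finite U \<Longrightarrow> finite (moved p U)"
  by (simp add: moved_def)

lemma card_fixpts_moved: "finite U \<Longrightarrow> card (fixpts p U) + card (moved p U) = card U"
  unfolding fixpts_def moved_def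
  by (subst card_Un_disjoint[symmetric]) (auto intro: arg_cong[where f = card])

lemma finite_inv_subsets: "finite U \<Longrightarrow> finite (inv_subsets p U k)"
  unfolding inv_subsets_def by simp

lemma funpow_in_image_invariant: "p ` X = X \<Longrightarrow> x \<in> X \<Longrightarrow> (p ^^ i) x \<in> X"
  by (induction i) auto

text \<open>A generating set of minimal size is disjoint from its image.\<close>

lemma exists_half_generating:
  assumes fin: "finite X" and inv: "p ` X = X" and nofix: "\<And>x. x \<in> X \<Longrightarrow> p x \<noteq> x"
  shows "\<exists>R\<subseteq>X. generates p R X \<and> 2 * card R \<le> card X"
proof -
  define Q where "Q = (\<lambda>R. R \<subseteq> X \<and> generates p R X)"
  have "Q X" using generates_self unfolding Q_def by blast
  then obtain R where R: "Q R" and least: "\<And>R'. Q R' \<Longrightarrow> card R \<le> card R'"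
    using exists_least_iff[of "\<lambda>m. \<exists>R. Q R \<and> card R = m"] by (metis not_le)
  have finR: "finite R" using R fin finite_subset unfolding Q_def by blast
  have inj: "inj_on p X" using fin inv by (simp add: finite_surj_inj)
  have "R \<inter> p ` R = {}"
  proof (rule ccontr)
    assume "R \<inter> p ` R \<noteq> {}"
    then obtain r where r: "r \<in> R" "p r \<in> R" by blast
    then have ne: "p r \<noteq> r" using R nofix unfolding Q_def by blast
    have "generates p (R - {p r}) X"
      unfolding generates_def
    proof
      fix y assume "y \<in> X"
      then obtain r' i where r': "r' \<in> R" "y = (p ^^ i) r'"
        using R unfolding Q_def generates_def by blast
      show "\<exists>r\<in>R - {p r}. \<exists>i. y = (p ^^ i) r"
      proof (cases "r' = p r")
        case True
        then have "y = (p ^^ Suc i) r" using r'(2) by (simp add: funpow_swap1)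
        moreover have "r \<in> R - {p r}" using r ne by auto
        ultimately show ?thesis by blast
      qed (use r' in blast)
    qed
    then have "Q (R - {p r})" using R unfolding Q_def by blast
    then show False using least r(2) finR by (meson card_Diff1_less not_le)
  qed
  then have "card R + card (p ` R) = card (R \<union> p ` R)"
    using finR by (simp add: card_Un_disjoint)
  also have "\<dots> \<le> card X"
    using R inv fin unfolding Q_def by (intro card_mono) blast+
  also have "card (p ` R) = card R"
    using inj R unfolding Q_def by (meson card_image inj_on_subset)
  finally show ?thesis using R unfolding Q_def by (intro exI[of _ R]) auto
qed

text \<open>An invariant subset is determined by any generating set, and a fixed-point-free one is
  generated by half of its elements.\<close>

lemma card_inv_subsets_moved_le:
  assumes fin: "finite U" and j: "j \<noteq> 1"
  shows "card (inv_subsets p (moved p U) j) \<le> card U ^ (j div 2)"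
proof (cases "j = 0")
  case True
  have "inv_subsets p (moved p U) 0 \<subseteq> {{}}"
    using finite_moved[OF fin] unfolding inv_subsets_def by (auto dest: finite_subset)
  then have "card (inv_subsets p (moved p U) 0) \<le> card {{}::'a set}" by (intro card_mono) auto
  then show ?thesis using True by simp
next
  case False
  define d where "d = j div 2"
  have d: "d > 0" using False j unfolding d_def by simp
  define cl where "cl = (\<lambda>h::nat \<Rightarrow> 'a. {(p ^^ i) (h l) | i l. l < d})"
  have "inv_subsets p (moved p U) j \<subseteq> cl ` ({..<d} \<rightarrow>\<^sub>E U)"
  proof
    fix X assume X: "X \<in> inv_subsets p (moved p U) j"
    then have XU: "X \<subseteq> U" and cX: "card X = j" and inv: "p ` X = X"
      and nofix: "\<And>x. x \<in> X \<Longrightarrow> p x \<noteq> x"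
      unfolding inv_subsets_def moved_def by auto
    have finX: "finite X" using XU fin finite_subset by blast
    obtain R where R: "R \<subseteq> X" "generates p R X" "2 * card R \<le> card X"
      using exists_half_generating[OF finX inv nofix] by blast
    have finR: "finite R" using R finX finite_subset by blast
    have cR: "card R \<le> d" using R cX unfolding d_def by linarith
    have "X \<noteq> {}" using cX False by auto
    then obtain r0 where r0: "r0 \<in> R" using R(2) unfolding generates_def by blast
    obtain e where e: "bij_betw e {0..<card R} R" using ex_bij_betw_nat_finite[OF finR] by blast
    \<comment> \<open>Tuples of the exact length \<open>d\<close> are counted, so a shorter list of
      generators is padded with copies of \<open>r0\<close>.\<close>
    define h where "h = (\<lambda>l\<in>{..<d}. if l < card R then e l else r0)"
    have hR: "h l \<in> R" if "l < d" for l
      using that r0 e unfolding h_def bij_betw_def by auto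
    have hs: "\<exists>l<d. h l = r" if "r \<in> R" for r
    proof -
      have "r \<in> e ` {0..<card R}" using that e unfolding bij_betw_def by blast
      then obtain l where "l < card R" "e l = r" by auto
      then show ?thesis using cR unfolding h_def by (intro exI[of _ l]) auto
    qed
    have "h \<in> {..<d} \<rightarrow>\<^sub>E U" 
    proof (rule PiE_I)
      show "h l \<in> U" if "l \<in> {..<d}" for l using that hR R XU by blast
      show "h l = undefined" if "l \<notin> {..<d}" for l using that unfolding h_def by simp
    qed
    moreover have "X = cl h"
    proof
      show "X \<subseteq> cl h"
      proof
        fix y assume "y \<in> X"
        then obtain r i where "r \<in> R" "y = (p ^^ i) r" using R(2) unfolding generates_def by blast
        with hs show "y \<in> cl h" unfolding cl_def by blast
      qed
      show "cl h \<subseteq> X"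
        using hR R(1) funpow_in_image_invariant[OF inv] unfolding cl_def by blast
    qed
    ultimately show "X \<in> cl ` ({..<d} \<rightarrow>\<^sub>E U)" by blast
  qed
  then have "card (inv_subsets p (moved p U) j) \<le> card ({..<d} \<rightarrow>\<^sub>E U)"
    using fin by (intro surj_card_le) (auto simp: finite_PiE)
  also have "\<dots> = card U ^ d" by (simp add: card_PiE)
  finally show ?thesis unfolding d_def .
qed

lemma inv_subsets_moved_1: "inv_subsets p (moved p U) 1 = {}"
  unfolding inv_subsets_def moved_def by (auto simp: card_1_singleton_iff)

lemma card_inv_subsets_0: "finite U \<Longrightarrow> card (inv_subsets p U 0) = 1"
proof -
  assume "finite U"
  then have "inv_subsets p U 0 = {{}}" unfolding inv_subsets_def by (auto dest: finite_subset)
  then show ?thesis by simp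
qed

text \<open>For prime \<open>l\<close> these are exactly the points of \<open>U\<close> on
  \<open>l\<close>-cycles: the cycle length divides \<open>l\<close>, and length 1 is excluded by
  \<open>moved\<close>.\<close>

definition cycpts :: "('a \<Rightarrow> 'a) \<Rightarrow> 'a set \<Rightarrow> nat \<Rightarrow> 'a set" where
  "cycpts p U l = {x\<in>moved p U. (p ^^ l) x = x}"

lemma finite_cycpts: "finite U \<Longrightarrow> finite (cycpts p U l)"
  by (simp add: cycpts_def finite_moved)

text \<open>For sizes 2, 3 and 4 the general bound \<open>card U ^ (j div 2)\<close> is too weak
  after summation over all pairs. Here and in the next two lemmas it is replaced by a count of
  points on short cycles, which is small on average.\<close>

lemma card_inv_subsets_moved_2:
  assumes fin: "finite U"
  shows "card (inv_subsets p (moved p U) 2) \<le> card (cycpts p U 2)"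
proof -
  have "inv_subsets p (moved p U) 2 \<subseteq> (\<lambda>r. {r, p r}) ` cycpts p U 2"
  proof
    fix X assume X: "X \<in> inv_subsets p (moved p U) 2"
    then obtain r s where rs: "X = {r, s}" "r \<noteq> s"
      unfolding inv_subsets_def by (auto simp: card_2_iff)
    from X have "p ` X = X" "p r \<noteq> r" "p s \<noteq> s" "r \<in> moved p U"
      using rs unfolding inv_subsets_def moved_def by auto
    then have "p r = s" "p s = r" using rs by auto
    then show "X \<in> (\<lambda>r. {r, p r}) ` cycpts p U 2"
      using rs \<open>r \<in> moved p U\<close> unfolding cycpts_def by (auto simp: numeral_2_eq_2)
  qed
  then show ?thesis using finite_cycpts[OF fin] surj_card_le by blast
qed

text \<open>A permutation of three points without fixed points is a 3-cycle, since a 2-cycle would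
  leave a single point, which would be fixed.\<close>

lemma card_inv_subsets_moved_3:
  assumes fin: "finite U"
  shows "card (inv_subsets p (moved p U) 3) \<le> card (cycpts p U 3)"
proof -
  have "inv_subsets p (moved p U) 3 \<subseteq> (\<lambda>r. {r, p r, p (p r)}) ` cycpts p U 3"
  proof
    fix X assume X: "X \<in> inv_subsets p (moved p U) 3"
    then have cX: "card X = 3" and pX: "p ` X = X" and XU: "X \<subseteq> U"
      and nf: "\<And>x. x \<in> X \<Longrightarrow> p x \<noteq> x"
      unfolding inv_subsets_def moved_def by auto
    have finX: "finite X" using cX card.infinite by fastforce
    have inj: "inj_on p X" using finX pX by (simp add: finite_surj_inj)
    have inX: "p x \<in> X" if "x \<in> X" for x using pX that by blast
    have "X \<noteq> {}" using cX by auto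
    then obtain r where r: "r \<in> X" by blast
    let ?a = "p r" let ?b = "p (p r)"
    have ins: "?a \<in> X" "?b \<in> X" using r inX by auto
    have d: "?a \<noteq> r" "?b \<noteq> ?a" using nf r ins by auto
    have "?b \<noteq> r"
    proof
      assume b: "?b = r"
      have "X - {r, ?a} \<noteq> {}"
        using cX card_mono[of "{r, ?a}" X] by (auto simp: card_insert_if split: if_splits)
      then obtain s where s: "s \<in> X" "s \<noteq> r" "s \<noteq> ?a" by blast
      have ps: "p s \<noteq> r" "p s \<noteq> ?a" "p s \<noteq> s"
        using inj s r ins b nf by (metis inj_onD)+
      have "card {r, ?a, s, p s} \<le> card X"
        using r ins s inX finX by (intro card_mono) auto
      then show False using cX d s ps by (auto simp: card_insert_if)
    qed
    then have eq: "{r, ?a, ?b} = X"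
      using d r ins cX by (intro card_subset_eq[OF finX]) (auto simp: card_insert_if)
    have "p ?b \<noteq> ?a" "p ?b \<noteq> ?b"
      using inj r ins d \<open>?b \<noteq> r\<close> by (metis inj_onD)+
    then have "p ?b = r" using inX[OF ins(2)] eq by blast
    moreover have "r \<in> moved p U" using r XU nf unfolding moved_def by auto
    ultimately have "r \<in> cycpts p U 3" unfolding cycpts_def by (simp add: numeral_3_eq_3)
    then show "X \<in> (\<lambda>r. {r, p r, p (p r)}) ` cycpts p U 3" using eq by blast
  qed
  then show ?thesis using finite_cycpts[OF fin] surj_card_le by blast
qed

text \<open>Four points without a fixed point form two 2-cycles or one 4-cycle. The first kind is
  given by a point \<open>r\<close> on a 2-cycle and any point \<open>s\<close> of the other one,
  the second by any of its points.\<close>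

lemma card_inv_subsets_moved_4:
  assumes fin: "finite U"
  shows "card (inv_subsets p (moved p U) 4) \<le> card U * card (cycpts p U 2) + card U"
proof -
  have "inv_subsets p (moved p U) 4 \<subseteq>
      (\<lambda>(s, r). {r, p r, s, p s}) ` (U \<times> cycpts p U 2) \<union>
      (\<lambda>r. {r, p r, p (p r), p (p (p r))}) ` U" (is "_ \<subseteq> ?A \<union> ?B")
  proof
    fix X assume X: "X \<in> inv_subsets p (moved p U) 4"
    then have cX: "card X = 4" and pX: "p ` X = X" and XU: "X \<subseteq> U"
      and nf: "\<And>x. x \<in> X \<Longrightarrow> p x \<noteq> x"
      unfolding inv_subsets_def moved_def by auto
    have finX: "finite X" using cX card.infinite by fastforce
    have inj: "inj_on p X" using finX pX by (simp add: finite_surj_inj)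
    have inX: "p x \<in> X" if "x \<in> X" for x using pX that by blast
    show "X \<in> ?A \<union> ?B"
    proof (cases "\<exists>r\<in>X. p (p r) = r")
      case True
      then obtain r where r: "r \<in> X" "p (p r) = r" by blast
      have "X - {r, p r} \<noteq> {}"
        using cX card_mono[of "{r, p r}" X] by (auto simp: card_insert_if split: if_splits)
      then obtain s where s: "s \<in> X" "s \<noteq> r" "s \<noteq> p r" by blast
      have ps: "p s \<noteq> r" "p s \<noteq> p r" "p s \<noteq> s"
        using inj r s nf inX by (metis inj_onD)+
      have "{r, p r, s, p s} = X"
      proof (rule card_subset_eq[OF finX])
        show "{r, p r, s, p s} \<subseteq> X" using r s inX by auto
        have "p r \<noteq> r" using nf r by blast
        then show "card {r, p r, s, p s} = card X" using cX r s ps by (auto simp: card_insert_if)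
      qed
      moreover have "(s, r) \<in> U \<times> cycpts p U 2"
        using r s XU nf unfolding cycpts_def moved_def by (auto simp: numeral_2_eq_2)
      ultimately show ?thesis by (intro UnI1 image_eqI[of _ _ "(s, r)"]) auto
    next
      case False
      have "X \<noteq> {}" using cX by auto
      then obtain r where r: "r \<in> X" by blast
      let ?a = "p r" let ?b = "p (p r)" let ?c = "p (p (p r))"
      have ins: "?a \<in> X" "?b \<in> X" "?c \<in> X" using r inX by auto
      have d: "?a \<noteq> r" "?b \<noteq> r" "?b \<noteq> ?a" "?c \<noteq> ?b" "?c \<noteq> ?a"
        using nf False r ins by metis+
      have "?c \<noteq> r"
      proof
        assume c: "?c = r"
        have "card {r, ?a, ?b} \<le> 3" by (auto simp: card_insert_if)
        then have "X - {r, ?a, ?b} \<noteq> {}"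
          using cX card_mono[of "{r, ?a, ?b}" X] by force
        then obtain s where s: "s \<in> X" "s \<noteq> r" "s \<noteq> ?a" "s \<noteq> ?b" by blast
        have ps: "p s \<noteq> r" "p s \<noteq> ?a" "p s \<noteq> ?b" "p s \<noteq> s"
          using inj s r ins c nf by (metis inj_onD)+
        have "card {r, ?a, ?b, s, p s} \<le> card X"
          using r ins s inX finX by (intro card_mono) auto
        then show False using cX d s ps by (auto simp: card_insert_if)
      qed
      then have "{r, ?a, ?b, ?c} = X"
        using d r ins cX by (intro card_subset_eq[OF finX]) (auto simp: card_insert_if)
      then show ?thesis using r XU by blast
    qed
  qed
  moreover have "finite (?A \<union> ?B)" using fin finite_cycpts[OF fin] by auto
  ultimately have "card (inv_subsets p (moved p U) 4) \<le> card (?A \<union> ?B)" by (intro card_mono)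
  also have "\<dots> \<le> card ?A + card ?B" by (rule card_Un_le)
  also have "\<dots> \<le> card (U \<times> cycpts p U 2) + card U"
    using fin finite_cycpts[OF fin] by (intro add_mono card_image_le) auto
  finally show ?thesis by (simp add: card_cartesian_product)
qed

lemma image_Int_moved:
  assumes "inj_on p U" "p ` U = U" "X \<subseteq> U" "p ` X = X"
  shows "p ` (X \<inter> moved p U) = X \<inter> moved p U"
proof
  show "p ` (X \<inter> moved p U) \<subseteq> X \<inter> moved p U"
  proof
    fix y assume "y \<in> p ` (X \<inter> moved p U)"
    then obtain x where x: "x \<in> X" "x \<in> U" "p x \<noteq> x" "y = p x" unfolding moved_def by auto
    then have "y \<in> X" "y \<in> U" using assms by auto
    moreover have "p y \<noteq> y" using x \<open>y \<in> U\<close> assms(1) by (metis inj_onD)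
    ultimately show "y \<in> X \<inter> moved p U" unfolding moved_def by simp
  qed
  show "X \<inter> moved p U \<subseteq> p ` (X \<inter> moved p U)"
  proof
    fix y assume y: "y \<in> X \<inter> moved p U"
    then obtain x where x: "x \<in> X" "y = p x" using assms(4) by blast
    then have "p x \<noteq> x" using y unfolding moved_def by auto
    then show "y \<in> p ` (X \<inter> moved p U)" using x assms(3) unfolding moved_def by blast
  qed
qed

text \<open>An invariant set is recovered from its fixed and its moved part, and the moved part is
  again invariant; \<open>j\<close> is the size of the latter.\<close>

lemma card_inv_subsets_le_sum:
  assumes fin: "finite U" and surj: "p ` U = U"
  shows "card (inv_subsets p U k) \<le>
    (\<Sum>j\<le>k. (card (fixpts p U) choose (k - j)) * card (inv_subsets p (moved p U) j))"
proof -
  have inj: "inj_on p U" using fin surj by (simp add: finite_surj_inj)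
  let ?B = "\<lambda>j. {A. A \<subseteq> fixpts p U \<and> card A = k - j} \<times> inv_subsets p (moved p U) j"
  let ?f = "\<lambda>X. (X \<inter> fixpts p U, X \<inter> moved p U)"
  have finB: "finite (?B j)" for j
    using finite_fixpts[OF fin] finite_inv_subsets[OF finite_moved[OF fin]]
    by (intro finite_cartesian_product) auto
  have "card (inv_subsets p U k) = card (?f ` inv_subsets p U k)"
  proof (rule card_image[symmetric], rule inj_onI)
    fix X Y assume "X \<in> inv_subsets p U k" "Y \<in> inv_subsets p U k" "?f X = ?f Y"
    then show "X = Y" unfolding inv_subsets_def fixpts_def moved_def by blast
  qed
  also have "\<dots> \<le> card (\<Union>j\<le>k. ?B j)"
  proof (rule card_mono)
    show "finite (\<Union>j\<le>k. ?B j)" using finB by blast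
    show "?f ` inv_subsets p U k \<subseteq> (\<Union>j\<le>k. ?B j)"
    proof (rule image_subsetI)
      fix X assume X: "X \<in> inv_subsets p U k"
      then have XU: "X \<subseteq> U" and cX: "card X = k" and pX: "p ` X = X"
        unfolding inv_subsets_def by auto
      have finX: "finite X" using XU fin finite_subset by blast
      have "X = (X \<inter> fixpts p U) \<union> (X \<inter> moved p U)"
        using XU unfolding fixpts_def moved_def by blast
      then have "card X = card (X \<inter> fixpts p U) + card (X \<inter> moved p U)"
        using finX by (subst card_Un_disjoint[symmetric]) (auto simp: fixpts_def moved_def)
      then have "?f X \<in> ?B (card (X \<inter> moved p U))" "card (X \<inter> moved p U) \<le> k"
        using image_Int_moved[OF inj surj XU pX] cX unfolding inv_subsets_def by auto
      then show "?f X \<in> (\<Union>j\<le>k. ?B j)" by blast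
    qed
  qed
  also have "\<dots> \<le> (\<Sum>j\<le>k. card (?B j))" by (rule card_UN_le) simp
  also have "\<dots> = (\<Sum>j\<le>k. (card (fixpts p U) choose (k - j)) * card (inv_subsets p (moved p U) j))"
    using n_subsets[OF finite_fixpts[OF fin]] by (simp add: card_cartesian_product)
  finally show ?thesis .
qed

section \<open>Quotients of binomial coefficients\<close>

lemma Suc_times_binomial_Suc: "Suc i * (n choose Suc i) = (n - i) * (n choose i)"
  by (metis binomial_absorb_comp binomial_absorption mult.commute)

text \<open>For \<open>i \<le> N\<close> the quotient of the binomial coefficients is the product of
  \<open>(f - l) / (N - l)\<close> over \<open>l < i\<close>, and each factor is at most
  \<open>f / N\<close>. Denominators are cleared so that the induction stays in
  \<open>nat\<close>.\<close>

lemma binomial_power_le: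
  assumes "f \<le> N"
  shows "(f choose i) * N ^ i \<le> (N choose i) * f ^ i"
proof (induction i)
  case (Suc i)
  have "Suc i * ((f choose Suc i) * N ^ Suc i) = ((f - i) * N) * ((f choose i) * N ^ i)"
    by (metis Suc_times_binomial_Suc mult.assoc mult.left_commute power_Suc)
  also have "\<dots> \<le> ((N - i) * f) * ((N choose i) * f ^ i)"
  proof (rule mult_mono[OF _ Suc.IH])
    show "(f - i) * N \<le> (N - i) * f"
      unfolding diff_mult_distrib using mult_le_mono2[OF assms, of i]
      by (simp only: mult.commute[of N f] diff_le_mono2)
  qed auto
  also have "\<dots> = Suc i * ((N choose Suc i) * f ^ Suc i)"
    by (metis Suc_times_binomial_Suc mult.assoc mult.left_commute power_Suc)
  finally show ?case by (simp only: Suc_mult_le_cancel1)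
qed simp

text \<open>Raising the lower index from \<open>m\<close> to \<open>m + 1 \<le> k\<close> multiplies
  the binomial coefficient by \<open>(N - m) / (m + 1)\<close>, which is at least
  \<open>N / (2 * k)\<close> because \<open>N - m \<ge> N / 2\<close>.\<close>

lemma binomial_step_power_le:
  assumes "i + j \<le> k" "2 * k \<le> N"
  shows "(N choose i) * N ^ j \<le> (N choose (i + j)) * (2 * k) ^ j"
  using assms(1)
proof (induction j)
  case (Suc j)
  have "Suc (i + j) * N \<le> k * (2 * (N - (i + j)))"
    using Suc.prems assms(2) by (intro mult_mono) auto
  then have "Suc (i + j) * ((N choose (i + j)) * N) \<le> (N choose (i + j)) * (k * (2 * (N - (i + j))))"
    by (metis mult.left_commute mult_le_mono2)
  also have "\<dots> = (2 * k) * ((N - (i + j)) * (N choose (i + j)))" by (simp add: mult_ac)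
  also have "\<dots> = (2 * k) * (Suc (i + j) * (N choose Suc (i + j)))"
    by (simp only: Suc_times_binomial_Suc)
  also have "\<dots> = Suc (i + j) * ((N choose Suc (i + j)) * (2 * k))" by (simp only: mult_ac)
  finally have step: "(N choose (i + j)) * N \<le> (N choose Suc (i + j)) * (2 * k)"
    by (simp only: Suc_mult_le_cancel1)
  have "(N choose i) * N ^ Suc j = ((N choose i) * N ^ j) * N" by (simp add: mult_ac)
  also have "\<dots> \<le> ((N choose (i + j)) * (2 * k) ^ j) * N"
    using Suc by (intro mult_right_mono) auto
  also have "\<dots> = ((N choose (i + j)) * N) * (2 * k) ^ j" by (simp only: mult_ac)
  also have "\<dots> \<le> ((N choose Suc (i + j)) * (2 * k)) * (2 * k) ^ j"
    using step by (rule mult_right_mono) simp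
  finally show ?case by (simp add: mult_ac)
qed simp

lemma binomial_ratio_le:
  fixes f N k j :: nat
  assumes "f \<le> N" "j \<le> k" "2 * k \<le> N" "N > 0"
  shows "real (f choose (k - j)) \<le> (real f / N) ^ (k - j) * (2 * k / N) ^ j * real (N choose k)"
proof -
  have "real (f choose (k - j)) * real N ^ (k - j) * real N ^ j
      \<le> real (N choose (k - j)) * real f ^ (k - j) * real N ^ j"
    using binomial_power_le[OF assms(1), of "k - j"] 
    by (intro mult_right_mono) (simp_all flip: of_nat_power of_nat_mult)
  also have "\<dots> = (real (N choose (k - j)) * real N ^ j) * real f ^ (k - j)" by simp
  also have "\<dots> \<le> (real (N choose k) * (2 * real k) ^ j) * real f ^ (k - j)"
  proof (rule mult_right_mono)
    have "(N choose (k - j)) * N ^ j \<le> (N choose k) * (2 * k) ^ j"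
      using binomial_step_power_le[of "k - j" j k N] assms by simp
    then have "real ((N choose (k - j)) * N ^ j) \<le> real ((N choose k) * (2 * k) ^ j)"
      by (simp only: of_nat_le_iff)
    then show "real (N choose (k - j)) * real N ^ j \<le> real (N choose k) * (2 * real k) ^ j"
      by simp
  qed simp
  finally show ?thesis using assms by (simp add: field_simps)
qed

lemma inv_subsets_ratio_le:
  assumes fin: "finite U" and surj: "p ` U = U" and k: "2 * k \<le> card U" and U: "U \<noteq> {}"
  shows "real (card (inv_subsets p U k)) / real (card U choose k) \<le>
    (\<Sum>j\<le>k. (real (card (fixpts p U)) / card U) ^ (k - j) * (2 * k / card U) ^ j
              * card (inv_subsets p (moved p U) j))"
proof -
  let ?f = "card (fixpts p U)" and ?N = "card U"
  have fN: "?f \<le> ?N" using card_fixpts_moved[OF fin, of p] by linarith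
  have pos: "?N > 0" using fin U by (simp add: card_gt_0_iff)
  have "real (card (inv_subsets p U k)) \<le>
      real (\<Sum>j\<le>k. (?f choose (k - j)) * card (inv_subsets p (moved p U) j))"
    using card_inv_subsets_le_sum[OF fin surj] of_nat_le_iff by blast
  also have "\<dots> = (\<Sum>j\<le>k. real (?f choose (k - j)) * card (inv_subsets p (moved p U) j))" by simp
  also have "\<dots> \<le> (\<Sum>j\<le>k. ((real ?f / ?N) ^ (k - j) * (2 * k / ?N) ^ j * real (?N choose k))
      * card (inv_subsets p (moved p U) j))"
    using binomial_ratio_le[OF fN _ k pos] by (intro sum_mono mult_right_mono) auto
  also have "\<dots> = (\<Sum>j\<le>k. (real ?f / ?N) ^ (k - j) * (2 * k / ?N) ^ j
      * card (inv_subsets p (moved p U) j)) * real (?N choose k)"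
    unfolding sum_distrib_right by (simp only: mult_ac)
  finally show ?thesis using k by (simp add: field_simps zero_less_binomial)
qed

section \<open>Exponential bound from the generating function\<close>

text \<open>Take \<open>Y\<close> maximal among the sets disjoint from their image. A moved point
  outside \<open>Y\<close>, its image and its preimage could be added to \<open>Y\<close>, so these
  three sets, none larger than \<open>Y\<close>, cover all moved points.\<close>

lemma exists_independent_third:
  assumes fin: "finite U" and surj: "p ` U = U"
  shows "\<exists>Y\<subseteq>U. Y \<inter> p ` Y = {} \<and> card (moved p U) \<le> 3 * card Y"
proof -
  have inj: "inj_on p U" using fin surj by (simp add: finite_surj_inj)
  define F where "F = {Y. Y \<subseteq> U \<and> Y \<inter> p ` Y = {}}"
  have "finite F" "{} \<in> F" using fin unfolding F_def by auto
  then obtain Y where YF: "Y \<in> F" and max: "\<forall>Z\<in>F. Y \<subseteq> Z \<longrightarrow> Y = Z"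
    using finite_has_maximal[of F] by blast
  have Y: "Y \<subseteq> U" "Y \<inter> p ` Y = {}" using YF unfolding F_def by auto
  have finY: "finite Y" using Y fin finite_subset by blast
  have "moved p U \<subseteq> Y \<union> p ` Y \<union> {y\<in>U. p y \<in> Y}"
  proof
    fix y assume y: "y \<in> moved p U"
    show "y \<in> Y \<union> p ` Y \<union> {y\<in>U. p y \<in> Y}"
    proof (rule ccontr)
      assume n: "y \<notin> Y \<union> p ` Y \<union> {y\<in>U. p y \<in> Y}"
      have "insert y Y \<in> F" using n y Y unfolding moved_def F_def by auto
      then show False using max n by blast
    qed
  qed
  then have "card (moved p U) \<le> card (Y \<union> p ` Y \<union> {y\<in>U. p y \<in> Y})"
    using fin finY by (intro card_mono) auto
  also have "\<dots> \<le> card Y + card (p ` Y) + card {y\<in>U. p y \<in> Y}"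
    by (meson add_le_mono1 card_Un_le order_trans)
  also have "card (p ` Y) \<le> card Y" using finY by (rule card_image_le)
  also have "card {y\<in>U. p y \<in> Y} \<le> card Y"
    using inj finY by (intro card_inj_on_le[of p]) (auto intro: inj_on_subset)
  finally show ?thesis using Y by (intro exI[of _ Y]) simp
qed

lemma sum_Pow_power_card:
  fixes t :: "'b::comm_semiring_1"
  assumes "finite A"
  shows "(\<Sum>X\<in>Pow A. t ^ card X) = (1 + t) ^ card A"
proof -
  have "(\<Prod>x\<in>A. t + 1) = (\<Sum>X\<in>Pow A. (\<Prod>x\<in>X. t) * (\<Prod>x\<in>A-X. 1))"
    by (rule prod_add[OF assms])
  then show ?thesis by (simp add: add.commute)
qed

text \<open>Membership of \<open>y \<in> Y\<close> and of \<open>p y\<close> in an invariant set are equivalent, so the pairs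
  \<open>{y, p y}\<close> contribute \<open>1 + t\<^sup>2\<close> instead of \<open>(1 + t)\<^sup>2\<close> to the generating function.\<close>

lemma sum_inv_subsets_le:
  fixes t :: real
  assumes fin: "finite U" and surj: "p ` U = U" and YU: "Y \<subseteq> U" and Y: "Y \<inter> p ` Y = {}"
    and t: "t \<ge> 0"
  shows "t ^ k * card (inv_subsets p U k) \<le> (1 + t\<^sup>2) ^ card Y * (1 + t) ^ (card U - 2 * card Y)"
proof -
  have inj: "inj_on p U" using fin surj by (simp add: finite_surj_inj)
  define W where "W = U - (Y \<union> p ` Y)"
  let ?f = "\<lambda>X. (X \<inter> Y, X \<inter> W)"
  let ?w = "\<lambda>(A, B). (t\<^sup>2) ^ card A * t ^ card B"
  have finY: "finite Y" using YU fin finite_subset by blast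
  have finW: "finite W" using fin unfolding W_def by simp
  have cpY: "card (p ` Z) = card Z" if "Z \<subseteq> U" for Z
    using inj that by (meson card_image inj_on_subset)
  have cW: "card W = card U - 2 * card Y"
  proof -
    have "card (Y \<union> p ` Y) = 2 * card Y"
      using Y finY cpY[OF YU] by (simp add: card_Un_disjoint)
    moreover have "Y \<union> p ` Y \<subseteq> U" using YU surj by blast
    ultimately show ?thesis unfolding W_def using finY by (subst card_Diff_subset) auto
  qed
  have decomp: "X = (X \<inter> Y) \<union> p ` (X \<inter> Y) \<union> (X \<inter> W)" if X: "X \<in> inv_subsets p U k" for X
  proof -
    have XU: "X \<subseteq> U" and pX: "p ` X = X" using X unfolding inv_subsets_def by auto
    have "X \<inter> p ` Y \<subseteq> p ` (X \<inter> Y)"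
    proof
      fix z assume z: "z \<in> X \<inter> p ` Y"
      then obtain y x where "y \<in> Y" "z = p y" "x \<in> X" "z = p x" using pX by blast
      then show "z \<in> p ` (X \<inter> Y)" using inj XU YU by (metis IntI image_eqI inj_onD subsetD)
    qed
    then show ?thesis using XU pX unfolding W_def by blast
  qed
  have "t ^ k * card (inv_subsets p U k) = (\<Sum>X\<in>inv_subsets p U k. t ^ k)" by simp
  also have "\<dots> = (\<Sum>X\<in>inv_subsets p U k. ?w (?f X))"
  proof (rule sum.cong[OF refl])
    fix X assume X: "X \<in> inv_subsets p U k"
    then have XU: "X \<subseteq> U" and cX: "card X = k" unfolding inv_subsets_def by auto
    have finX: "finite X" using XU fin finite_subset by blast
    have "card X = card ((X \<inter> Y) \<union> p ` (X \<inter> Y) \<union> (X \<inter> W))" using decomp[OF X] by simp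
    also have "\<dots> = card (X \<inter> Y) + card (p ` (X \<inter> Y)) + card (X \<inter> W)"
      using Y finX unfolding W_def by (subst card_Un_disjoint; (subst card_Un_disjoint)?) auto
    also have "card (p ` (X \<inter> Y)) = card (X \<inter> Y)" using XU by (intro cpY) auto
    finally have "k = 2 * card (X \<inter> Y) + card (X \<inter> W)" using cX by simp
    then show "t ^ k = ?w (?f X)" by (simp add: power_add power_mult)
  qed
  also have "\<dots> = (\<Sum>z\<in>?f ` inv_subsets p U k. ?w z)"
  proof (rule sum.reindex_cong[symmetric])
    show "inj_on ?f (inv_subsets p U k)"
    proof (rule inj_onI)
      fix X X' assume X: "X \<in> inv_subsets p U k" and X': "X' \<in> inv_subsets p U k"
        and "?f X = ?f X'"
      then have "X \<inter> Y = X' \<inter> Y" "X \<inter> W = X' \<inter> W" by auto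
      then show "X = X'" using decomp[OF X] decomp[OF X'] by simp
    qed
  qed auto
  also have "\<dots> \<le> (\<Sum>z\<in>Pow Y \<times> Pow W. ?w z)"
    using finY finW t by (intro sum_mono2) auto
  also have "\<dots> = (\<Sum>A\<in>Pow Y. (t\<^sup>2) ^ card A) * (\<Sum>B\<in>Pow W. t ^ card B)"
    by (simp add: sum.cartesian_product sum_product)
  also have "\<dots> = (1 + t\<^sup>2) ^ card Y * (1 + t) ^ (card U - 2 * card Y)"
    using sum_Pow_power_card[OF finY, of "t\<^sup>2"] sum_Pow_power_card[OF finW, of t] cW by simp
  finally show ?thesis .
qed

text \<open>For \<open>t = k / (N - k)\<close> the \<open>k\<close>-th term of the binomial expansion of \<open>(1 + t) ^ N\<close> is the
  largest one.\<close>

lemma binomial_mode_ge: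
  fixes N k :: nat
  assumes k: "k < N"
  defines "t \<equiv> real k / real (N - k)"
  shows "(1 + t) ^ N \<le> (real N + 1) * (real (N choose k) * t ^ k)"
proof -
  define u where "u = (\<lambda>i. real (N choose i) * t ^ i)"
  have t: "t \<ge> 0" unfolding t_def by simp
  have ratio: "real (Suc i) * u (Suc i) = (real (N - i) * t) * u i" for i
  proof -
    have "real (Suc i) * real (N choose Suc i) = real (N - i) * real (N choose i)"
      using Suc_times_binomial_Suc[of i N] by (metis of_nat_mult)
    then show ?thesis unfolding u_def by (simp add: algebra_simps)
  qed
  have upos: "u i \<ge> 0" for i unfolding u_def using t by simp
  have up: "u i \<le> u (Suc i)" if "Suc i \<le> k" for i
  proof -
    have "real (Suc i) * real (N - k) \<le> real k * real (N - i)"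
      using that k by (intro mult_mono) auto
    then have "real (Suc i) \<le> real (N - i) * t" unfolding t_def using k by (simp add: field_simps)
    then have "real (Suc i) * u i \<le> real (Suc i) * u (Suc i)"
      unfolding ratio using upos by (rule mult_right_mono)
    then show ?thesis by simp
  qed
  have down: "u (Suc i) \<le> u i" if "k \<le> i" for i
  proof -
    have "real k * real (N - i) \<le> real (Suc i) * real (N - k)"
      using that k by (intro mult_mono) auto
    then have "real (N - i) * t \<le> real (Suc i)" unfolding t_def using k by (simp add: field_simps)
    then have "real (Suc i) * u (Suc i) \<le> real (Suc i) * u i"
      unfolding ratio using upos by (rule mult_right_mono)
    then show ?thesis by simp
  qed
  have le: "u i \<le> u k" for i
  proof (cases "i \<le> k")
    case True
    then show ?thesis
    proof (induction rule: inc_induct)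
      case (step i)
      then show ?case using up[of i] by linarith
    qed simp
  next
    case False
    then have "k \<le> i" by simp
    then show ?thesis
    proof (induction rule: dec_induct)
      case (step i)
      then show ?case using down[of i] by linarith
    qed simp
  qed
  have "(1 + t) ^ N = (t + 1) ^ N" by (simp add: add.commute)
  also have "\<dots> = (\<Sum>i\<le>N. u i)" unfolding u_def by (subst binomial_ring) simp
  also have "\<dots> \<le> (\<Sum>i\<le>N. u k)" by (intro sum_mono le)
  also have "\<dots> = (real N + 1) * u k" by simp
  finally show ?thesis unfolding u_def .
qed

text \<open>At least three quarters of the points are moved, and a third of these is independent, so
  there are \<open>M \<ge> N / 4\<close> pairs \<open>{y, p y}\<close>. Compared with
  \<open>(1 + t) ^ N\<close>, each pair gains the factor \<open>q = 1 - 2 * t / (1 + t)^2\<close>,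
  which for \<open>t = k / (N - k)\<close> and \<open>2 * k \<le> N\<close> is at most
  \<open>1 - k / N\<close>. The factor \<open>N + 1\<close> is the price for comparing the whole
  binomial expansion with its largest term.\<close>

lemma inv_subsets_ratio_le_exp:
  assumes fin: "finite U" and surj: "p ` U = U" and k: "0 < k" "2 * k \<le> card U"
    and f: "4 * card (fixpts p U) \<le> card U"
  shows "real (card (inv_subsets p U k)) / real (card U choose k)
    \<le> (real (card U) + 1) * exp (- real k / 4)"
proof -
  obtain Y where Y: "Y \<subseteq> U" "Y \<inter> p ` Y = {}" "card (moved p U) \<le> 3 * card Y"
    using exists_independent_third[OF fin surj] by blast
  define N where "N = card U"
  define M where "M = card Y"
  have inj: "inj_on p U" using fin surj by (simp add: finite_surj_inj)
  have finY: "finite Y" using Y fin finite_subset by blast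
  have M4: "N \<le> 4 * M" using Y(3) f card_fixpts_moved[OF fin, of p] unfolding N_def M_def by linarith
  have M2: "2 * M \<le> N"
  proof -
    have "card (Y \<union> p ` Y) = 2 * M"
      using Y finY card_image[OF inj_on_subset[OF inj Y(1)]]
      by (simp add: card_Un_disjoint M_def)
    moreover have "Y \<union> p ` Y \<subseteq> U" using Y surj by blast
    ultimately show ?thesis using card_mono[OF fin] unfolding N_def by metis
  qed
  have kN: "2 * k \<le> N" "k < N" "N > 0" using k unfolding N_def by auto
  define t where "t = real k / real (N - k)"
  have t: "t > 0" using kN k unfolding t_def by simp
  define q where "q = (1 + t\<^sup>2) / (1 + t)\<^sup>2"
  have q0: "q \<ge> 0" unfolding q_def by simp
  have "(1 + t)\<^sup>2 > 0" using t by (simp add: zero_less_power)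
  have qeq: "1 - q = 2 * t / (1 + t)\<^sup>2"
    unfolding q_def using \<open>(1 + t)\<^sup>2 > 0\<close> by (simp add: field_simps power2_eq_square)
  have "1 + t = real N / real (N - k)" unfolding t_def using kN by (simp add: field_simps of_nat_diff)
  then have "1 - q = 2 * real k * real (N - k) / (real N)\<^sup>2"
    unfolding qeq unfolding t_def using kN by (simp add: field_simps power2_eq_square)
  moreover have "2 * real k * real (N - k) / (real N)\<^sup>2 \<ge> real k / real N"
  proof -
    have "real N \<le> 2 * real (N - k)" using kN by (simp add: of_nat_diff)
    then have "real k * real N * real N \<le> real k * real N * (2 * real (N - k))"
      by (intro mult_left_mono) auto
    then show ?thesis using kN by (simp add: field_simps power2_eq_square)
  qed
  ultimately have "q \<le> 1 + (- (real k / real N))" by simp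
  also have "\<dots> \<le> exp (- (real k / real N))" by (rule exp_ge_add_one_self)
  finally have "q ^ M \<le> exp (- (real k / real N)) ^ M" using q0 by (rule power_mono)
  also have "\<dots> = exp (- (real k * real M / real N))" by (simp flip: exp_of_nat_mult add: mult_ac)
  also have "\<dots> \<le> exp (- real k / 4)"
  proof -
    have "real k * real N \<le> real k * (4 * real M)"
      using M4 by (intro mult_left_mono) linarith+
    then show ?thesis using kN by (simp add: field_simps)
  qed
  finally have qM: "q ^ M \<le> exp (- real k / 4)" .
  have pos: "real (N choose k) * t ^ k > 0" using kN t by (simp add: zero_less_binomial)
  have "t ^ k * card (inv_subsets p U k) \<le> (1 + t\<^sup>2) ^ M * (1 + t) ^ (N - 2 * M)"
    using sum_inv_subsets_le[OF fin surj Y(1,2), of t k] t unfolding N_def M_def by simp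
  also have "\<dots> = q ^ M * (1 + t) ^ N"
  proof -
    have "(1 + t) ^ N = ((1 + t)\<^sup>2) ^ M * (1 + t) ^ (N - 2 * M)"
      using M2 by (simp flip: power_mult power_add)
    moreover have "q ^ M * ((1 + t)\<^sup>2) ^ M = (1 + t\<^sup>2) ^ M"
      unfolding q_def using t by (simp flip: power_mult_distrib)
    ultimately show ?thesis by (metis mult.assoc)
  qed
  also have "\<dots> \<le> exp (- real k / 4) * ((real N + 1) * (real (N choose k) * t ^ k))"
    using qM binomial_mode_ge[OF kN(2)] t unfolding t_def[symmetric] by (intro mult_mono) auto
  finally have "t ^ k * card (inv_subsets p U k) \<le>
      t ^ k * (exp (- real k / 4) * (real N + 1) * real (N choose k))" by (simp add: mult_ac)
  then have "card (inv_subsets p U k) \<le> exp (- real k / 4) * (real N + 1) * real (N choose k)"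
    using t by (subst (asm) mult_le_cancel_left_pos) auto
  then show ?thesis using pos kN unfolding N_def[symmetric]
    by (simp add: pos_divide_le_eq zero_less_binomial mult_ac)
qed

section \<open>Centralizers in the symmetric group\<close>

definition centr :: "'a set \<Rightarrow> ('a \<Rightarrow> 'a) \<Rightarrow> ('a \<Rightarrow> 'a) set" where
  "centr S h = {a. a permutes S \<and> a \<circ> h = h \<circ> a}"

lemma finite_centr: "finite S \<Longrightarrow> finite (centr S h)"
  unfolding centr_def using finite_permutations by (rule finite_subset[rotated]) auto

lemma commute_funpow_apply:
  assumes "a \<circ> h = h \<circ> a"
  shows "a ((h ^^ i) x) = (h ^^ i) (a x)"
proof (induction i)
  case (Suc i)
  have "a (h y) = h (a y)" for y using assms by (metis comp_apply)
  then show ?case using Suc by simp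
qed simp

lemma centr_eq_on_generated:
  assumes "generates h R X" "a \<circ> h = h \<circ> a" "b \<circ> h = h \<circ> b"
    and "\<And>r. r \<in> R \<Longrightarrow> a r = b r" and "y \<in> X"
  shows "a y = b y"
proof -
  obtain r i where "r \<in> R" "y = (h ^^ i) r" using assms(1,5) unfolding generates_def by blast
  then show ?thesis using commute_funpow_apply assms(2-4) by metis
qed

lemma permutes_image_moved:
  assumes "h permutes S"
  shows "h ` moved h S = moved h S"
proof -
  have "h ` S = S" using assms by (rule permutes_image)
  then have "h ` (S \<inter> moved h S) = S \<inter> moved h S"
    using assms by (intro image_Int_moved) (auto simp: permutes_inj_on)
  moreover have "S \<inter> moved h S = moved h S" unfolding moved_def by auto
  ultimately show ?thesis by simp
qed

lemma exists_half_generating_moved: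
  assumes "finite S" "h permutes S"
  shows "\<exists>R\<subseteq>moved h S. generates h R (moved h S) \<and> 2 * card R \<le> card (moved h S)"
  using finite_moved[OF assms(1)] permutes_image_moved[OF assms(2)]
  by (rule exists_half_generating) (auto simp: moved_def)

text \<open>A permutation commuting with \<open>h\<close> permutes the fixed points of \<open>h\<close>, and on the moved points
  it is determined by its values on a generating set.\<close>

lemma card_centr_le_moved:
  assumes fin: "finite S" and h: "h permutes S"
  shows "card (centr S h) \<le> fact (card S - card (moved h S)) *
    card (moved h S) ^ (card (moved h S) div 2)"
proof -
  define F where "F = fixpts h S"
  define M where "M = moved h S"
  obtain R where R: "R \<subseteq> M" "generates h R M" "2 * card R \<le> card M"
    using exists_half_generating_moved[OF assms] unfolding M_def by blast
  have finM: "finite M" and finF: "finite F"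
    using finite_moved[OF fin] finite_fixpts[OF fin] unfolding M_def F_def by auto
  have finR: "finite R" using R finM finite_subset by blast
  have cF: "card F = card S - card M"
    using card_fixpts_moved[OF fin, of h] unfolding F_def M_def by linarith
  \<comment> \<open>The first component is extended by the identity to become a permutation of
    \<open>F\<close> in the sense of \<open>permutes\<close>; the second is extensional, so that it
    lies in a function space that can be counted.\<close>
  let ?f = "\<lambda>a. (\<lambda>x. if x \<in> F then a x else x, restrict a R)"
  have "inj_on ?f (centr S h)"
  proof (rule inj_onI)
    fix a b assume a: "a \<in> centr S h" and b: "b \<in> centr S h" and eq: "?f a = ?f b"
    have "restrict a R = restrict b R" using eq by simp
    then have R_eq: "a r = b r" if "r \<in> R" for r using that by (metis restrict_apply')
    have F_eq: "(\<lambda>x. if x \<in> F then a x else x) = (\<lambda>x. if x \<in> F then b x else x)"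
      using eq by simp
    show "a = b"
    proof
      fix x
      consider "x \<in> F" | "x \<in> M" | "x \<notin> S" unfolding F_def M_def fixpts_def moved_def by blast
      then show "a x = b x"
      proof cases
        case 1
        then show ?thesis using fun_cong[OF F_eq, of x] by simp
      next
        case 2
        then show ?thesis
          using a b R_eq centr_eq_on_generated[OF R(2), of a b x] unfolding centr_def by simp
      next
        case 3
        then show ?thesis using a b unfolding centr_def permutes_def by simp
      qed
    qed
  qed
  moreover have "?f ` centr S h \<subseteq> {p. p permutes F} \<times> (R \<rightarrow>\<^sub>E M)"
  proof (rule image_subsetI)
    fix a assume a: "a \<in> centr S h"
    then have ap: "a permutes S" and ac: "\<And>x. a (h x) = h (a x)"
      unfolding centr_def by (auto simp: fun_eq_iff)
    have aS: "a x \<in> S" if "x \<in> S" for x using that permutes_in_image[OF ap] by simp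
    have "a ` F \<subseteq> F"
    proof (rule image_subsetI)
      fix x assume "x \<in> F"
      then show "a x \<in> F" using ac[of x] aS unfolding F_def fixpts_def by simp
    qed
    then have "bij_betw a F F"
      using permutes_inj_on[OF ap] finF by (simp add: bij_betw_def endo_inj_surj)
    then have "(\<lambda>x. if x \<in> F then a x else x) permutes F"
      by (intro bij_imp_permutes) (auto cong: bij_betw_cong)
    moreover have "a x \<in> M" if "x \<in> M" for x
    proof -
      have "h x \<noteq> x" using that unfolding M_def moved_def by simp
      then have "a (h x) \<noteq> a x" using injD[OF permutes_inj[OF ap]] by blast
      then have "h (a x) \<noteq> a x" by (simp only: ac not_False_eq_True)
      then show ?thesis using that aS unfolding M_def moved_def by auto
    qed
    ultimately show "?f a \<in> {p. p permutes F} \<times> (R \<rightarrow>\<^sub>E M)" using R(1) by auto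
  qed
  moreover have "finite ({p. p permutes F} \<times> (R \<rightarrow>\<^sub>E M))"
    using finite_permutations[OF finF] finR finM by (intro finite_cartesian_product finite_PiE) auto
  ultimately have "card (centr S h) \<le> card ({p. p permutes F} \<times> (R \<rightarrow>\<^sub>E M))"
    by (rule card_inj_on_le)
  also have "\<dots> = fact (card F) * card M ^ card R"
    using finR finF by (simp add: card_cartesian_product card_PiE card_permutations)
  also have "\<dots> \<le> fact (card F) * card M ^ (card M div 2)"
  proof (cases "card M = 0")
    case False
    then show ?thesis using R(3) by (intro mult_left_mono power_increasing) auto
  qed (use R(3) in auto)
  finally show ?thesis using cF unfolding M_def by simp
qed

section \<open>Number of cycles and the rising factorial\<close>

text \<open>For a permutation of a finite set this is the number of its cycles.\<close>

definition gen_rank :: "('a \<Rightarrow> 'a) \<Rightarrow> 'a set \<Rightarrow> nat" where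
  "gen_rank p S = (LEAST m. \<exists>R\<subseteq>S. generates p R S \<and> card R = m)"

lemma gen_rank_le: "R \<subseteq> S \<Longrightarrow> generates p R S \<Longrightarrow> gen_rank p S \<le> card R"
  unfolding gen_rank_def by (rule Least_le) blast

lemma gen_rank_witness: "\<exists>R\<subseteq>S. generates p R S \<and> card R = gen_rank p S"
  unfolding gen_rank_def
  by (rule LeastI[of "\<lambda>m. \<exists>R\<subseteq>S. generates p R S \<and> card R = m" "card S"])
     (use generates_self in blast)

text \<open>A commuting permutation is determined by its values on one point of each cycle.\<close>

lemma card_centr_le_gen_rank:
  assumes fin: "finite S"
  shows "card (centr S h) \<le> card S ^ gen_rank h S"
proof -
  obtain R where R: "R \<subseteq> S" "generates h R S" "card R = gen_rank h S"
    using gen_rank_witness[of S h] by blast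
  have finR: "finite R" using R fin finite_subset by blast
  have "inj_on (\<lambda>a. restrict a R) (centr S h)"
  proof (rule inj_onI)
    fix a b assume a: "a \<in> centr S h" and b: "b \<in> centr S h"
      and eq: "restrict a R = restrict b R"
    have R_eq: "a r = b r" if "r \<in> R" for r using eq that by (metis restrict_apply')
    show "a = b"
    proof
      fix x
      show "a x = b x"
        using a b R_eq centr_eq_on_generated[OF R(2), of a b x] permutes_not_in[of a S x]
          permutes_not_in[of b S x]
        unfolding centr_def by (cases "x \<in> S") auto
    qed
  qed
  moreover have "(\<lambda>a. restrict a R) ` centr S h \<subseteq> R \<rightarrow>\<^sub>E S"
  proof (rule image_subsetI)
    fix a assume "a \<in> centr S h"
    then have "a x \<in> S" if "x \<in> S" for x
      using that permutes_in_image[of a S x] unfolding centr_def by simp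
    then show "restrict a R \<in> R \<rightarrow>\<^sub>E S" using R(1) by auto
  qed
  moreover have "finite (R \<rightarrow>\<^sub>E S)" using fin finR by (intro finite_PiE) auto
  ultimately have "card (centr S h) \<le> card (R \<rightarrow>\<^sub>E S)" by (rule card_inj_on_le)
  also have "\<dots> = card S ^ gen_rank h S" using finR R(3) by (simp add: card_PiE)
  finally show ?thesis .
qed

text \<open>Each fixed point generates itself, and half of the moved points suffice for the
  rest.\<close>

lemma gen_rank_le_moved:
  assumes fin: "finite S" and h: "h permutes S"
  shows "gen_rank h S \<le> card S - card (moved h S) + card (moved h S) div 2"
proof -
  obtain R where R: "R \<subseteq> moved h S" "generates h R (moved h S)" "2 * card R \<le> card (moved h S)"
    using exists_half_generating_moved[OF assms] by blast
  have S: "fixpts h S \<union> moved h S = S" unfolding fixpts_def moved_def by blast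
  have "generates h (fixpts h S \<union> R) S"
    using generates_Un[OF generates_self[of h "fixpts h S"] R(2)] S by simp
  moreover have "fixpts h S \<union> R \<subseteq> S" using R(1) S by blast
  ultimately have "gen_rank h S \<le> card (fixpts h S \<union> R)" by (intro gen_rank_le)
  also have "\<dots> \<le> card (fixpts h S) + card R" by (rule card_Un_le)
  finally show ?thesis using R(3) card_fixpts_moved[OF fin, of h] by linarith
qed

text \<open>A generator reaches at most \<open>l\<close> points when the \<open>l\<close>-th power
  is the identity. Hence roots of the identity of small order have many cycles, which makes them
  rare.\<close>

lemma card_le_times_gen_rank:
  assumes fin: "finite S" and l: "l > 0" and id: "\<And>x. (h ^^ l) x = x"
  shows "card S \<le> l * gen_rank h S"
proof -
  obtain R where R: "R \<subseteq> S" "generates h R S" "card R = gen_rank h S"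
    using gen_rank_witness[of S h] by blast
  have finR: "finite R" using R fin finite_subset by blast
  have "S \<subseteq> (\<lambda>(i, r). (h ^^ i) r) ` ({..<l} \<times> R)"
  proof
    fix y assume "y \<in> S"
    then obtain r i where r: "r \<in> R" "y = (h ^^ i) r" using R(2) unfolding generates_def by blast
    then have "y = (h ^^ (i mod l)) r" using id by (simp add: funpow_mod_eq)
    then show "y \<in> (\<lambda>(i, r). (h ^^ i) r) ` ({..<l} \<times> R)"
      using r l by (intro image_eqI[of _ _ "(i mod l, r)"]) auto
  qed
  then have "card S \<le> card ({..<l} \<times> R)" using finR by (intro surj_card_le) auto
  then show ?thesis using R(3) by (simp add: card_cartesian_product)
qed

text \<open>Composing with \<open>transpose a b\<close> inserts \<open>a\<close> in front of \<open>b\<close> into a cycle of \<open>q\<close>.\<close>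

lemma generates_transpose:
  assumes q: "q permutes S" and a: "a \<notin> S" and b: "b \<in> S" and gen: "generates q R S"
    and R: "R \<subseteq> S"
  shows "generates (transpose a b \<circ> q) R (insert a S)"
proof -
  let ?p = "transpose a b \<circ> q"
  have qa: "q a = a" using q a by (simp add: permutes_not_in)
  have pa: "?p a = b" using qa by simp
  \<comment> \<open>One step of \<open>q\<close> into \<open>b\<close> becomes two steps, the detour
    through \<open>a\<close>; all other steps are unchanged.\<close>
  have step: "\<exists>j. q y = (?p ^^ j) y" if "y \<in> S" for y
  proof (cases "q y = b")
    case True
    then have "?p (?p y) = b" using pa by simp
    then have "q y = (?p ^^ 2) y" using True by (simp add: numeral_2_eq_2)
    then show ?thesis by blast
  next
    case False
    moreover have "q y \<noteq> a" using that a permutes_in_image[OF q] by metis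
    ultimately have "q y = (?p ^^ 1) y" by simp
    then show ?thesis by blast
  qed
  have reach: "\<exists>j. (q ^^ i) r = (?p ^^ j) r" if r: "r \<in> S" for r i
  proof (induction i)
    case 0
    then show ?case by (metis funpow_0)
  next
    case (Suc i)
    then obtain j where j: "(q ^^ i) r = (?p ^^ j) r" by blast
    have "(q ^^ i) r \<in> S" using funpow_in_image_invariant[OF permutes_image[OF q] r] .
    then obtain j' where "q ((q ^^ i) r) = (?p ^^ j') ((q ^^ i) r)" using step by blast
    then have "(q ^^ Suc i) r = (?p ^^ (j' + j)) r" using j by (simp add: funpow_add)
    then show ?case by blast
  qed
  have main: "\<exists>r\<in>R. \<exists>i. y = (?p ^^ i) r" if y: "y \<in> S" for y
  proof -
    obtain r i where r: "r \<in> R" "y = (q ^^ i) r"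
      using gen y unfolding generates_def by blast
    then obtain j where "y = (?p ^^ j) r" using reach[of r i] R by blast
    then show ?thesis using r by blast
  qed
  have "\<exists>r\<in>R. \<exists>i. a = (?p ^^ i) r"
  proof -
    have "b \<in> q ` S" using b permutes_image[OF q] by simp
    then obtain z where z: "z \<in> S" "q z = b" by blast
    then have "?p z = a" by simp
    moreover obtain r i where "r \<in> R" "z = (?p ^^ i) r" using main[OF z(1)] by blast
    ultimately have "a = (?p ^^ Suc i) r" by simp
    then show ?thesis using \<open>r \<in> R\<close> by blast
  qed
  then show ?thesis using main unfolding generates_def by blast
qed

lemma gen_rank_transpose_le:
  assumes q: "q permutes S" and a: "a \<notin> S" and b: "b \<in> S"
  shows "gen_rank (transpose a b \<circ> q) (insert a S) \<le> gen_rank q S"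
proof -
  obtain R where R: "R \<subseteq> S" "generates q R S" "card R = gen_rank q S"
    using gen_rank_witness[of S q] by blast
  have "gen_rank (transpose a b \<circ> q) (insert a S) \<le> card R"
    using generates_transpose[OF q a b R(2,1)] R(1) by (intro gen_rank_le) auto
  then show ?thesis using R(3) by simp
qed

lemma gen_rank_insert_le: "gen_rank q (insert a S) \<le> Suc (gen_rank q S)"
proof -
  obtain R where R: "R \<subseteq> S" "generates q R S" "card R = gen_rank q S"
    using gen_rank_witness[of S q] by blast
  have "generates q (insert a R) (insert a S)"
    using generates_Un[OF R(2) generates_self[of q "{a}"]] by simp
  then have "gen_rank q (insert a S) \<le> card (insert a R)" using R(1) by (intro gen_rank_le) auto
  also have "\<dots> \<le> Suc (card R)" by (rule card_insert_le_m1) auto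
  finally show ?thesis using R(3) by simp
qed

text \<open>Each permutation of \<open>insert a S\<close> is \<open>transpose a b \<circ> q\<close>
  for exactly one \<open>b\<close> in \<open>insert a S\<close> and one permutation \<open>q\<close>
  of \<open>S\<close>. The choice \<open>b = a\<close> adds a fixed point and hence a factor
  \<open>x\<close>; each of the \<open>card S\<close> other choices inserts \<open>a\<close> into an
  existing cycle. Together this is the new factor \<open>x + card S\<close>.\<close>

lemma sum_power_gen_rank_le:
  fixes x :: nat
  assumes "finite S" and x: "x \<ge> 1"
  shows "(\<Sum>p | p permutes S. x ^ gen_rank p S) \<le> (\<Prod>i<card S. x + i)"
  using assms(1)
proof (induction S rule: finite_induct)
  case empty
  have "gen_rank id ({}::'a set) \<le> card ({}::'a set)"
    by (rule gen_rank_le) (auto simp: generates_def)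
  then show ?case by (simp add: permutes_empty id_def)
next
  case (insert a S)
  let ?G = "\<Sum>q | q permutes S. x ^ gen_rank q S"
  have "(\<Sum>p | p permutes insert a S. x ^ gen_rank p (insert a S)) =
      (\<Sum>b\<in>insert a S. \<Sum>q | q permutes S. x ^ gen_rank (transpose a b \<circ> q) (insert a S))"
    using insert.hyps by (intro sum_over_permutations_insert)
  also have "\<dots> = (\<Sum>q | q permutes S. x ^ gen_rank (transpose a a \<circ> q) (insert a S)) +
      (\<Sum>b\<in>S. \<Sum>q | q permutes S. x ^ gen_rank (transpose a b \<circ> q) (insert a S))"
    using insert.hyps by (rule sum.insert)
  also have "\<dots> \<le> (\<Sum>q | q permutes S. x * x ^ gen_rank q S) + (\<Sum>b\<in>S. ?G)"
  proof (intro add_mono sum_mono)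
    fix q
    have "x ^ gen_rank q (insert a S) \<le> x ^ Suc (gen_rank q S)"
      using x by (intro power_increasing gen_rank_insert_le)
    then show "x ^ gen_rank (transpose a a \<circ> q) (insert a S) \<le> x * x ^ gen_rank q S" by simp
  next
    fix b q assume "b \<in> S" "q \<in> {q. q permutes S}"
    then show "x ^ gen_rank (transpose a b \<circ> q) (insert a S) \<le> x ^ gen_rank q S"
      using x insert.hyps by (intro power_increasing gen_rank_transpose_le) auto
  qed
  also have "\<dots> = ?G * (x + card S)" by (simp add: distrib_right mult.commute flip: sum_distrib_left)
  also have "\<dots> \<le> (\<Prod>i<card S. x + i) * (x + card S)"
    using insert.IH by (intro mult_right_mono) auto
  also have "\<dots> = (\<Prod>i<card (insert a S). x + i)" using insert by simp
  finally show ?case .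
qed

text \<open>There are \<open>card S choose s\<close> possible supports and at most
  \<open>fact s\<close> permutations on each; the remaining factor is kept on the left to avoid
  division in \<open>nat\<close>.\<close>

lemma card_permutes_moved_eq:
  assumes fin: "finite S"
  shows "card {h. h permutes S \<and> card (moved h S) = s} * fact (card S - s) \<le> fact (card S)"
proof (cases "s \<le> card S")
  case True
  let ?A = "{M. M \<subseteq> S \<and> card M = s}"
  have finA: "finite ?A" using fin by simp
  have "{h. h permutes S \<and> card (moved h S) = s} \<subseteq> (\<Union>M\<in>?A. {h. h permutes M})"
  proof
    fix h assume "h \<in> {h. h permutes S \<and> card (moved h S) = s}"
    then have h: "h permutes S" "card (moved h S) = s" by auto
    have "h permutes moved h S"
      by (rule permutes_superset[OF h(1)]) (simp add: moved_def)
    moreover have "moved h S \<in> ?A" using h(2) moved_def[of h S] by auto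
    ultimately show "h \<in> (\<Union>M\<in>?A. {h. h permutes M})" by blast
  qed
  moreover have "finite (\<Union>M\<in>?A. {h. h permutes M})"
    using finA fin by (auto intro!: finite_permutations dest: finite_subset)
  ultimately have "card {h. h permutes S \<and> card (moved h S) = s} \<le> card (\<Union>M\<in>?A. {h. h permutes M})"
    by (intro card_mono)
  also have "\<dots> \<le> (\<Sum>M\<in>?A. card {h. h permutes M})" using finA by (rule card_UN_le)
  also have "\<dots> = (\<Sum>M\<in>?A. fact s)"
    using fin by (intro sum.cong refl card_permutations) (auto dest: finite_subset)
  also have "\<dots> = (card S choose s) * fact s" using n_subsets[OF fin] by simp
  finally have "card {h. h permutes S \<and> card (moved h S) = s} * fact (card S - s)
      \<le> (card S choose s) * fact s * fact (card S - s)" by (rule mult_right_mono) simp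
  also have "\<dots> = fact (card S)" using binomial_fact_lemma[OF True] by (simp add: mult_ac)
  finally show ?thesis .
next
  case False
  have "card (moved h S) \<le> card S" for h using fin by (intro card_mono) (auto simp: moved_def)
  then have "{h. h permutes S \<and> card (moved h S) = s} = {}" using False by force
  then have "card {h. h permutes S \<and> card (moved h S) = s} = 0" by (simp only: card.empty)
  then show ?thesis by (simp only: mult_0 zero_le)
qed

section \<open>Explicit estimates for small support\<close>

lemma Suc_power_le: "real (Suc s) ^ s \<le> 3 * real s ^ s"
proof (cases "s = 0")
  case False
  have "(1 + 1 / real s) ^ s \<le> exp (1 / real s) ^ s"
    by (intro power_mono exp_ge_add_one_self) auto
  also have "\<dots> = exp 1" using False by (simp flip: exp_of_nat_mult)
  also have "\<dots> \<le> 3" by (rule exp_le)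
  finally have "real s ^ s * (1 + 1 / real s) ^ s \<le> real s ^ s * 3" by (intro mult_left_mono) auto
  moreover have "real (Suc s) = real s * (1 + 1 / real s)" using False by (simp add: field_simps)
  ultimately show ?thesis by (metis mult.commute power_mult_distrib)
qed simp

text \<open>An elementary stand-in for Stirling's formula, with 3 in place of e.\<close>

lemma self_power_le_fact: "real n ^ n \<le> 3 ^ n * fact n"
proof (induction n)
  case (Suc n)
  have "real (Suc n) ^ Suc n = real (Suc n) * real (Suc n) ^ n" by simp
  also have "\<dots> \<le> real (Suc n) * (3 * (3 ^ n * fact n))"
    using Suc Suc_power_le[of n] by (intro mult_left_mono) auto
  finally show ?case by (simp add: mult_ac)
qed simp

text \<open>One quantity for two purposes: times \<open>fact n\<close> it bounds the order of a
  centralizer of an element moving \<open>s\<close> points, and times \<open>(fact n)^2\<close> the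
  sum of the squared orders over all these elements. In the sum, \<open>s ^ s\<close> is the square
  of the factor \<open>s ^ (s div 2)\<close> in the centralizer bound, and one of the two factors
  \<open>fact (n - s)\<close> is used up by the number of elements.\<close>

definition supp_weight :: "nat \<Rightarrow> nat \<Rightarrow> real" where
  "supp_weight n s = real s ^ s * fact (n - s) / fact n"

text \<open>The step multiplies the weight by at most \<open>3 * Suc s / (n - s)\<close>. This is
  where supports up to a quarter of all points are singled out.\<close>

lemma supp_weight_Suc_le:
  assumes "4 * Suc s \<le> n"
  shows "supp_weight n (Suc s) \<le> supp_weight n s"
proof -
  have "n - s = Suc (n - Suc s)" using assms by simp
  then have f: "fact (n - s) = real (n - s) * fact (n - Suc s)" by (metis fact_Suc of_nat_fact of_nat_mult)
  have "real (Suc s) ^ Suc s = real (Suc s) * real (Suc s) ^ s" by simp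
  also have "\<dots> \<le> real (Suc s) * (3 * real s ^ s)"
    by (intro mult_left_mono Suc_power_le) auto
  also have "\<dots> = (3 * real (Suc s)) * real s ^ s" by simp
  also have "\<dots> \<le> real (n - s) * real s ^ s"
    using assms by (intro mult_right_mono) auto
  finally have "real (Suc s) ^ Suc s * fact (n - Suc s) \<le> real (n - s) * real s ^ s * fact (n - Suc s)"
    by (rule mult_right_mono) simp
  also have "\<dots> = real s ^ s * fact (n - s)" by (simp add: f mult_ac)
  finally show ?thesis unfolding supp_weight_def by (rule divide_right_mono) simp
qed

lemma supp_weight_antimono:
  assumes "4 * s \<le> n" "i \<le> s"
  shows "supp_weight n s \<le> supp_weight n i"
  using assms(2,1)
proof (induction rule: dec_induct)
  case (step s)
  then show ?case using supp_weight_Suc_le[of s n] by simp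
qed simp

lemma supp_weight_2: "n \<ge> 2 \<Longrightarrow> supp_weight n 2 = 4 / (real n * (real n - 1))"
proof -
  assume n: "n \<ge> 2"
  then obtain m where m: "n = Suc (Suc m)" by (metis add_2_eq_Suc le_Suc_ex)
  then have f: "fact n = (real n * (real n - 1)) * fact (n - 2)" by (simp add: algebra_simps)
  show ?thesis unfolding supp_weight_def f by simp
qed

lemma supp_weight_3: "n \<ge> 3 \<Longrightarrow> supp_weight n 3 = 27 / (real n * (real n - 1) * (real n - 2))"
proof -
  assume n: "n \<ge> 3"
  then obtain m where m: "n = Suc (Suc (Suc m))"
    by (metis add_Suc le_Suc_ex numeral_3_eq_3 plus_nat.add_0)
  then have "fact n = real (Suc (Suc (Suc m))) * (real (Suc (Suc m)) * (real (Suc m) * fact m))"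
    by (simp only: fact_Suc of_nat_mult)
  then have f: "fact n = (real n * (real n - 1) * (real n - 2)) * fact (n - 3)"
    using m by (simp add: numeral_3_eq_3)
  show ?thesis unfolding supp_weight_def f by simp
qed

lemma supp_weight_le_2: "n \<ge> 2 \<Longrightarrow> 2 \<le> s \<Longrightarrow> 4 * s \<le> n \<Longrightarrow> supp_weight n s \<le> 8 / (real n)\<^sup>2"
proof -
  assume n: "n \<ge> 2" and s: "2 \<le> s" "4 * s \<le> n"
  have "supp_weight n s \<le> 4 / (real n * (real n - 1))"
    using supp_weight_antimono[OF s(2,1)] supp_weight_2[OF n] by simp
  also have "\<dots> \<le> 4 / (real n * (real n / 2))"
    using n by (intro divide_left_mono mult_left_mono mult_pos_pos) auto
  finally show ?thesis by (simp add: power2_eq_square)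
qed

text \<open>One order better than for \<open>s = 2\<close>, so that the sum over all
  \<open>s\<close> from 3 to \<open>n div 4\<close> is still of order
  \<open>1 / n^2\<close>.\<close>

lemma supp_weight_le_3: "n \<ge> 4 \<Longrightarrow> 3 \<le> s \<Longrightarrow> 4 * s \<le> n \<Longrightarrow> supp_weight n s \<le> 108 / (real n) ^ 3"
proof -
  assume n: "n \<ge> 4" and s: "3 \<le> s" "4 * s \<le> n"
  have "supp_weight n s \<le> 27 / (real n * (real n - 1) * (real n - 2))"
    using supp_weight_antimono[OF s(2,1)] supp_weight_3 n by simp
  also have "\<dots> \<le> 27 / (real n * (real n / 2) * (real n / 2))"
    using n by (intro divide_left_mono mult_mono mult_pos_pos) auto
  finally show ?thesis by (simp add: power3_eq_cube)
qed

abbreviation perms :: "nat \<Rightarrow> (nat \<Rightarrow> nat) set" where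
  "perms n \<equiv> {p. p permutes {1..n}}"

abbreviation cent :: "nat \<Rightarrow> (nat \<Rightarrow> nat) \<Rightarrow> (nat \<Rightarrow> nat) set" where
  "cent n \<equiv> centr {1..n}"

abbreviation supp_size :: "nat \<Rightarrow> (nat \<Rightarrow> nat) \<Rightarrow> nat" where
  "supp_size n h \<equiv> card (moved h {1..n})"

lemma finite_perms: "finite (perms n)"
  by (simp add: finite_permutations)

lemma card_perms: "card (perms n) = fact n"
  by (rule card_permutations) auto

lemma supp_size_ge_2:
  assumes h: "h \<in> perms n" "h \<noteq> id"
  shows "2 \<le> supp_size n h"
proof -
  have hp: "h permutes {1..n}" using h by simp
  have "\<exists>x. h x \<noteq> x" using h(2) by (auto simp: fun_eq_iff)
  then obtain x where x: "h x \<noteq> x" by blast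
  then have "x \<in> {1..n}" using hp permutes_not_in by metis
  then have xm: "x \<in> moved h {1..n}" using x by (simp add: moved_def)
  then have "h x \<in> moved h {1..n}" using permutes_image_moved[OF hp] by blast
  then have "{x, h x} \<subseteq> moved h {1..n}" using xm by simp
  then have "card {x, h x} \<le> supp_size n h" by (intro card_mono finite_moved) auto
  then show ?thesis using x by simp
qed

lemma card_cent_le_supp_weight:
  assumes h: "h \<in> perms n"
  shows "real (card (cent n h)) \<le> fact n * supp_weight n (supp_size n h)"
proof -
  let ?s = "supp_size n h"
  have "card (cent n h) \<le> fact (n - ?s) * ?s ^ (?s div 2)"
    using card_centr_le_moved[of "{1..n}" h] h by simp
  also have "\<dots> \<le> fact (n - ?s) * ?s ^ ?s"
    by (cases "?s = 0") (auto intro!: mult_left_mono power_increasing)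
  finally have "real (card (cent n h)) \<le> real (fact (n - ?s) * ?s ^ ?s)" by (simp only: of_nat_le_iff)
  then show ?thesis unfolding supp_weight_def by (simp add: mult_ac)
qed

lemma sum_card_cent_sq_le_supp_weight:
  "(\<Sum>h | h \<in> perms n \<and> supp_size n h = s. (real (card (cent n h)))\<^sup>2) \<le> (fact n)\<^sup>2 * supp_weight n s"
proof -
  let ?A = "{h. h \<in> perms n \<and> supp_size n h = s}"
  have "(real (card (cent n h)))\<^sup>2 \<le> (fact (n - s))\<^sup>2 * real s ^ s" if "h \<in> ?A" for h
  proof -
    have h: "h permutes {1..n}" "supp_size n h = s" using that by auto
    have "card (cent n h) \<le> fact (n - s) * s ^ (s div 2)"
      using card_centr_le_moved[of "{1..n}" h] h by simp
    then have "card (cent n h) ^ 2 \<le> (fact (n - s) * s ^ (s div 2)) ^ 2" by (rule power_mono) simp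
    also have "\<dots> = (fact (n - s))\<^sup>2 * s ^ (s div 2 * 2)" by (simp add: power_mult_distrib power_mult)
    also have "\<dots> \<le> (fact (n - s))\<^sup>2 * s ^ s"
      by (cases "s = 0") (auto intro!: mult_left_mono power_increasing)
    finally have "real (card (cent n h) ^ 2) \<le> real ((fact (n - s))\<^sup>2 * s ^ s)"
      by (simp only: of_nat_le_iff)
    then show ?thesis by simp
  qed
  then have "(\<Sum>h\<in>?A. (real (card (cent n h)))\<^sup>2) \<le> real (card ?A) * ((fact (n - s))\<^sup>2 * real s ^ s)"
    by (rule sum_bounded_above)
  also have "\<dots> = (real (card ?A) * fact (n - s)) * (fact (n - s) * real s ^ s)"
    by (simp add: power2_eq_square mult_ac)
  also have "\<dots> \<le> fact n * (fact (n - s) * real s ^ s)"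
  proof (rule mult_right_mono)
    have "card ?A * fact (n - s) \<le> fact n" using card_permutes_moved_eq[of "{1..n}" s] by simp
    then have "real (card ?A * fact (n - s)) \<le> real (fact n)" by (simp only: of_nat_le_iff)
    then show "real (card ?A) * fact (n - s) \<le> fact n" by simp
  qed simp
  also have "\<dots> = (fact n)\<^sup>2 * supp_weight n s"
    unfolding supp_weight_def by (simp add: power2_eq_square)
  finally show ?thesis .
qed

section \<open>Asymptotic estimates for centralizers and roots\<close>

text \<open>At \<open>x = n\<close> every factor of the rising factorial is at most
  \<open>2 * n\<close>, and \<open>n ^ n \<le> 3 ^ n * fact n\<close>.\<close>

lemma sum_power_gen_rank_le_fact:
  assumes "n \<ge> 1"
  shows "(\<Sum>p\<in>perms n. real n ^ gen_rank p {1..n}) \<le> 6 ^ n * fact n"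
proof -
  have "(\<Sum>p\<in>perms n. n ^ gen_rank p {1..n}) \<le> (\<Prod>i<n. n + i)"
    using sum_power_gen_rank_le[of "{1..n}" n] assms by simp
  also have "\<dots> \<le> (\<Prod>i<n. 2 * n)" by (intro prod_mono) auto
  also have "\<dots> = (2 * n) ^ n" by simp
  finally have "real (\<Sum>p\<in>perms n. n ^ gen_rank p {1..n}) \<le> real ((2 * n) ^ n)"
    by (simp only: of_nat_le_iff)
  then have "(\<Sum>p\<in>perms n. real n ^ gen_rank p {1..n}) \<le> (2 * real n) ^ n" by simp
  also have "\<dots> = 2 ^ n * real n ^ n" by (simp add: power_mult_distrib)
  also have "\<dots> \<le> 2 ^ n * (3 ^ n * fact n)" by (intro mult_left_mono self_power_le_fact) auto
  also have "\<dots> = 6 ^ n * fact n" by (simp flip: power_mult_distrib)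
  finally show ?thesis .
qed

text \<open>With more than \<open>n / 4\<close> moved points, at most
  \<open>n - s / 2 < 7 * n / 8\<close> generators are needed.\<close>

lemma card_cent_le_powr:
  assumes h: "h \<in> perms n" and s: "n < 4 * supp_size n h" and n: "n \<ge> 1"
  shows "real (card (cent n h)) \<le> real n powr (7 * real n / 8)"
proof -
  let ?s = "supp_size n h"
  have sn: "?s \<le> n" using card_fixpts_moved[of "{1..n}" h] by simp
  have "gen_rank h {1..n} \<le> n - ?s + ?s div 2" using gen_rank_le_moved[of "{1..n}" h] h by simp
  then have "8 * gen_rank h {1..n} \<le> 7 * n" using s sn by linarith
  then have r: "real (gen_rank h {1..n}) \<le> 7 * real n / 8" by linarith
  have "real (card (cent n h)) \<le> real (n ^ gen_rank h {1..n})"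
    using card_centr_le_gen_rank[of "{1..n}" h] by (simp only: of_nat_le_iff) simp
  also have "\<dots> = real n powr real (gen_rank h {1..n})" using n by (simp add: powr_realpow)
  also have "\<dots> \<le> real n powr (7 * real n / 8)" using r n by (intro powr_mono) auto
  finally show ?thesis .
qed

text \<open>Since \<open>fact n \<ge> (n / 3) ^ n\<close>, a factor \<open>n powr (n / 8)\<close> is
  left over, and it outgrows \<open>18 ^ n * n^2\<close>.\<close>

lemma eventually_powr_le_fact:
  "\<forall>\<^sub>F n in sequentially. real n powr (7 * real n / 8) * 6 ^ n \<le> fact n / (real n)\<^sup>2"
proof -
  have "\<forall>\<^sub>F n in sequentially.
      real n powr (7 * real n / 8) * 6 ^ n * 3 ^ n * (real n)\<^sup>2 \<le> real n powr real n"
    by real_asymp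
  then show ?thesis using eventually_gt_at_top[of 0]
  proof eventually_elim
    case (elim n)
    have "real n powr (7 * real n / 8) * 6 ^ n * 3 ^ n * (real n)\<^sup>2 \<le> 3 ^ n * fact n"
      using elim self_power_le_fact[of n] powr_realpow[of "real n" n] by linarith
    then have "3 ^ n * (real n powr (7 * real n / 8) * 6 ^ n * (real n)\<^sup>2) \<le> 3 ^ n * fact n"
      by (simp only: mult_ac)
    then have "real n powr (7 * real n / 8) * 6 ^ n * (real n)\<^sup>2 \<le> fact n"
      by (subst (asm) mult_le_cancel_left_pos) auto
    then show ?case using elim by (simp add: field_simps)
  qed
qed

text \<open>The order \<open>fact n / n^2\<close> is that of the centralizer of a transposition, so
  no non-trivial element does essentially worse.\<close>

lemma eventually_card_cent_le:
  "\<forall>\<^sub>F n in sequentially. \<forall>h\<in>perms n - {id}. real (card (cent n h)) \<le> 8 * fact n / (real n)\<^sup>2"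
  using eventually_powr_le_fact eventually_ge_at_top[of 2]
proof eventually_elim
  case (elim n)
  show ?case
  proof
    fix h assume h: "h \<in> perms n - {id}"
    then have s2: "2 \<le> supp_size n h" using supp_size_ge_2 by blast
    show "real (card (cent n h)) \<le> 8 * fact n / (real n)\<^sup>2"
    proof (cases "4 * supp_size n h \<le> n")
      case True
      have "real (card (cent n h)) \<le> fact n * supp_weight n (supp_size n h)"
        using card_cent_le_supp_weight h by blast
      also have "\<dots> \<le> fact n * (8 / (real n)\<^sup>2)"
        using supp_weight_le_2[OF elim(2) s2 True] by (intro mult_left_mono) auto
      finally show ?thesis by (simp add: mult.commute)
    next
      case False
      then have "real (card (cent n h)) \<le> real n powr (7 * real n / 8)"
        using card_cent_le_powr[of h n] h elim by simp
      also have "\<dots> = real n powr (7 * real n / 8) * 1" by simp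
      also have "\<dots> \<le> real n powr (7 * real n / 8) * 6 ^ n" by (intro mult_left_mono) auto
      also have "\<dots> \<le> fact n / (real n)\<^sup>2" by (rule elim(1))
      also have "\<dots> \<le> 8 * fact n / (real n)\<^sup>2" by (intro divide_right_mono) auto
      finally show ?thesis .
    qed
  qed
qed

lemma eventually_sum_card_cent_sq_le:
  "\<forall>\<^sub>F n in sequentially.
    (\<Sum>h\<in>perms n - {id}. (real (card (cent n h)))\<^sup>2) \<le> 120 * (fact n)\<^sup>2 / (real n)\<^sup>2"
  using eventually_powr_le_fact eventually_ge_at_top[of 4]
proof eventually_elim
  case (elim n)
  let ?w = "\<lambda>h. (real (card (cent n h)))\<^sup>2"
  let ?A = "{h \<in> perms n - {id}. 4 * supp_size n h \<le> n}"
  let ?B = "{h \<in> perms n - {id}. n < 4 * supp_size n h}"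
  have fin: "finite (perms n)" by (rule finite_perms)
  have "(\<Sum>h\<in>perms n - {id}. ?w h) = (\<Sum>h\<in>?A \<union> ?B. ?w h)"
    by (rule sum.cong) auto
  also have "\<dots> = (\<Sum>h\<in>?A. ?w h) + (\<Sum>h\<in>?B. ?w h)"
    using fin by (intro sum.union_disjoint) auto
  also have "(\<Sum>h\<in>?A. ?w h) \<le> 116 * (fact n)\<^sup>2 / (real n)\<^sup>2"
  proof -
    have "(\<Sum>h\<in>?A. ?w h) \<le> (\<Sum>h\<in>(\<Union>s\<in>{2..n div 4}. {h. h \<in> perms n \<and> supp_size n h = s}). ?w h)"
    proof (rule sum_mono2)
      show "finite (\<Union>s\<in>{2..n div 4}. {h. h \<in> perms n \<and> supp_size n h = s})" using fin by simp
      show "?A \<subseteq> (\<Union>s\<in>{2..n div 4}. {h. h \<in> perms n \<and> supp_size n h = s})"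
      proof
        fix h assume h: "h \<in> ?A"
        then have "2 \<le> supp_size n h" using supp_size_ge_2 by blast
        then have "supp_size n h \<in> {2..n div 4}" using h by auto
        then show "h \<in> (\<Union>s\<in>{2..n div 4}. {h. h \<in> perms n \<and> supp_size n h = s})" using h by blast
      qed
    qed simp
    also have "\<dots> = (\<Sum>s\<in>{2..n div 4}. \<Sum>h | h \<in> perms n \<and> supp_size n h = s. ?w h)"
      using fin by (intro sum.UNION_disjoint) auto
    also have "\<dots> \<le> (\<Sum>s\<in>{2..n div 4}. (fact n)\<^sup>2 * supp_weight n s)"
      by (intro sum_mono sum_card_cent_sq_le_supp_weight)
    also have "\<dots> = (fact n)\<^sup>2 * (\<Sum>s\<in>{2..n div 4}. supp_weight n s)" by (simp add: sum_distrib_left)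
    also have "\<dots> \<le> (fact n)\<^sup>2 * (116 / (real n)\<^sup>2)"
    proof (rule mult_left_mono)
      \<comment> \<open>Only \<open>s = 2\<close> reaches the order \<open>1 / n^2\<close>; all
        other terms together cost at most \<open>n * 108 / n^3\<close>, whence 116 = 8 +
        108.\<close>
      have "(\<Sum>s\<in>{2..n div 4}. supp_weight n s) \<le>
          (\<Sum>s\<in>{2..n div 4}. (if s = 2 then 8 / (real n)\<^sup>2 else 0) + 108 / real n ^ 3)"
      proof (rule sum_mono)
        fix s assume s: "s \<in> {2..n div 4}"
        then have s4: "4 * s \<le> n" by auto
        show "supp_weight n s \<le> (if s = 2 then 8 / (real n)\<^sup>2 else 0) + 108 / real n ^ 3"
        proof (cases "s = 2")
          case True
          have "supp_weight n s \<le> 8 / (real n)\<^sup>2"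
            using supp_weight_le_2[of n s] s s4 elim by simp
          moreover have "0 \<le> 108 / real n ^ 3" by simp
          ultimately have "supp_weight n s \<le> 8 / (real n)\<^sup>2 + 108 / real n ^ 3" by linarith
          then show ?thesis using True by simp
        next
          case False
          then show ?thesis using supp_weight_le_3[of n s] s s4 elim by simp
        qed
      qed
      also have "\<dots> = (\<Sum>s\<in>{2..n div 4}. (if s = 2 then 8 / (real n)\<^sup>2 else 0))
          + real (card {2..n div 4}) * (108 / real n ^ 3)" by (simp add: sum.distrib)
      also have "\<dots> \<le> 8 / (real n)\<^sup>2 + real n * (108 / real n ^ 3)"
        by (intro add_mono mult_right_mono) auto
      also have "\<dots> = 116 / (real n)\<^sup>2"
        using elim by (simp add: power3_eq_cube power2_eq_square field_simps)
      finally show "(\<Sum>s\<in>{2..n div 4}. supp_weight n s) \<le> 116 / (real n)\<^sup>2" .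
    qed simp
    finally show ?thesis by (simp add: mult.commute)
  qed
  also have "(\<Sum>h\<in>?B. ?w h) \<le> (fact n)\<^sup>2 / (real n)\<^sup>2"
  proof -
    have n1: "n \<ge> 1" using elim by simp
    \<comment> \<open>Of the two factors of the square, one is bounded uniformly and the other by
      \<open>n ^ gen_rank\<close>, whose sum over all permutations is known.\<close>
    have "(\<Sum>h\<in>?B. ?w h) \<le> (\<Sum>h\<in>?B. real n powr (7 * real n / 8) * real n ^ gen_rank h {1..n})"
    proof (rule sum_mono)
      fix h assume h: "h \<in> ?B"
      have "real (card (cent n h)) \<le> real (n ^ gen_rank h {1..n})"
        using card_centr_le_gen_rank[of "{1..n}" h] by (simp only: of_nat_le_iff) simp
      moreover have "real (card (cent n h)) \<le> real n powr (7 * real n / 8)"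
        using card_cent_le_powr[of h n] h n1 by simp
      ultimately show "?w h \<le> real n powr (7 * real n / 8) * real n ^ gen_rank h {1..n}"
        unfolding power2_eq_square by (intro mult_mono) auto
    qed
    also have "\<dots> \<le> (\<Sum>h\<in>perms n. real n powr (7 * real n / 8) * real n ^ gen_rank h {1..n})"
      using fin by (intro sum_mono2) auto
    also have "\<dots> = real n powr (7 * real n / 8) * (\<Sum>h\<in>perms n. real n ^ gen_rank h {1..n})"
      by (simp add: sum_distrib_left)
    also have "\<dots> \<le> real n powr (7 * real n / 8) * (6 ^ n * fact n)"
      by (intro mult_left_mono sum_power_gen_rank_le_fact n1) auto
    also have "\<dots> = (real n powr (7 * real n / 8) * 6 ^ n) * fact n" by simp
    also have "\<dots> \<le> (fact n / (real n)\<^sup>2) * fact n" by (intro mult_right_mono elim(1)) auto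
    finally show ?thesis by (simp add: power2_eq_square)
  qed
  finally have "(\<Sum>h\<in>perms n - {id}. ?w h) \<le> 117 * ((fact n)\<^sup>2 / (real n)\<^sup>2)" by simp
  also have "\<dots> \<le> 120 * ((fact n)\<^sup>2 / (real n)\<^sup>2)" by (intro mult_right_mono) auto
  finally show ?case by simp
qed

text \<open>Such a permutation has at least \<open>n / 3\<close> cycles and so takes at least
  \<open>n powr (n / 3)\<close> of the sum of \<open>n ^ gen_rank\<close>, which is at most
  \<open>6 ^ n * fact n\<close>.\<close>

lemma eventually_card_roots_le:
  assumes l: "0 < l" "l \<le> (3::nat)"
  shows "\<forall>\<^sub>F n in sequentially. real (card {a \<in> perms n. a ^^ l = id}) \<le> fact n / (real n)\<^sup>2"
proof -
  have "\<forall>\<^sub>F n in sequentially. 6 ^ n * (real n)\<^sup>2 \<le> real n powr (real n / 3)"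
    by real_asymp
  then show ?thesis using eventually_ge_at_top[of 1]
  proof eventually_elim
    case (elim n)
    let ?A = "{a \<in> perms n. a ^^ l = id}"
    have "real (card ?A) * real n powr (real n / 3) = (\<Sum>a\<in>?A. real n powr (real n / 3))" by simp
    also have "\<dots> \<le> (\<Sum>a\<in>?A. real n ^ gen_rank a {1..n})"
    proof (rule sum_mono)
      fix a assume a: "a \<in> ?A"
      then have "n \<le> l * gen_rank a {1..n}"
        using card_le_times_gen_rank[of "{1..n}" l a] l by simp
      also have "\<dots> \<le> 3 * gen_rank a {1..n}" using l by simp
      finally have "real n / 3 \<le> real (gen_rank a {1..n})" by linarith
      then have "real n powr (real n / 3) \<le> real n powr real (gen_rank a {1..n})"
        using elim by (intro powr_mono) auto
      then show "real n powr (real n / 3) \<le> real n ^ gen_rank a {1..n}"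
        using elim by (simp add: powr_realpow)
    qed
    also have "\<dots> \<le> (\<Sum>a\<in>perms n. real n ^ gen_rank a {1..n})"
      using finite_perms by (intro sum_mono2) auto
    also have "\<dots> \<le> 6 ^ n * fact n" using elim by (intro sum_power_gen_rank_le_fact)
    finally have 1: "real (card ?A) * real n powr (real n / 3) \<le> 6 ^ n * fact n" .
    have "real (card ?A) * (6 ^ n * (real n)\<^sup>2) \<le> real (card ?A) * real n powr (real n / 3)"
      using elim by (intro mult_left_mono) auto
    then have "real (card ?A) * (6 ^ n * (real n)\<^sup>2) \<le> 6 ^ n * fact n" using 1 by linarith
    then have "6 ^ n * (real (card ?A) * (real n)\<^sup>2) \<le> 6 ^ n * fact n"
      by (simp only: mult.left_commute)
    then have "real (card ?A) * (real n)\<^sup>2 \<le> fact n"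
      by (subst (asm) mult_le_cancel_left_pos) auto
    then show ?case using elim by (simp add: field_simps)
  qed
qed

section \<open>Burnside's lemma for the two-sided action\<close>

definition tw :: "('a \<Rightarrow> 'a) \<Rightarrow> ('a \<Rightarrow> 'a) \<Rightarrow> ('a \<Rightarrow> 'a) \<Rightarrow> ('a \<Rightarrow> 'a)" where
  "tw a b x = a \<circ> x \<circ> inv' b"

lemma perms_comp: "a \<in> perms n \<Longrightarrow> b \<in> perms n \<Longrightarrow> a \<circ> b \<in> perms n"
  by (simp add: permutes_compose)

lemma perms_inv: "a \<in> perms n \<Longrightarrow> inv' a \<in> perms n"
  by (simp add: permutes_inv)

lemma perms_id: "id \<in> perms n"
  by (simp add: permutes_id)

lemma perms_inv_comp: "a \<in> perms n \<Longrightarrow> inv' a \<circ> a = id" "a \<in> perms n \<Longrightarrow> a \<circ> inv' a = id"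
  using permutes_inv_o by auto

lemma perms_funpow: "a \<in> perms n \<Longrightarrow> a ^^ l \<in> perms n"
  by (induction l) (auto simp: permutes_id permutes_compose)

lemma perms_cancel_left:
  assumes "a \<in> perms n"
  shows "a \<circ> x = a \<circ> y \<longleftrightarrow> x = y"
  using perms_inv_comp(1)[OF assms] by (metis comp_assoc id_comp)

lemma perms_cancel_right:
  assumes "a \<in> perms n"
  shows "x \<circ> a = y \<circ> a \<longleftrightarrow> x = y"
  using perms_inv_comp(2)[OF assms] by (metis comp_assoc comp_id)

lemma tw_in: "a \<in> perms n \<Longrightarrow> b \<in> perms n \<Longrightarrow> x \<in> perms n \<Longrightarrow> tw a b x \<in> perms n"
  unfolding tw_def by (intro perms_comp perms_inv)

lemma tw_comp:
  assumes "b \<in> perms n" "b' \<in> perms n"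
  shows "tw a b (tw a' b' x) = tw (a \<circ> a') (b \<circ> b') x"
proof -
  have "bij b" "bij b'" using assms permutes_bij by auto
  then have "inv' (b \<circ> b') = inv' b' \<circ> inv' b" by (rule o_inv_distrib)
  then show ?thesis unfolding tw_def by (simp add: comp_assoc)
qed

lemma tw_id: "tw id id x = x"
  unfolding tw_def by simp

lemma bij_betw_tw:
  assumes a: "a \<in> perms n" and b: "b \<in> perms n"
  shows "bij_betw (tw a b) (perms n) (perms n)"
proof (rule bij_betw_byWitness[where f' = "tw (inv' a) (inv' b)"])
  note inv = perms_inv[OF a] perms_inv[OF b]
  show "\<forall>x\<in>perms n. tw (inv' a) (inv' b) (tw a b x) = x"
    using tw_comp[OF inv(2) b] perms_inv_comp(1)[OF a] perms_inv_comp(1)[OF b] by (simp add: tw_id)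
  show "\<forall>x\<in>perms n. tw a b (tw (inv' a) (inv' b) x) = x"
    using tw_comp[OF b inv(2)] perms_inv_comp(2)[OF a] perms_inv_comp(2)[OF b] by (simp add: tw_id)
  show "tw a b ` perms n \<subseteq> perms n" using tw_in[OF a b] by blast
  show "tw (inv' a) (inv' b) ` perms n \<subseteq> perms n" using tw_in[OF inv] by blast
qed

lemma tw_image_perms: "a \<in> perms n \<Longrightarrow> b \<in> perms n \<Longrightarrow> tw a b ` perms n = perms n"
  using bij_betw_tw by (rule bij_betw_imp_surj_on)

text \<open>For permutations the fixed points are thus the elements \<open>x\<close> that conjugate
  \<open>b\<close> into \<open>a\<close>.\<close>

lemma tw_fixed_iff: "b \<in> perms n \<Longrightarrow> tw a b x = x \<longleftrightarrow> a \<circ> x = x \<circ> b"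
  unfolding tw_def using perms_inv_comp[of b n] by (metis comp_assoc comp_id)

lemma tw_funpow: "b \<in> perms n \<Longrightarrow> (tw a b ^^ l) x = tw (a ^^ l) (b ^^ l) x"
proof (induction l)
  case 0
  then show ?case using tw_id[of x] by (simp add: id_def)
next
  case (Suc l)
  then show ?case using tw_comp[OF Suc.prems perms_funpow[OF Suc.prems]] by (simp add: comp_def)
qed

lemma k_subsets_eq: "k_subsets n k = {X. X \<subseteq> perms n \<and> card X = k}"
  unfolding k_subsets_def sym_group_def by simp

lemma finite_k_subsets: "finite (k_subsets n k)"
  unfolding k_subsets_eq using finite_perms by simp

lemma two_sided_act_eq:
  assumes "b \<in> perms n"
  shows "two_sided_act n (a, inv' b) X = tw a b ` X"
  unfolding two_sided_act_def tw_def sym_group_def by simp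

lemma tw_k_subsets:
  assumes "a \<in> perms n" "b \<in> perms n" "X \<in> k_subsets n k"
  shows "tw a b ` X \<in> k_subsets n k"
proof -
  have X: "X \<subseteq> perms n" "card X = k" using assms(3) unfolding k_subsets_eq by auto
  have "inj_on (tw a b) X"
    using bij_betw_tw[OF assms(1,2)] X(1) by (meson bij_betw_imp_inj_on inj_on_subset)
  then show ?thesis
    using X tw_in[OF assms(1,2)] unfolding k_subsets_eq by (auto simp: card_image)
qed

text \<open>Because of the inverse in \<open>tw\<close> this is a homomorphism on the direct product, unlike
  \<open>two_sided_act\<close>; it is restricted to the \<open>k\<close>-subsets because \<open>BijGroup\<close> consists of extensional
  functions.\<close>

definition lr_act where
  "lr_act n k g = (\<lambda>X\<in>k_subsets n k. tw (fst g) (snd g) ` X)"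

lemma lr_act_group_action:
  "group_action (sym_group n \<times>\<times> sym_group n) (k_subsets n k) (lr_act n k)"
proof -
  let ?G = "sym_group n \<times>\<times> sym_group n" and ?E = "k_subsets n k"
  have carr: "carrier (sym_group n) = perms n" unfolding sym_group_def by simp
  have comp: "tw a b ` (tw a' b' ` X) = tw (a \<circ> a') (b \<circ> b') ` X"
    if "b \<in> perms n" "b' \<in> perms n" for a b a' b' X
    unfolding image_image using tw_comp[OF that] by simp
  have idX: "tw id id ` X = X" for X :: "(nat \<Rightarrow> nat) set" by (simp add: tw_id)
  have bij: "lr_act n k (a, b) \<in> Bij ?E" if a: "a \<in> perms n" and b: "b \<in> perms n" for a b
  proof -
    note inv = perms_inv[OF a] perms_inv[OF b]
    have "bij_betw (\<lambda>X. tw a b ` X) ?E ?E"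
    proof (rule bij_betw_byWitness[where f' = "\<lambda>X. tw (inv' a) (inv' b) ` X"])
      show "\<forall>X\<in>?E. tw (inv' a) (inv' b) ` tw a b ` X = X"
        using comp[OF inv(2) b] perms_inv_comp(1)[OF a] perms_inv_comp(1)[OF b] idX by simp
      show "\<forall>X\<in>?E. tw a b ` tw (inv' a) (inv' b) ` X = X"
        using comp[OF b inv(2)] perms_inv_comp(2)[OF a] perms_inv_comp(2)[OF b] idX by simp
      show "(\<lambda>X. tw a b ` X) ` ?E \<subseteq> ?E" using tw_k_subsets[OF a b] by blast
      show "(\<lambda>X. tw (inv' a) (inv' b) ` X) ` ?E \<subseteq> ?E" using tw_k_subsets[OF inv] by blast
    qed
    then show ?thesis unfolding lr_act_def Bij_def by (simp add: bij_betw_restrict_eq)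
  qed
  have "lr_act n k \<in> hom ?G (BijGroup ?E)"
  proof (rule homI)
    fix g assume "g \<in> carrier ?G"
    then have "fst g \<in> perms n" "snd g \<in> perms n" unfolding carrier_DirProd carr by auto
    then have "lr_act n k (fst g, snd g) \<in> Bij ?E" by (rule bij)
    then show "lr_act n k g \<in> carrier (BijGroup ?E)" unfolding BijGroup_def by simp
  next
    fix g g' assume "g \<in> carrier ?G" "g' \<in> carrier ?G"
    then obtain a b a' b' where g: "g = (a, b)" "g' = (a', b')"
      "a \<in> perms n" "b \<in> perms n" "a' \<in> perms n" "b' \<in> perms n"
      unfolding carrier_DirProd carr by blast
    have "lr_act n k (a \<circ> a', b \<circ> b') = compose ?E (lr_act n k (a, b)) (lr_act n k (a', b'))"
      using comp[OF g(4,6)] tw_k_subsets[OF g(5,6)] unfolding lr_act_def compose_def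
      by (auto simp: fun_eq_iff)
    then show "lr_act n k (g \<otimes>\<^bsub>?G\<^esub> g') = lr_act n k g \<otimes>\<^bsub>BijGroup ?E\<^esub> lr_act n k g'"
      using bij[OF g(3,4)] bij[OF g(5,6)] g(1,2) unfolding BijGroup_def by (simp add: sym_group_def)
  qed
  then show ?thesis
    unfolding group_action_def group_hom_def group_hom_axioms_def
    using DirProd_group[OF sym_group_is_group sym_group_is_group] group_BijGroup by blast
qed

text \<open>The two actions differ by inverting the second component, which permutes the acting
  pairs.\<close>

lemma orbits_lr_act:
  "orbits (sym_group n \<times>\<times> sym_group n) (k_subsets n k) (lr_act n k) =
   orbits (sym_group n \<times>\<times> sym_group n) (k_subsets n k) (two_sided_act n)"
proof -
  let ?G = "sym_group n \<times>\<times> sym_group n"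
  have carr: "carrier ?G = perms n \<times> perms n" unfolding sym_group_def by simp
  have "orbit ?G (lr_act n k) X = orbit ?G (two_sided_act n) X" if X: "X \<in> k_subsets n k" for X
  proof
    show "orbit ?G (lr_act n k) X \<subseteq> orbit ?G (two_sided_act n) X"
    proof
      fix Y assume "Y \<in> orbit ?G (lr_act n k) X"
      then obtain a b where ab: "a \<in> perms n" "b \<in> perms n" "Y = lr_act n k (a, b) X"
        unfolding orbit_def carr by auto
      then have "Y = two_sided_act n (a, inv' b) X"
        using X two_sided_act_eq[OF ab(2)] unfolding lr_act_def by simp
      then show "Y \<in> orbit ?G (two_sided_act n) X"
        using ab perms_inv[OF ab(2)] unfolding orbit_def carr by blast
    qed
    show "orbit ?G (two_sided_act n) X \<subseteq> orbit ?G (lr_act n k) X"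
    proof
      fix Y assume "Y \<in> orbit ?G (two_sided_act n) X"
      then obtain a b where ab: "a \<in> perms n" "b \<in> perms n" "Y = two_sided_act n (a, b) X"
        unfolding orbit_def carr by auto
      have "inv' (inv' b) = b" using ab(2) by (simp add: permutes_inv_inv)
      then have "Y = lr_act n k (a, inv' b) X"
        using X ab(3) two_sided_act_eq[OF perms_inv[OF ab(2)], of a X] unfolding lr_act_def by simp
      then show "Y \<in> orbit ?G (lr_act n k) X"
        using ab perms_inv[OF ab(2)] unfolding orbit_def carr by blast
    qed
  qed
  then show ?thesis unfolding orbits_def by blast
qed

lemma T_burnside:
  "T n k * (fact n)\<^sup>2 = (\<Sum>(a, b)\<in>perms n \<times> perms n. card (inv_subsets (tw a b) (perms n) k))"
proof -
  let ?G = "sym_group n \<times>\<times> sym_group n"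
  have carr: "carrier ?G = perms n \<times> perms n" unfolding sym_group_def by simp
  interpret group_action ?G "k_subsets n k" "lr_act n k" by (rule lr_act_group_action)
  have "order ?G = (fact n)\<^sup>2"
    unfolding order_def carr by (simp only: card_cartesian_product card_perms power2_eq_square)
  then have "T n k * (fact n)\<^sup>2 = (\<Sum>g\<in>carrier ?G. card (invariants (k_subsets n k) (lr_act n k) g))"
    using burnside[OF _ finite_k_subsets] finite_perms
    unfolding T_def orbits_lr_act carr by simp
  also have "\<dots> = (\<Sum>g\<in>perms n \<times> perms n. card (inv_subsets (tw (fst g) (snd g)) (perms n) k))"
  proof (rule sum.cong[OF carr], rule arg_cong[where f = card])
    fix g
    show "invariants (k_subsets n k) (lr_act n k) g = inv_subsets (tw (fst g) (snd g)) (perms n) k"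
      unfolding invariants_def inv_subsets_def lr_act_def k_subsets_eq by auto
  qed
  finally show ?thesis by (simp add: case_prod_unfold)
qed

section \<open>Double counting of fixed points and cycle points\<close>

text \<open>Count pairs \<open>(b, x)\<close>: a given \<open>x\<close> is fixed by exactly one
  \<open>b\<close>, the conjugate of \<open>a\<close> by \<open>x\<close>. The weight is left free,
  since functions of the number of fixed points and numbers of cycle points are put in for
  it.\<close>

lemma sum_fixpts_weighted:
  fixes w :: "(nat \<Rightarrow> nat) \<Rightarrow> (nat \<Rightarrow> nat) \<Rightarrow> real"
  assumes a: "a \<in> perms n"
  shows "(\<Sum>b\<in>perms n. real (card (fixpts (tw a b) (perms n))) * w a b) =
    (\<Sum>x\<in>perms n. w a (inv' x \<circ> a \<circ> x))"
proof -
  have "real (card (fixpts (tw a b) (perms n))) * w a b =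
      (\<Sum>x\<in>perms n. if b = inv' x \<circ> a \<circ> x then w a b else 0)" if b: "b \<in> perms n" for b
  proof -
    have "fixpts (tw a b) (perms n) = {x\<in>perms n. b = inv' x \<circ> a \<circ> x}"
      unfolding fixpts_def tw_fixed_iff[OF b]
      using perms_inv_comp[of _ n] by (smt (verit, best) Collect_cong comp_assoc id_comp)
    then have "card (fixpts (tw a b) (perms n)) = card {x\<in>perms n. b = inv' x \<circ> a \<circ> x}" by simp
    moreover have "(\<Sum>x\<in>perms n. if b = inv' x \<circ> a \<circ> x then c else 0) =
        real (card {x\<in>perms n. b = inv' x \<circ> a \<circ> x}) * c" for c
      using finite_perms[of n] by (simp add: sum.If_cases Int_def)
    ultimately show ?thesis by (simp only:)
  qed
  then have "(\<Sum>b\<in>perms n. real (card (fixpts (tw a b) (perms n))) * w a b) =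
      (\<Sum>b\<in>perms n. \<Sum>x\<in>perms n. if b = inv' x \<circ> a \<circ> x then w a b else 0)"
    by (intro sum.cong refl) simp
  also have "\<dots> = (\<Sum>x\<in>perms n. \<Sum>b\<in>perms n. if b = inv' x \<circ> a \<circ> x then w a b else 0)"
    by (rule sum.swap)
  also have "\<dots> = (\<Sum>x\<in>perms n. w a (inv' x \<circ> a \<circ> x))"
  proof (rule sum.cong[OF refl])
    fix x assume x: "x \<in> perms n"
    have "inv' x \<circ> a \<circ> x \<in> perms n" using a x by (intro perms_comp perms_inv)
    then show "(\<Sum>b\<in>perms n. if b = inv' x \<circ> a \<circ> x then w a b else 0) = w a (inv' x \<circ> a \<circ> x)"
      using finite_perms[of n] by (simp add: sum.delta)
  qed
  finally show ?thesis .
qed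

text \<open>The fixed points form the coset of all \<open>z \<circ> x\<close> with \<open>z\<close>
  in the centralizer of \<open>a\<close>.\<close>

lemma card_fixpts_conj:
  assumes a: "a \<in> perms n" and x: "x \<in> perms n"
  shows "card (fixpts (tw a (inv' x \<circ> a \<circ> x)) (perms n)) = card (cent n a)"
proof -
  let ?b = "inv' x \<circ> a \<circ> x"
  have b: "?b \<in> perms n" using a x by (intro perms_comp perms_inv)
  have "bij_betw (\<lambda>y. y \<circ> inv' x) (fixpts (tw a ?b) (perms n)) (cent n a)"
  proof (rule bij_betw_byWitness[where f' = "\<lambda>z. z \<circ> x"])
    show "\<forall>y\<in>fixpts (tw a ?b) (perms n). (y \<circ> inv' x) \<circ> x = y"
      using perms_inv_comp(1)[OF x] by (simp add: comp_assoc)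
    show "\<forall>z\<in>cent n a. (z \<circ> x) \<circ> inv' x = z"
      using perms_inv_comp(2)[OF x] by (simp add: comp_assoc)
    show "(\<lambda>y. y \<circ> inv' x) ` fixpts (tw a ?b) (perms n) \<subseteq> cent n a"
    proof (rule image_subsetI)
      fix y assume "y \<in> fixpts (tw a ?b) (perms n)"
      then have y: "y \<in> perms n" "a \<circ> y = y \<circ> ?b" unfolding fixpts_def tw_fixed_iff[OF b] by auto
      have "(y \<circ> inv' x) \<circ> a = (y \<circ> ?b) \<circ> inv' x"
        using perms_inv_comp(2)[OF x] by (simp add: comp_assoc)
      also have "\<dots> = a \<circ> (y \<circ> inv' x)" unfolding y(2)[symmetric] by (simp add: comp_assoc)
      finally show "y \<circ> inv' x \<in> cent n a"
        using perms_comp[OF y(1) perms_inv[OF x]] unfolding centr_def by simp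
    qed
    show "(\<lambda>z. z \<circ> x) ` cent n a \<subseteq> fixpts (tw a ?b) (perms n)"
    proof (rule image_subsetI)
      fix z assume "z \<in> cent n a"
      then have z: "z \<in> perms n" "z \<circ> a = a \<circ> z" unfolding centr_def by auto
      have "(z \<circ> x) \<circ> ?b = z \<circ> (x \<circ> inv' x) \<circ> a \<circ> x" by (simp only: comp_assoc)
      also have "\<dots> = a \<circ> (z \<circ> x)" using perms_inv_comp(2)[OF x] z(2) by (simp add: comp_assoc)
      finally show "z \<circ> x \<in> fixpts (tw a ?b) (perms n)"
        using perms_comp[OF z(1) x] unfolding fixpts_def tw_fixed_iff[OF b] by simp
    qed
  qed
  then show ?thesis by (rule bij_betw_same_card)
qed

lemma conj_funpow:
  assumes x: "x \<in> perms n"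
  shows "(inv' x \<circ> a \<circ> x) ^^ l = inv' x \<circ> (a ^^ l) \<circ> x"
proof (induction l)
  case 0
  then show ?case using perms_inv_comp(1)[OF x] by simp
next
  case (Suc l)
  have "(inv' x \<circ> a \<circ> x) ^^ Suc l = (inv' x \<circ> a \<circ> x) \<circ> (inv' x \<circ> (a ^^ l) \<circ> x)"
    by (simp only: funpow.simps Suc)
  also have "\<dots> = inv' x \<circ> a \<circ> (x \<circ> inv' x) \<circ> (a ^^ l) \<circ> x" by (simp only: comp_assoc)
  also have "\<dots> = inv' x \<circ> (a ^^ Suc l) \<circ> x"
    by (simp only: perms_inv_comp(2)[OF x] comp_id funpow.simps comp_assoc)
  finally show ?case .
qed

lemma card_cycpts_tw_le:
  assumes b: "b \<in> perms n"
  shows "card (cycpts (tw a b) (perms n) l) \<le> card (fixpts (tw (a ^^ l) (b ^^ l)) (perms n))"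
proof (rule card_mono)
  show "finite (fixpts (tw (a ^^ l) (b ^^ l)) (perms n))" by (intro finite_fixpts finite_perms)
  show "cycpts (tw a b) (perms n) l \<subseteq> fixpts (tw (a ^^ l) (b ^^ l)) (perms n)"
    unfolding cycpts_def fixpts_def moved_def using tw_funpow[OF b] by auto
qed

text \<open>Count pairs \<open>(b, x)\<close> with
  \<open>a ^^ l \<circ> x = x \<circ> b ^^ l\<close>. For fixed \<open>x\<close>, replacing
  \<open>b\<close> by its conjugate turns the condition into equality of the \<open>l\<close>-th
  powers, so each of the \<open>fact n\<close> choices of \<open>x\<close> contributes the same
  number.\<close>

lemma sum_fixpts_funpow:
  "(\<Sum>a\<in>perms n. \<Sum>b\<in>perms n. card (fixpts (tw (a ^^ l) (b ^^ l)) (perms n))) =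
    fact n * (\<Sum>a\<in>perms n. card {b\<in>perms n. a ^^ l = b ^^ l})"
proof -
  have "(\<Sum>b\<in>perms n. card (fixpts (tw (a ^^ l) (b ^^ l)) (perms n))) =
      fact n * card {b\<in>perms n. a ^^ l = b ^^ l}" if a: "a \<in> perms n" for a
  proof -
    have "(\<Sum>b\<in>perms n. card (fixpts (tw (a ^^ l) (b ^^ l)) (perms n))) =
        (\<Sum>b\<in>perms n. \<Sum>x\<in>perms n. if (a ^^ l) \<circ> x = x \<circ> (b ^^ l) then 1 else 0)"
    proof (rule sum.cong[OF refl])
      fix b assume "b \<in> perms n"
      then have bl: "b ^^ l \<in> perms n" by (rule perms_funpow)
      show "card (fixpts (tw (a ^^ l) (b ^^ l)) (perms n)) =
          (\<Sum>x\<in>perms n. if (a ^^ l) \<circ> x = x \<circ> (b ^^ l) then 1 else 0)"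
        unfolding fixpts_def tw_fixed_iff[OF bl]
        using finite_perms[of n] by (simp add: sum.If_cases Int_def)
    qed
    also have "\<dots> = (\<Sum>x\<in>perms n. \<Sum>b\<in>perms n. if (a ^^ l) \<circ> x = x \<circ> (b ^^ l) then 1 else 0)"
      by (rule sum.swap)
    also have "\<dots> = (\<Sum>x\<in>perms n. card {b\<in>perms n. a ^^ l = b ^^ l})"
    proof (rule sum.cong[OF refl])
      fix x assume x: "x \<in> perms n"
      have "(\<Sum>b\<in>perms n. if (a ^^ l) \<circ> x = x \<circ> (b ^^ l) then 1 else 0) =
          card {b\<in>perms n. (a ^^ l) \<circ> x = x \<circ> (b ^^ l)}"
        using finite_perms[of n] by (simp add: sum.If_cases Int_def)
      also have "\<dots> = card {b\<in>perms n. a ^^ l = b ^^ l}"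
      proof (rule bij_betw_same_card[symmetric])
        let ?c = "\<lambda>b. inv' x \<circ> b \<circ> x" and ?d = "\<lambda>b. x \<circ> b \<circ> inv' x"
        have cd: "?c (?d b) = b" "?d (?c b) = b" for b
          using perms_inv_comp[OF x] by (metis comp_assoc comp_id id_comp)+
        have iff: "(a ^^ l) \<circ> x = x \<circ> (?c b ^^ l) \<longleftrightarrow> a ^^ l = b ^^ l" for b
        proof -
          have "x \<circ> (?c b ^^ l) = (x \<circ> inv' x) \<circ> (b ^^ l) \<circ> x"
            unfolding conj_funpow[OF x] by (simp only: comp_assoc)
          then have "x \<circ> (?c b ^^ l) = (b ^^ l) \<circ> x" using perms_inv_comp(2)[OF x] by simp
          then show ?thesis using perms_cancel_right[OF x] by metis
        qed
        have cin: "?c b \<in> perms n" and din: "?d b \<in> perms n" if "b \<in> perms n" for b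
          using that x by (intro perms_comp perms_inv; simp)+
        show "bij_betw ?c {b\<in>perms n. a ^^ l = b ^^ l} {b\<in>perms n. (a ^^ l) \<circ> x = x \<circ> (b ^^ l)}"
        proof (rule bij_betw_byWitness[where f' = ?d])
          show "?c ` {b\<in>perms n. a ^^ l = b ^^ l} \<subseteq> {b\<in>perms n. (a ^^ l) \<circ> x = x \<circ> (b ^^ l)}"
            using cin iff by blast
          show "?d ` {b\<in>perms n. (a ^^ l) \<circ> x = x \<circ> (b ^^ l)} \<subseteq> {b\<in>perms n. a ^^ l = b ^^ l}"
          proof (rule image_subsetI)
            fix b assume "b \<in> {b\<in>perms n. (a ^^ l) \<circ> x = x \<circ> (b ^^ l)}"
            then show "?d b \<in> {b\<in>perms n. a ^^ l = b ^^ l}"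
              using din iff[of "?d b"] unfolding cd(1) by blast
          qed
        qed (use cd in blast)+
      qed
      finally show "(\<Sum>b\<in>perms n. if (a ^^ l) \<circ> x = x \<circ> (b ^^ l) then 1 else 0) =
          card {b\<in>perms n. a ^^ l = b ^^ l}" .
    qed
    also have "\<dots> = fact n * card {b\<in>perms n. a ^^ l = b ^^ l}" by (simp only: sum_constant card_perms of_nat_id)
    finally show ?thesis .
  qed
  then show ?thesis by (simp add: sum_distrib_left)
qed

lemma card_inv_subsets_complement:
  assumes fin: "finite U" and surj: "p ` U = U" and k: "k \<le> card U"
  shows "card (inv_subsets p U (card U - k)) = card (inv_subsets p U k)"
proof (rule bij_betw_same_card)
  have inj: "inj_on p U" using fin surj by (simp add: finite_surj_inj)
  have compl: "U - X \<in> inv_subsets p U (card U - l)" if X: "X \<in> inv_subsets p U l" for X l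
  proof -
    have X: "X \<subseteq> U" "card X = l" "p ` X = X" using X unfolding inv_subsets_def by auto
    have "p ` (U - X) = U - X" using inj_on_image_set_diff[OF inj, of U X] X surj by auto
    then show ?thesis
      using X fin unfolding inv_subsets_def by (auto simp: card_Diff_subset finite_subset)
  qed
  show "bij_betw (\<lambda>X. U - X) (inv_subsets p U (card U - k)) (inv_subsets p U k)"
  proof (rule bij_betw_byWitness[where f' = "\<lambda>X. U - X"])
    show "(\<lambda>X. U - X) ` inv_subsets p U (card U - k) \<subseteq> inv_subsets p U k"
      using compl[of _ "card U - k"] k by auto
    show "(\<lambda>X. U - X) ` inv_subsets p U k \<subseteq> inv_subsets p U (card U - k)"
      using compl by blast
  qed (auto simp: inv_subsets_def)
qed

section \<open>The relative error as a sum over non-trivial pairs\<close>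

definition nontriv :: "nat \<Rightarrow> ((nat \<Rightarrow> nat) \<times> (nat \<Rightarrow> nat)) set" where
  "nontriv n = perms n \<times> perms n - {(id, id)}"

definition inv_ratio :: "nat \<Rightarrow> nat \<Rightarrow> (nat \<Rightarrow> nat) \<Rightarrow> (nat \<Rightarrow> nat) \<Rightarrow> real" where
  "inv_ratio n k a b = real (card (inv_subsets (tw a b) (perms n) k)) / real (fact n choose k)"

text \<open>This is \<open>T n k / Lambda n k - 1\<close>, as \<open>T_div_Lambda\<close> shows for
  \<open>k \<le> fact n\<close>.\<close>

definition excess :: "nat \<Rightarrow> nat \<Rightarrow> real" where
  "excess n k = (\<Sum>(a, b)\<in>nontriv n. inv_ratio n k a b)"

lemma finite_nontriv: "finite (nontriv n)"
  unfolding nontriv_def using finite_perms by simp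

lemma card_nontriv_le: "real (card (nontriv n)) \<le> (fact n)\<^sup>2"
proof -
  have "card (nontriv n) \<le> card (perms n \<times> perms n)"
    unfolding nontriv_def using finite_perms by (intro card_mono) auto
  also have "\<dots> = (fact n)\<^sup>2" by (simp only: card_cartesian_product card_perms power2_eq_square)
  finally have "real (card (nontriv n)) \<le> real ((fact n)\<^sup>2)" by (simp only: of_nat_le_iff)
  then show ?thesis by simp
qed

lemma nontriv_perms: "(a, b) \<in> nontriv n \<Longrightarrow> a \<in> perms n" "(a, b) \<in> nontriv n \<Longrightarrow> b \<in> perms n"
  unfolding nontriv_def by auto

lemma inv_ratio_nonneg: "inv_ratio n k a b \<ge> 0"
  unfolding inv_ratio_def by simp

lemma excess_nonneg: "excess n k \<ge> 0"
  unfolding excess_def by (intro sum_nonneg) (auto simp: inv_ratio_nonneg)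

lemma T_div_Lambda:
  assumes k: "k \<le> fact n"
  shows "real (T n k) / Lambda n k = 1 + excess n k"
proof -
  have pos: "real (fact n choose k) > 0" using k by (simp add: zero_less_binomial)
  have "inv_subsets (tw id id) (perms n) k = {X. X \<subseteq> perms n \<and> card X = k}"
    unfolding inv_subsets_def by (auto simp: tw_id)
  then have "card (inv_subsets (tw id id) (perms n) k) = (fact n choose k)"
    using n_subsets[OF finite_perms[of n], of k] unfolding card_perms by simp
  then have one: "inv_ratio n k id id = 1" unfolding inv_ratio_def using pos by simp
  have "real (T n k * (fact n)\<^sup>2) =
      real (\<Sum>(a, b)\<in>perms n \<times> perms n. card (inv_subsets (tw a b) (perms n) k))"
    using T_burnside[of n k] by (simp only:)
  then have eq: "real (T n k) * (fact n)\<^sup>2 =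
      (\<Sum>(a, b)\<in>perms n \<times> perms n. real (card (inv_subsets (tw a b) (perms n) k)))"
    by (simp add: case_prod_unfold)
  have "real (T n k) / Lambda n k = real (T n k) * (fact n)\<^sup>2 / real (fact n choose k)"
    unfolding Lambda_def by simp
  also have "\<dots> = (\<Sum>(a, b)\<in>perms n \<times> perms n. inv_ratio n k a b)"
    unfolding eq inv_ratio_def by (simp add: sum_divide_distrib case_prod_unfold)
  also have "\<dots> = inv_ratio n k id id + excess n k"
    unfolding excess_def nontriv_def
    using finite_perms[of n] perms_id[of n] by (subst sum.remove[of _ "(id, id)"]) auto
  finally show ?thesis using one by simp
qed

lemma excess_complement:
  assumes "k \<le> fact n"
  shows "excess n (fact n - k) = excess n k"
  unfolding excess_def
proof (rule sum.cong[OF refl], clarify)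
  fix a b assume ab: "(a, b) \<in> nontriv n"
  have "card (inv_subsets (tw a b) (perms n) (fact n - k)) = card (inv_subsets (tw a b) (perms n) k)"
    using card_inv_subsets_complement[OF finite_perms tw_image_perms[OF nontriv_perms[OF ab]], of k]
      assms unfolding card_perms by simp
  then show "inv_ratio n (fact n - k) a b = inv_ratio n k a b"
    unfolding inv_ratio_def using binomial_symmetric[OF assms] by simp
qed

abbreviation nfix :: "nat \<Rightarrow> (nat \<Rightarrow> nat) \<Rightarrow> (nat \<Rightarrow> nat) \<Rightarrow> nat" where
  "nfix n a b \<equiv> card (fixpts (tw a b) (perms n))"

abbreviation ncyc :: "nat \<Rightarrow> nat \<Rightarrow> (nat \<Rightarrow> nat) \<Rightarrow> (nat \<Rightarrow> nat) \<Rightarrow> nat" where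
  "ncyc n l a b \<equiv> card (cycpts (tw a b) (perms n) l)"

lemma nfix_id_left:
  assumes b: "b \<in> perms n" "b \<noteq> id"
  shows "nfix n id b = 0"
proof -
  have "fixpts (tw id b) (perms n) = {}"
  proof (rule ccontr)
    assume "fixpts (tw id b) (perms n) \<noteq> {}"
    then obtain x where x: "x \<in> perms n" "id \<circ> x = x \<circ> b"
      unfolding fixpts_def tw_fixed_iff[OF b(1)] by blast
    then have "x \<circ> id = x \<circ> b" by simp
    then show False using perms_cancel_left[OF x(1)] b(2) by metis
  qed
  then show ?thesis by simp
qed

text \<open>Pairs \<open>(id, b)\<close> in \<open>nontriv n\<close> have no fixed points, so
  \<open>a\<close> may be taken different from \<open>id\<close>; the remaining \<open>b\<close> are
  then unrestricted.\<close>

lemma sum_nontriv_nfix: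
  "(\<Sum>(a, b)\<in>nontriv n. real (nfix n a b) * w a b) =
    (\<Sum>a\<in>perms n - {id}. \<Sum>x\<in>perms n. w a (inv' x \<circ> a \<circ> x))"
proof -
  let ?g = "\<lambda>a b. real (nfix n a b) * w a b"
  have "(\<Sum>(a, b)\<in>nontriv n. ?g a b) = (\<Sum>(a, b)\<in>(perms n - {id}) \<times> perms n. ?g a b)"
  proof (rule sum.mono_neutral_right)
    show "\<forall>i\<in>nontriv n - (perms n - {id}) \<times> perms n. (case i of (a, b) \<Rightarrow> ?g a b) = 0"
      using nfix_id_left unfolding nontriv_def by fastforce
    show "finite (nontriv n)" by (rule finite_nontriv)
    show "(perms n - {id}) \<times> perms n \<subseteq> nontriv n" unfolding nontriv_def by auto
  qed
  also have "\<dots> = (\<Sum>a\<in>perms n - {id}. \<Sum>b\<in>perms n. ?g a b)"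
    by (rule sum.cartesian_product[symmetric])
  also have "\<dots> = (\<Sum>a\<in>perms n - {id}. \<Sum>x\<in>perms n. w a (inv' x \<circ> a \<circ> x))"
    by (rule sum.cong[OF refl], rule sum_fixpts_weighted) blast
  finally show ?thesis .
qed

lemma sum_nontriv_nfix_le: "(\<Sum>(a, b)\<in>nontriv n. real (nfix n a b)) \<le> (fact n)\<^sup>2"
proof -
  have "(\<Sum>(a, b)\<in>nontriv n. real (nfix n a b)) = real (card (perms n - {id})) * real (card (perms n))"
    using sum_nontriv_nfix[of n "\<lambda>_ _. 1"] by simp
  also have "\<dots> \<le> real (card (perms n)) * real (card (perms n))"
    using finite_perms[of n] by (intro mult_right_mono) (auto intro!: card_mono)
  also have "\<dots> = (fact n)\<^sup>2" unfolding card_perms by (simp add: power2_eq_square)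
  finally show ?thesis .
qed

text \<open>One factor \<open>nfix\<close> is consumed by the double counting and
  \<open>\<phi>\<close> is evaluated at centralizer orders. The square serves the upper bound;
  \<open>(x - 1) / 2\<close> and \<open>(x - 1) * (x - 2) / 6\<close> serve the lower bounds for
  \<open>k = 2\<close> and \<open>k = 3\<close>.\<close>

lemma sum_nontriv_nfix_fun:
  "(\<Sum>(a, b)\<in>nontriv n. real (nfix n a b) * \<phi> (nfix n a b)) =
    fact n * (\<Sum>a\<in>perms n - {id}. \<phi> (card (cent n a)))"
proof -
  have "(\<Sum>(a, b)\<in>nontriv n. real (nfix n a b) * \<phi> (nfix n a b)) =
      (\<Sum>a\<in>perms n - {id}. \<Sum>x\<in>perms n. \<phi> (nfix n a (inv' x \<circ> a \<circ> x)))"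
    by (rule sum_nontriv_nfix)
  also have "\<dots> = (\<Sum>a\<in>perms n - {id}. \<Sum>x\<in>perms n. \<phi> (card (cent n a)))"
    using card_fixpts_conj by (intro sum.cong refl) auto
  also have "\<dots> = (\<Sum>a\<in>perms n - {id}. real (card (perms n)) * \<phi> (card (cent n a)))"
    by (simp only: sum_constant)
  also have "\<dots> = fact n * (\<Sum>a\<in>perms n - {id}. \<phi> (card (cent n a)))"
    unfolding card_perms by (simp add: sum_distrib_left)
  finally show ?thesis .
qed

text \<open>The weight is now the number of cycle points. These are fixed by the \<open>l\<close>-th
  powers of the pair, which are again conjugate, so there are at most as many as elements commuting
  with \<open>a ^^ l\<close>.\<close>

lemma sum_nontriv_nfix_ncyc_le:
  "(\<Sum>(a, b)\<in>nontriv n. real (nfix n a b) * real (ncyc n l a b)) \<le>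
    fact n * (\<Sum>a\<in>perms n - {id}. real (card (cent n (a ^^ l))))"
proof -
  have "(\<Sum>(a, b)\<in>nontriv n. real (nfix n a b) * real (ncyc n l a b)) =
      (\<Sum>a\<in>perms n - {id}. \<Sum>x\<in>perms n. real (ncyc n l a (inv' x \<circ> a \<circ> x)))"
    by (rule sum_nontriv_nfix)
  also have "\<dots> \<le> (\<Sum>a\<in>perms n - {id}. \<Sum>x\<in>perms n. real (card (cent n (a ^^ l))))"
  proof (intro sum_mono)
    fix a x assume a: "a \<in> perms n - {id}" and x: "x \<in> perms n"
    have "inv' x \<circ> a \<circ> x \<in> perms n" using a x by (intro perms_comp perms_inv) auto
    then have "ncyc n l a (inv' x \<circ> a \<circ> x) \<le> nfix n (a ^^ l) ((inv' x \<circ> a \<circ> x) ^^ l)"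
      by (rule card_cycpts_tw_le)
    also have "\<dots> = card (cent n (a ^^ l))"
      unfolding conj_funpow[OF x] using a x by (intro card_fixpts_conj perms_funpow) auto
    finally show "real (ncyc n l a (inv' x \<circ> a \<circ> x)) \<le> real (card (cent n (a ^^ l)))" by simp
  qed
  also have "\<dots> = (\<Sum>a\<in>perms n - {id}. real (card (perms n)) * real (card (cent n (a ^^ l))))"
    by (simp only: sum_constant)
  also have "\<dots> = fact n * (\<Sum>a\<in>perms n - {id}. real (card (cent n (a ^^ l))))"
    unfolding card_perms by (simp add: sum_distrib_left)
  finally show ?thesis .
qed

lemma sum_nontriv_ncyc_le:
  "(\<Sum>(a, b)\<in>nontriv n. real (ncyc n l a b)) \<le>
    fact n * (\<Sum>a\<in>perms n. real (card {b\<in>perms n. a ^^ l = b ^^ l}))"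
proof -
  have "(\<Sum>(a, b)\<in>nontriv n. real (ncyc n l a b)) \<le> (\<Sum>(a, b)\<in>perms n \<times> perms n. real (ncyc n l a b))"
    unfolding nontriv_def using finite_perms[of n] by (intro sum_mono2) auto
  also have "\<dots> = (\<Sum>a\<in>perms n. \<Sum>b\<in>perms n. real (ncyc n l a b))"
    by (rule sum.cartesian_product[symmetric])
  also have "\<dots> \<le> (\<Sum>a\<in>perms n. \<Sum>b\<in>perms n. real (nfix n (a ^^ l) (b ^^ l)))"
    using card_cycpts_tw_le by (intro sum_mono) auto
  also have "\<dots> = real (\<Sum>a\<in>perms n. \<Sum>b\<in>perms n. nfix n (a ^^ l) (b ^^ l))" by simp
  also have "\<dots> = fact n * (\<Sum>a\<in>perms n. real (card {b\<in>perms n. a ^^ l = b ^^ l}))"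
    unfolding sum_fixpts_funpow by simp
  finally show ?thesis .
qed

text \<open>A fixed point makes \<open>b\<close> a conjugate of \<open>a\<close>; then
  \<open>a = id\<close> would force \<open>b = id\<close>, so \<open>a\<close> is non-trivial and
  the fixed points are as many as its centralizer has elements.\<close>

lemma nfix_le:
  assumes ab: "(a, b) \<in> nontriv n" and M: "M \<ge> 0"
    and bound: "\<And>h. h \<in> perms n - {id} \<Longrightarrow> real (card (cent n h)) \<le> M"
  shows "real (nfix n a b) \<le> M"
proof (cases "fixpts (tw a b) (perms n) = {}")
  case False
  have a: "a \<in> perms n" and b: "b \<in> perms n" using nontriv_perms[OF ab] by auto
  obtain x where x: "x \<in> perms n" "a \<circ> x = x \<circ> b"
    using False unfolding fixpts_def tw_fixed_iff[OF b] by blast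
  have "inv' x \<circ> a \<circ> x = inv' x \<circ> x \<circ> b" using x(2) by (simp only: comp_assoc)
  then have beq: "inv' x \<circ> a \<circ> x = b" using perms_inv_comp(1)[OF x(1)] by simp
  have "a \<noteq> id"
  proof
    assume "a = id"
    then have "b = id" using beq perms_inv_comp(1)[OF x(1)] by simp
    then show False using ab \<open>a = id\<close> unfolding nontriv_def by simp
  qed
  then show ?thesis using card_fixpts_conj[OF a x(1)] beq bound[of a] a by simp
qed (use M in simp)

section \<open>The upper bound\<close>

text \<open>From \<open>k\<close> to \<open>Suc k\<close> the square at most quadruples while the
  power loses a factor 4; the value at \<open>k = 3\<close> is 9. This absorbs the
  \<open>k^2\<close> coming from the 2-cycles.\<close>

lemma square_le_power_4:
  assumes "k \<ge> 3"
  shows "(real k)\<^sup>2 * (1 / 4) ^ (k - 3) \<le> 9"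
  using assms
proof (induction k rule: dec_induct)
  case (step k)
  have "real (Suc k) \<le> 2 * real k" using step by simp
  then have "(real (Suc k))\<^sup>2 \<le> (2 * real k)\<^sup>2" by (rule power_mono) simp
  then have "(real (Suc k))\<^sup>2 * (1 / 4) ^ (Suc k - 3) \<le> (2 * real k)\<^sup>2 * (1 / 4) ^ (Suc k - 3)"
    by (rule mult_right_mono) simp
  also have "\<dots> = (real k)\<^sup>2 * (1 / 4) ^ (k - 3)"
  proof -
    have "Suc k - 3 = Suc (k - 3)" using step(1) by simp
    then show ?thesis by (simp add: power_mult_distrib)
  qed
  finally show ?case using step by linarith
qed simp

lemma sum_three_le:
  fixes A B C D :: real
  assumes "C \<ge> 0" "A \<ge> 0" "B \<ge> 0" "D \<ge> 0"
  shows "(\<Sum>j\<le>k. (if j = 0 then A else if j = 2 then B else C) + (if j = k then D else 0))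
    \<le> A + B + real (k + 1) * C + D"
proof -
  have "(\<Sum>j\<le>k. (if j = 0 then A else if j = 2 then B else C) + (if j = k then D else 0))
      \<le> (\<Sum>j\<le>k. (if j = 0 then A else 0) + (if j = 2 then B else 0) + C + (if j = k then D else 0))"
    using assms by (intro sum_mono) auto
  also have "\<dots> \<le> A + B + real (k + 1) * C + D"
    using assms by (simp add: sum.distrib)
  finally show ?thesis .
qed

text \<open>With \<open>N = n!\<close>: the term \<open>j = 0\<close> counts subsets of fixed points; the terms \<open>2 < j < k\<close> are
  small because \<open>nfix\<close> sums to at most \<open>N\<^sup>2\<close> over all pairs; for \<open>j = k \<ge> 5\<close> the bound \<open>e ^ 5\<close> beats the
  number \<open>N\<^sup>2\<close> of pairs, while \<open>j = 2\<close> and \<open>j = k \<in> {3, 4}\<close> require that few pairs have many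
  2- or 3-cycles.\<close>

lemma inv_ratio_small_le:
  fixes n k :: nat
  assumes ab: "(a, b) \<in> nontriv n" and k3: "3 \<le> k" and k2: "2 * k \<le> fact n"
    and quarter: "4 * nfix n a b \<le> fact n" and e: "2 * real k / sqrt (fact n) \<le> e" and e1: "e \<le> 1"
  shows "inv_ratio n k a b \<le> (real (nfix n a b) / fact n) ^ 3
    + 36 * (real (nfix n a b) * real (ncyc n 2 a b) / fact n ^ 3)
    + real (k + 1) * (real (nfix n a b) / fact n * e ^ 3)
    + (216 * (real (ncyc n 3 a b) / fact n ^ 3)
       + 4096 * ((real (ncyc n 2 a b) + 1) / fact n ^ 3) + e ^ 5)"
    (is "_ \<le> ?A + ?B + real (k + 1) * ?C + ?D")
proof -
  define N :: real where "N = fact n"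
  define f where "f = real (nfix n a b) / N"
  define m2 where "m2 = real (ncyc n 2 a b)"
  define m3 where "m3 = real (ncyc n 3 a b)"
  define I where "I = (\<lambda>j. real (card (inv_subsets (tw a b) (moved (tw a b) (perms n)) j)))"
  define t where "t = (\<lambda>j. f ^ (k - j) * (2 * real k / N) ^ j * I j)"
  note P = finite_perms[of n]
  have N1: "N \<ge> 1" unfolding N_def by simp
  have e0: "e \<ge> 0"
  proof -
    have "0 \<le> 2 * real k / sqrt (fact n)" by simp
    then show ?thesis using e by linarith
  qed
  have "real (4 * nfix n a b) \<le> real (fact n)" using quarter by (simp only: of_nat_le_iff)
  then have f4: "f \<le> 1 / 4" unfolding f_def N_def by simp
  have f0: "f \<ge> 0" unfolding f_def using N1 by simp
  have cardP: "real (card (perms n)) = N" unfolding card_perms N_def by simp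
  have ne: "perms n \<noteq> {}" using perms_id[of n] by blast
  have "2 * k \<le> card (perms n)" using k2 unfolding card_perms .
  from inv_subsets_ratio_le[OF P tw_image_perms[OF nontriv_perms[OF ab]] this ne]
  have "inv_ratio n k a b \<le> (\<Sum>j\<le>k. t j)"
    unfolding inv_ratio_def t_def f_def I_def N_def card_perms by simp
  also have "\<dots> \<le> (\<Sum>j\<le>k. (if j = 0 then ?A else if j = 2 then ?B else ?C) + (if j = k then ?D else 0))"
  proof (rule sum_mono)
    fix j assume "j \<in> {..k}"
    then have jk: "j \<le> k" by simp
    have A0: "?A \<ge> 0" and B0: "?B \<ge> 0" and C0: "?C \<ge> 0" and D0: "?D \<ge> 0"
      using e0 by auto
    \<comment> \<open>The general count is at most \<open>sqrt N ^ j\<close>, which merges with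
      \<open>(2 * k / N) ^ j\<close> into \<open>(2 * k / sqrt N) ^ j\<close>.\<close>
    have gen: "(2 * real k / N) ^ j * I j \<le> e ^ j" if "j \<noteq> 1" for j
    proof -
      have "I j \<le> real (card (perms n) ^ (j div 2))"
        unfolding I_def using card_inv_subsets_moved_le[OF P that] by (simp only: of_nat_le_iff)
      also have "\<dots> = N ^ (j div 2)" unfolding of_nat_power cardP ..
      also have "\<dots> = sqrt N ^ (2 * (j div 2))" unfolding power_mult using N1 by simp
      also have "\<dots> \<le> sqrt N ^ j" using N1 by (intro power_increasing) auto
      finally have "(2 * real k / N) ^ j * I j \<le> (2 * real k / N) ^ j * sqrt N ^ j"
        using N1 by (intro mult_left_mono) auto
      also have "\<dots> = (2 * real k / N * sqrt N) ^ j" by (rule power_mult_distrib[symmetric])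
      also have "2 * real k / N * sqrt N = 2 * real k / sqrt N"
        using N1 by (simp add: field_simps)
      also have "(2 * real k / sqrt N) ^ j \<le> e ^ j"
        using e N1 unfolding N_def by (intro power_mono) auto
      finally show ?thesis .
    qed
    consider "j = 0" | "j = 1" | "j = 2" | "3 \<le> j" "j < k" | "j = k" "k = 3" | "j = k" "k = 4"
      | "j = k" "5 \<le> k" using jk k3 by linarith
    then show "t j \<le> (if j = 0 then ?A else if j = 2 then ?B else ?C) + (if j = k then ?D else 0)"
    proof cases
      case 1
      have "I 0 = 1" unfolding I_def using card_inv_subsets_0[OF finite_moved[OF P]] by simp
      then have "t 0 = f ^ k" unfolding t_def by simp
      also have "\<dots> \<le> f ^ 3" using f0 f4 k3 by (intro power_decreasing) auto
      finally show ?thesis using 1 k3 unfolding f_def N_def by simp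
    next
      case 2
      have "I 1 = 0" unfolding I_def inv_subsets_moved_1 by simp
      then have "t 1 = 0" unfolding t_def by simp
      then show ?thesis using 2 C0 k3 by simp
    next
      case 3
      have I2: "I 2 \<le> m2" unfolding I_def m2_def using card_inv_subsets_moved_2[OF P] by simp
      \<comment> \<open>One factor \<open>f\<close> is kept for averaging over the pairs; the other
        \<open>k - 3\<close> are at most 1/4 each and compensate \<open>k^2\<close>. The constant is
        36 = 4 * 9.\<close>
      have "k - 2 = Suc (k - 3)" using k3 by simp
      then have "t 2 = f * f ^ (k - 3) * (2 * real k / N)\<^sup>2 * I 2" unfolding t_def by simp
      also have "\<dots> \<le> f * (1 / 4) ^ (k - 3) * (2 * real k / N)\<^sup>2 * m2"
        using f0 f4 I2 N1 by (intro mult_mono power_mono mult_nonneg_nonneg) (auto simp: I_def)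
      also have "\<dots> = 4 * (f * m2 / N\<^sup>2) * ((real k)\<^sup>2 * (1 / 4) ^ (k - 3))"
        by (simp add: power_divide power_mult_distrib mult_ac)
      also have "\<dots> \<le> 4 * (f * m2 / N\<^sup>2) * 9"
        using square_le_power_4[OF k3] f0 by (intro mult_left_mono) (auto simp: m2_def)
      also have "\<dots> = ?B" unfolding f_def m2_def N_def by (simp add: power2_eq_square power3_eq_cube)
      finally show ?thesis using 3 k3 by simp
    next
      case 4
      have "t j = f ^ (k - j) * ((2 * real k / N) ^ j * I j)" unfolding t_def by simp
      also have "\<dots> \<le> f ^ 1 * e ^ j"
        using gen[of j] 4 f0 f4 N1 by (intro mult_mono power_decreasing) (auto simp: I_def)
      also have "\<dots> \<le> f ^ 1 * e ^ 3"
        using 4 f0 e0 e1 by (intro mult_left_mono power_decreasing) auto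
      finally show ?thesis using 4 unfolding f_def N_def by simp
    next
      case 5
      have I3: "I 3 \<le> m3" unfolding I_def m3_def using card_inv_subsets_moved_3[OF P] by simp
      \<comment> \<open>No fixed point is available for averaging when \<open>j = k\<close>, so the
        number of 3-cycle points takes this role; for \<open>k = 4\<close> it is the number of
        2-cycle points.\<close>
      have "t 3 = (6 / N) ^ 3 * I 3" unfolding t_def 5 by simp
      also have "\<dots> \<le> (6 / N) ^ 3 * m3" using I3 N1 by (intro mult_left_mono) auto
      also have "\<dots> = 216 * (m3 / N ^ 3)" by (simp add: power_divide)
      also have "\<dots> \<le> ?D" unfolding m3_def N_def using e0 by simp
      also have "\<dots> \<le> ?C + ?D" using C0 by simp
      finally show ?thesis using 5 by simp
    next
      case 6
      have "I 4 \<le> real (card (perms n) * ncyc n 2 a b + card (perms n))"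
        unfolding I_def using card_inv_subsets_moved_4[OF P] by (simp only: of_nat_le_iff)
      also have "\<dots> = N * (m2 + 1)" 
        unfolding of_nat_add of_nat_mult cardP m2_def by (simp add: algebra_simps)
      finally have I4: "I 4 \<le> N * (m2 + 1)" .
      have "t 4 = (8 / N) ^ 4 * I 4" unfolding t_def 6 by simp
      also have "\<dots> \<le> (8 / N) ^ 4 * (N * (m2 + 1))" using I4 N1 by (intro mult_left_mono) auto
      also have "\<dots> = 4096 * ((m2 + 1) / N ^ 3)"
        using N1 by (simp add: power_divide power4_eq_xxxx power3_eq_cube)
      also have "\<dots> \<le> ?D" unfolding m2_def N_def using e0 by simp
      also have "\<dots> \<le> ?C + ?D" using C0 by simp
      finally show ?thesis using 6 by simp
    next
      case 7
      have "t j = (2 * real k / N) ^ j * I j" unfolding t_def 7 by simp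
      also have "\<dots> \<le> e ^ j" using gen[of j] 7 by simp
      also have "\<dots> \<le> e ^ 5" using 7 e0 e1 by (intro power_decreasing) auto
      also have "\<dots> \<le> ?D" by simp
      also have "\<dots> \<le> ?C + ?D" using C0 by simp
      finally show ?thesis using 7 by simp
    qed
  qed
  also have "\<dots> \<le> ?A + ?B + real (k + 1) * ?C + ?D"
    using e0 by (intro sum_three_le) auto
  finally show ?thesis .
qed

text \<open>The bound for one pair is summed by means of the double counting identities. The
  hypothesis \<open>M \<le> fact n / 4\<close> ensures that every non-trivial pair fixes at most a
  quarter of the permutations.\<close>

lemma excess_small_le:
  fixes n k :: nat and M e :: real
  assumes k3: "3 \<le> k" and k2: "2 * k \<le> fact n"
    and M: "\<And>h. h \<in> perms n - {id} \<Longrightarrow> real (card (cent n h)) \<le> M" "M \<le> fact n / 4" "M \<ge> 0"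
    and e: "2 * real k / sqrt (fact n) \<le> e" "e \<le> 1"
  shows "excess n k \<le> (\<Sum>h\<in>perms n - {id}. (real (card (cent n h)))\<^sup>2) / (fact n)\<^sup>2
    + 36 * ((\<Sum>a\<in>perms n - {id}. real (card (cent n (a ^^ 2)))) / (fact n)\<^sup>2)
    + real (k + 1) * (fact n * e ^ 3)
    + (216 * ((\<Sum>a\<in>perms n. real (card {b\<in>perms n. a ^^ 3 = b ^^ 3})) / (fact n)\<^sup>2)
       + 4096 * ((\<Sum>a\<in>perms n. real (card {b\<in>perms n. a ^^ 2 = b ^^ 2})) / (fact n)\<^sup>2 + 1 / fact n)
       + (fact n)\<^sup>2 * e ^ 5)"
proof -
  define N :: real where "N = fact n"
  have N1: "N \<ge> 1" unfolding N_def by simp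
  let ?Q = "nontriv n"
  let ?f = "\<lambda>p. real (nfix n (fst p) (snd p))"
  let ?m = "\<lambda>l p. real (ncyc n l (fst p) (snd p))"
  have e0: "e \<ge> 0"
  proof -
    have "0 \<le> 2 * real k / sqrt (fact n)" by simp
    then show ?thesis using e by linarith
  qed
  have "excess n k = (\<Sum>p\<in>?Q. inv_ratio n k (fst p) (snd p))"
    unfolding excess_def by (simp add: case_prod_unfold)
  also have "\<dots> \<le> (\<Sum>p\<in>?Q. (?f p / N) ^ 3 + 36 * (?f p * ?m 2 p / N ^ 3) + real (k + 1) * (?f p / N * e ^ 3)
      + (216 * (?m 3 p / N ^ 3) + 4096 * ((?m 2 p + 1) / N ^ 3) + e ^ 5))"
  proof (rule sum_mono)
    fix p assume p: "p \<in> ?Q"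
    then have ab: "(fst p, snd p) \<in> ?Q" by simp
    have "?f p \<le> M" using nfix_le[OF ab M(3,1)] .
    then have "real (4 * nfix n (fst p) (snd p)) \<le> real (fact n)" using M(2) by simp
    then have "4 * nfix n (fst p) (snd p) \<le> fact n" by (simp only: of_nat_le_iff)
    then show "inv_ratio n k (fst p) (snd p) \<le> (?f p / N) ^ 3 + 36 * (?f p * ?m 2 p / N ^ 3)
        + real (k + 1) * (?f p / N * e ^ 3)
        + (216 * (?m 3 p / N ^ 3) + 4096 * ((?m 2 p + 1) / N ^ 3) + e ^ 5)"
      using inv_ratio_small_le[OF ab k3 k2 _ e] unfolding N_def by blast
  qed
  also have "\<dots> = (\<Sum>p\<in>?Q. ?f p * (?f p)\<^sup>2) / N ^ 3 + 36 * ((\<Sum>p\<in>?Q. ?f p * ?m 2 p) / N ^ 3)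
      + real (k + 1) * ((\<Sum>p\<in>?Q. ?f p) / N * e ^ 3)
      + (216 * ((\<Sum>p\<in>?Q. ?m 3 p) / N ^ 3)
         + 4096 * (((\<Sum>p\<in>?Q. ?m 2 p) + real (card ?Q)) / N ^ 3) + real (card ?Q) * e ^ 5)"
    by (simp add: sum.distrib sum_distrib_left sum_distrib_right sum_divide_distrib power_divide
        add_divide_distrib power3_eq_cube power2_eq_square mult.assoc distrib_left)
  also have "(\<Sum>p\<in>?Q. ?f p * (?f p)\<^sup>2) = N * (\<Sum>h\<in>perms n - {id}. (real (card (cent n h)))\<^sup>2)"
    using sum_nontriv_nfix_fun[of n "\<lambda>x. (real x)\<^sup>2"] unfolding N_def by (simp add: case_prod_unfold)
  also have "(\<Sum>p\<in>?Q. ?f p * ?m 2 p) / N ^ 3 \<le>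
      N * (\<Sum>a\<in>perms n - {id}. real (card (cent n (a ^^ 2)))) / N ^ 3"
    using sum_nontriv_nfix_ncyc_le[of n 2] N1 unfolding N_def
    by (intro divide_right_mono) (auto simp: case_prod_unfold)
  also have "(\<Sum>p\<in>?Q. ?f p) / N * e ^ 3 \<le> N\<^sup>2 / N * e ^ 3"
    using sum_nontriv_nfix_le[of n] N1 e0 unfolding N_def
    by (intro mult_right_mono divide_right_mono) (auto simp: case_prod_unfold)
  also have "(\<Sum>p\<in>?Q. ?m 3 p) / N ^ 3 \<le>
      N * (\<Sum>a\<in>perms n. real (card {b\<in>perms n. a ^^ 3 = b ^^ 3})) / N ^ 3"
    using sum_nontriv_ncyc_le[of n 3] N1 unfolding N_def
    by (intro divide_right_mono) (auto simp: case_prod_unfold)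
  also have "((\<Sum>p\<in>?Q. ?m 2 p) + real (card ?Q)) / N ^ 3 \<le>
      (N * (\<Sum>a\<in>perms n. real (card {b\<in>perms n. a ^^ 2 = b ^^ 2})) + N\<^sup>2) / N ^ 3"
    using sum_nontriv_ncyc_le[of n 2] card_nontriv_le[of n] N1 unfolding N_def
    by (intro divide_right_mono add_mono) (auto simp: case_prod_unfold)
  also have "real (card ?Q) * e ^ 5 \<le> N\<^sup>2 * e ^ 5"
    using card_nontriv_le[of n] e0 unfolding N_def by (intro mult_right_mono) auto
  finally have fin: "excess n k \<le> N * (\<Sum>h\<in>perms n - {id}. (real (card (cent n h)))\<^sup>2) / N ^ 3
      + 36 * (N * (\<Sum>a\<in>perms n - {id}. real (card (cent n (a ^^ 2)))) / N ^ 3)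
      + real (k + 1) * (N\<^sup>2 / N * e ^ 3)
      + (216 * (N * (\<Sum>a\<in>perms n. real (card {b\<in>perms n. a ^^ 3 = b ^^ 3})) / N ^ 3)
      + 4096 * ((N * (\<Sum>a\<in>perms n. real (card {b\<in>perms n. a ^^ 2 = b ^^ 2})) + N\<^sup>2) / N ^ 3)
      + N\<^sup>2 * e ^ 5)" by (simp add: id_def)
  have c1: "N * z / N ^ 3 = z / N\<^sup>2" and c2: "(N * z + N\<^sup>2) / N ^ 3 = z / N\<^sup>2 + 1 / N"
    and c3: "N\<^sup>2 / N = N" for z
    using N1 by (auto simp: power2_eq_square power3_eq_cube field_simps)
  show ?thesis using fin unfolding c1 c2 c3 unfolding N_def .
qed

section \<open>Asymptotics of the error terms\<close>

text \<open>The constants fit \<open>e = 32 * n^2 / sqrt (fact n)\<close>, which covers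
  \<open>k \<le> 16 * n^2\<close>: then \<open>(fact n)^2 * e ^ 5\<close> equals
  \<open>32 ^ 5 * n ^ 10 / sqrt (fact n)\<close> and has to be at most
  \<open>1 / n^2\<close>.\<close>

lemma eventually_sqrt_fact_ge:
  "\<forall>\<^sub>F n in sequentially. 32 ^ 5 * real n ^ 12 \<le> sqrt (fact n)"
proof -
  have "\<forall>\<^sub>F n in sequentially. (32 ^ 5 * real n ^ 12)\<^sup>2 * 3 ^ n \<le> real n powr real n"
    by real_asymp
  then show ?thesis using eventually_gt_at_top[of 0]
  proof eventually_elim
    case (elim n)
    have "(32 ^ 5 * real n ^ 12)\<^sup>2 * 3 ^ n \<le> real n powr real n" by (rule elim(1))
    also have "\<dots> = real n ^ n" using elim(2) by (simp add: powr_realpow)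
    also have "\<dots> \<le> 3 ^ n * fact n" by (rule self_power_le_fact)
    also have "\<dots> = fact n * 3 ^ n" by (rule mult.commute)
    finally have "(32 ^ 5 * real n ^ 12)\<^sup>2 \<le> fact n" by (subst (asm) mult_le_cancel_right_pos) auto
    then show ?case by (rule real_le_rsqrt)
  qed
qed

text \<open>If \<open>a ^^ 2 = id\<close> the centralizer of the square is everything, but such
  \<open>a\<close> are rare and contribute at most \<open>(fact n)^2 / n^2\<close>. For the others
  the square is non-trivial and its centralizer is small, which gives the remaining 8.\<close>

lemma eventually_sum_cent_square_le:
  "\<forall>\<^sub>F n in sequentially.
    (\<Sum>a\<in>perms n - {id}. real (card (cent n (a ^^ 2)))) \<le> 9 * (fact n)\<^sup>2 / (real n)\<^sup>2"
proof -
  have roots: "\<forall>\<^sub>F n in sequentially. real (card {a \<in> perms n. a ^^ 2 = id}) \<le> fact n / (real n)\<^sup>2"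
    by (rule eventually_card_roots_le) auto
  show ?thesis using roots eventually_card_cent_le
  proof eventually_elim
    case (elim n)
    define B :: real where "B = 8 * fact n / (real n)\<^sup>2"
    have B0: "B \<ge> 0" unfolding B_def by simp
    have fin: "finite (perms n)" by (rule finite_perms)
    have "(\<Sum>a\<in>perms n - {id}. real (card (cent n (a ^^ 2)))) \<le>
        (\<Sum>a\<in>perms n. real (card (cent n (a ^^ 2))))"
      using fin by (intro sum_mono2) auto
    also have "\<dots> \<le> (\<Sum>a\<in>perms n. (if a ^^ 2 = id then fact n else 0) + B)"
    proof (rule sum_mono)
      fix a assume a: "a \<in> perms n"
      show "real (card (cent n (a ^^ 2))) \<le> (if a ^^ 2 = id then fact n else 0) + B"
      proof (cases "a ^^ 2 = id")
        case True
        have "card (cent n (a ^^ 2)) \<le> card (perms n)"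
          using fin by (intro card_mono) (auto simp: centr_def)
        then have "real (card (cent n (a ^^ 2))) \<le> real (fact n)"
          unfolding card_perms by (simp only: of_nat_le_iff)
        then show ?thesis using True B0 by simp
      next
        case False
        then have "a ^^ 2 \<in> perms n - {id}" using perms_funpow[OF a] by blast
        then show ?thesis using elim(2) False unfolding B_def by simp
      qed
    qed
    also have "\<dots> = real (card {a \<in> perms n. a ^^ 2 = id}) * fact n + real (card (perms n)) * B"
      using fin by (simp add: sum.distrib sum.If_cases Int_def)
    also have "\<dots> \<le> (fact n / (real n)\<^sup>2) * fact n + fact n * B"
      unfolding card_perms using elim(1) B0 by (intro add_mono mult_right_mono) auto
    also have "\<dots> = 9 * (fact n)\<^sup>2 / (real n)\<^sup>2"
      unfolding B_def by (simp add: power2_eq_square)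
    finally show ?case .
  qed
qed

text \<open>If \<open>a ^^ l\<close> is the identity, \<open>b\<close> ranges over the rare roots of
  the identity. Otherwise \<open>b\<close> commutes with \<open>b ^^ l = a ^^ l\<close> and so lies
  in the centralizer of a non-trivial element.\<close>

lemma eventually_sum_equal_powers_le:
  assumes l: "0 < l" "l \<le> 3"
  shows "\<forall>\<^sub>F n in sequentially.
    (\<Sum>a\<in>perms n. real (card {b\<in>perms n. a ^^ l = b ^^ l})) \<le> 8 * (fact n)\<^sup>2 / (real n)\<^sup>2"
  using eventually_card_roots_le[OF l] eventually_card_cent_le
proof eventually_elim
  case (elim n)
  have fin: "finite (perms n)" by (rule finite_perms)
  have "(\<Sum>a\<in>perms n. real (card {b\<in>perms n. a ^^ l = b ^^ l})) \<le>
      (\<Sum>a\<in>perms n. 8 * fact n / (real n)\<^sup>2)"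
  proof (rule sum_mono)
    fix a assume a: "a \<in> perms n"
    show "real (card {b\<in>perms n. a ^^ l = b ^^ l}) \<le> 8 * fact n / (real n)\<^sup>2"
    proof (cases "a ^^ l = id")
      case True
      have "{b\<in>perms n. a ^^ l = b ^^ l} = {b\<in>perms n. b ^^ l = id}" unfolding True by auto
      then have "real (card {b\<in>perms n. a ^^ l = b ^^ l}) \<le> fact n / (real n)\<^sup>2"
        using elim(1) by simp
      also have "\<dots> \<le> 8 * fact n / (real n)\<^sup>2" by (intro divide_right_mono) auto
      finally show ?thesis .
    next
      case False
      have "{b\<in>perms n. a ^^ l = b ^^ l} \<subseteq> cent n (a ^^ l)"
      proof
        fix b assume b: "b \<in> {b\<in>perms n. a ^^ l = b ^^ l}"
        have "b \<circ> b ^^ l = b ^^ l \<circ> b" by (simp add: fun_eq_iff funpow_swap1)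
        then show "b \<in> cent n (a ^^ l)" using b unfolding centr_def by simp
      qed
      then have "card {b\<in>perms n. a ^^ l = b ^^ l} \<le> card (cent n (a ^^ l))"
        by (intro card_mono finite_centr) auto
      moreover have "a ^^ l \<in> perms n - {id}" using perms_funpow[OF a] False by blast
      then have "real (card (cent n (a ^^ l))) \<le> 8 * fact n / (real n)\<^sup>2" using elim(2) by blast
      ultimately show ?thesis by linarith
    qed
  qed
  also have "\<dots> = real (card (perms n)) * (8 * fact n / (real n)\<^sup>2)" by (simp only: sum_constant)
  also have "\<dots> = 8 * (fact n)\<^sup>2 / (real n)\<^sup>2" unfolding card_perms by (simp add: power2_eq_square)
  finally show ?case .
qed

text \<open>The bound 40000 rounds up 120 + 36 * 9 + 1 + 216 * 8 + 4096 * 9 + 1 = 39038. From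
  \<open>n \<ge> 6\<close> on, \<open>8 / n^2 \<le> 1 / 4\<close>, as the condition on
  \<open>M\<close> demands.\<close>

lemma eventually_excess_small_le:
  "\<forall>\<^sub>F n in sequentially. \<forall>k. 3 \<le> k \<longrightarrow> k \<le> 16 * n\<^sup>2 \<longrightarrow> 2 * k \<le> fact n \<longrightarrow>
    excess n k \<le> 40000 / (real n)\<^sup>2"
proof -
  have eq2: "\<forall>\<^sub>F n in sequentially. (\<Sum>a\<in>perms n. real (card {b\<in>perms n. a ^^ 2 = b ^^ 2}))
      \<le> 8 * (fact n)\<^sup>2 / (real n)\<^sup>2" by (rule eventually_sum_equal_powers_le) auto
  have eq3: "\<forall>\<^sub>F n in sequentially. (\<Sum>a\<in>perms n. real (card {b\<in>perms n. a ^^ 3 = b ^^ 3}))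
      \<le> 8 * (fact n)\<^sup>2 / (real n)\<^sup>2" by (rule eventually_sum_equal_powers_le) auto
  show ?thesis
    using eq2 eq3 eventually_sum_cent_square_le eventually_sum_card_cent_sq_le eventually_card_cent_le
      eventually_sqrt_fact_ge eventually_ge_at_top[of 6]
  proof eventually_elim
    case (elim n)
    show ?case
    proof (intro allI impI)
      fix k assume k3: "3 \<le> k" and kn: "k \<le> 16 * n\<^sup>2" and k2: "2 * k \<le> fact n"
      define q where "q = sqrt (fact n)"
      define x where "x = real n"
      define e where "e = 32 * x\<^sup>2 / q"
      have x6: "x \<ge> 6" unfolding x_def using elim(7) by simp
      have q0: "q > 0" unfolding q_def by simp
      have N: "fact n = q\<^sup>2" unfolding q_def by simp
      have qx: "32 ^ 5 * x ^ 12 \<le> q" using elim(6) unfolding q_def x_def .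
      have xp: "x ^ i \<le> x ^ 12" if "i \<le> 12" for i using x6 that by (intro power_increasing) auto
      have x1: "1 \<le> x ^ 12" using x6 by (intro one_le_power) simp
      have kx: "real k \<le> 16 * x\<^sup>2"
      proof -
        have "real k \<le> real (16 * n\<^sup>2)" using kn by (simp only: of_nat_le_iff)
        then show ?thesis unfolding x_def by simp
      qed
      have e1: "2 * real k / sqrt (fact n) \<le> e"
        unfolding e_def q_def using kx by (intro divide_right_mono) auto
      have "32 * x\<^sup>2 \<le> q" using qx xp[of 2] x1 by simp
      then have e2: "e \<le> 1" unfolding e_def using q0 by simp
      have x2: "36 \<le> x\<^sup>2" using power_mono[OF x6, of 2] by simp
      have M: "8 * fact n / (real n)\<^sup>2 \<le> fact n / 4"
      proof -
        have "8 * fact n / x\<^sup>2 \<le> 8 * fact n / (36::real)"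
          using x2 by (intro divide_left_mono) auto
        also have "\<dots> \<le> fact n / 4" by simp
        finally show ?thesis unfolding x_def .
      qed
      have div: "y / (fact n)\<^sup>2 \<le> c / x\<^sup>2" if "y \<le> c * (fact n)\<^sup>2 / (real n)\<^sup>2" for y c :: real
        using that unfolding x_def by (simp add: field_simps)
      have b3: "real (k + 1) * (fact n * e ^ 3) \<le> 1 / x\<^sup>2"
      proof -
        have eq: "fact n * e ^ 3 = 32768 * x ^ 6 / q"
          unfolding N e_def using q0
          by (simp add: power_divide power_mult_distrib field_simps power2_eq_square power3_eq_cube eval_nat_numeral)
        have "real (k + 1) \<le> 17 * x\<^sup>2" using kx x2 by simp
        then have "real (k + 1) * (fact n * e ^ 3) \<le> 17 * x\<^sup>2 * (32768 * x ^ 6 / q)"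
          unfolding eq using q0 by (intro mult_right_mono) auto
        also have "\<dots> = (557056 * x ^ 10 / q) / x\<^sup>2"
          using x6 q0 by (simp add: field_simps eval_nat_numeral)
        also have "\<dots> \<le> 1 / x\<^sup>2"
        proof (rule divide_right_mono)
          have "557056 * x ^ 10 \<le> q" using qx xp[of 10] x1 by simp
          then show "557056 * x ^ 10 / q \<le> 1" using q0 by simp
        qed simp
        finally show ?thesis .
      qed
      have b5: "(fact n)\<^sup>2 * e ^ 5 \<le> 1 / x\<^sup>2"
      proof -
        have "(fact n)\<^sup>2 * e ^ 5 = 32 ^ 5 * x ^ 10 / q"
          unfolding N e_def using q0
          by (simp add: power_divide power_mult_distrib field_simps eval_nat_numeral)
        also have "\<dots> = (32 ^ 5 * x ^ 12 / q) / x\<^sup>2"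
          using x6 q0 by (simp add: field_simps eval_nat_numeral)
        also have "\<dots> \<le> 1 / x\<^sup>2" using qx q0 by (intro divide_right_mono) auto
        finally show ?thesis .
      qed
      have b1: "1 / fact n \<le> 1 / x\<^sup>2"
      proof -
        have "x\<^sup>2 \<le> q" using qx xp[of 2] x1 by simp
        also have "q \<le> q\<^sup>2"
        proof -
          have "1 \<le> q" unfolding q_def by simp
          then show ?thesis unfolding power2_eq_square using q0 by (simp add: mult_le_cancel_left1)
        qed
        finally have "x\<^sup>2 \<le> fact n" unfolding N .
        then show ?thesis using x6 by (intro divide_left_mono mult_pos_pos) auto
      qed
      have "excess n k \<le> (\<Sum>h\<in>perms n - {id}. (real (card (cent n h)))\<^sup>2) / (fact n)\<^sup>2
        + 36 * ((\<Sum>a\<in>perms n - {id}. real (card (cent n (a ^^ 2)))) / (fact n)\<^sup>2)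
        + real (k + 1) * (fact n * e ^ 3)
        + (216 * ((\<Sum>a\<in>perms n. real (card {b\<in>perms n. a ^^ 3 = b ^^ 3})) / (fact n)\<^sup>2)
           + 4096 * ((\<Sum>a\<in>perms n. real (card {b\<in>perms n. a ^^ 2 = b ^^ 2})) / (fact n)\<^sup>2 + 1 / fact n)
           + (fact n)\<^sup>2 * e ^ 5)"
        using elim(5) by (intro excess_small_le[OF k3 k2 _ M _ e1 e2]) auto
      also have "\<dots> \<le> 120 / x\<^sup>2 + 36 * (9 / x\<^sup>2) + 1 / x\<^sup>2
          + (216 * (8 / x\<^sup>2) + 4096 * (8 / x\<^sup>2 + 1 / x\<^sup>2) + 1 / x\<^sup>2)"
        using div[OF elim(4)] div[OF elim(3)] div[OF elim(2)] div[OF elim(1)] b1 b3 b5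
        by (intro add_mono mult_left_mono) auto
      also have "\<dots> = 39038 * (1 / x\<^sup>2)" by simp
      also have "\<dots> \<le> 40000 * (1 / x\<^sup>2)" by (intro mult_right_mono) auto
      finally show "excess n k \<le> 40000 / (real n)\<^sup>2" unfolding x_def by simp
    qed
  qed
qed

text \<open>The threshold \<open>16 * n^2\<close> comes from
  \<open>fact n \<le> n ^ n \<le> exp (n^2)\<close>: it makes \<open>exp (- k / 4)\<close> at most
  \<open>1 / N ^ 4\<close>, which beats the factor \<open>N + 1\<close> and the \<open>N^2\<close>
  pairs and leaves \<open>2 / N\<close>.\<close>

lemma eventually_excess_large_le:
  "\<forall>\<^sub>F n in sequentially. \<forall>k. 16 * n\<^sup>2 \<le> k \<longrightarrow> 2 * k \<le> fact n \<longrightarrow> excess n k \<le> 40000 / (real n)\<^sup>2"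
  using eventually_card_cent_le eventually_sqrt_fact_ge eventually_ge_at_top[of 6]
proof eventually_elim
  case (elim n)
  show ?case
  proof (intro allI impI)
    fix k assume kn: "16 * n\<^sup>2 \<le> k" and k2: "2 * k \<le> fact n"
    define N :: real where "N = fact n"
    define x where "x = real n"
    have x6: "x \<ge> 6" unfolding x_def using elim(3) by simp
    have N1: "N \<ge> 1" unfolding N_def by simp
    have x2: "36 \<le> x\<^sup>2" using power_mono[OF x6, of 2] by simp
    have M: "8 * fact n / (real n)\<^sup>2 \<le> fact n / 4"
    proof -
      have "8 * fact n / x\<^sup>2 \<le> 8 * fact n / (36::real)"
        using x2 by (intro divide_left_mono) auto
      also have "\<dots> \<le> fact n / 4" by simp
      finally show ?thesis unfolding x_def .
    qed
    have k0: "0 < k"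
    proof -
      have "0 < 16 * n\<^sup>2" using elim(3) by simp
      then show ?thesis using kn by linarith
    qed
    have "N \<le> x ^ n"
      unfolding N_def x_def using fact_le_power[where 'a = real, of n] by simp
    also have "x ^ n \<le> exp x ^ n"
      using x6 exp_ge_add_one_self[of x] by (intro power_mono) linarith+
    also have "\<dots> = exp (x\<^sup>2)" by (simp flip: exp_of_nat_mult add: x_def power2_eq_square)
    finally have Nexp: "N \<le> exp (x\<^sup>2)" .
    have "exp (- real k / 4) \<le> exp (- 4 * x\<^sup>2)"
    proof -
      have "real (16 * n\<^sup>2) \<le> real k" using kn by (simp only: of_nat_le_iff)
      then show ?thesis unfolding x_def by simp
    qed
    also have "\<dots> = 1 / exp (x\<^sup>2) ^ 4"
      by (simp flip: exp_of_nat_mult add: exp_minus inverse_eq_divide)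
    also have "\<dots> \<le> 1 / N ^ 4"
      using Nexp N1 by (intro divide_left_mono power_mono mult_pos_pos) auto
    finally have ek: "exp (- real k / 4) \<le> 1 / N ^ 4" .
    have "excess n k = (\<Sum>p\<in>nontriv n. inv_ratio n k (fst p) (snd p))"
      unfolding excess_def by (simp add: case_prod_unfold)
    also have "\<dots> \<le> (\<Sum>p\<in>nontriv n. (N + 1) * (1 / N ^ 4))"
    proof (rule sum_mono)
      fix p assume p: "p \<in> nontriv n"
      then have ab: "(fst p, snd p) \<in> nontriv n" by simp
      have "real (nfix n (fst p) (snd p)) \<le> 8 * fact n / (real n)\<^sup>2"
        using elim(1) by (intro nfix_le[OF ab]) auto
      then have "real (4 * nfix n (fst p) (snd p)) \<le> real (fact n)" using M by simp
      then have f: "4 * card (fixpts (tw (fst p) (snd p)) (perms n)) \<le> card (perms n)"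
        unfolding card_perms by (simp only: of_nat_le_iff)
      have "2 * k \<le> card (perms n)" using k2 unfolding card_perms .
      from inv_subsets_ratio_le_exp[OF finite_perms tw_image_perms[OF nontriv_perms[OF ab]] k0 this f]
      have "inv_ratio n k (fst p) (snd p) \<le> (N + 1) * exp (- real k / 4)"
        unfolding inv_ratio_def card_perms N_def by simp
      also have "\<dots> \<le> (N + 1) * (1 / N ^ 4)" using ek N1 by (intro mult_left_mono) auto
      finally show "inv_ratio n k (fst p) (snd p) \<le> (N + 1) * (1 / N ^ 4)" .
    qed
    also have "\<dots> = real (card (nontriv n)) * ((N + 1) * (1 / N ^ 4))" by simp
    also have "\<dots> \<le> N\<^sup>2 * ((2 * N) * (1 / N ^ 4))"
      using card_nontriv_le[of n] N1 unfolding N_def by (intro mult_mono) auto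
    also have "\<dots> = 2 / N" using N1 by (simp add: field_simps eval_nat_numeral)
    also have "\<dots> \<le> 2 / x\<^sup>2"
    proof -
      have "x\<^sup>2 \<le> x ^ 12" using x6 by (intro power_increasing) auto
      also have "\<dots> \<le> 32 ^ 5 * x ^ 12" using x6 by simp
      also have "\<dots> \<le> sqrt N" using elim(2) unfolding x_def N_def .
      also have "\<dots> \<le> N" using N1 by (simp add: sqrt_le_D real_le_lsqrt power2_eq_square mult_le_cancel_left1)
      finally show ?thesis using x6 N1 by (intro divide_left_mono mult_pos_pos) auto
    qed
    also have "\<dots> \<le> 40000 / x\<^sup>2" by (intro divide_right_mono) auto
    finally show "excess n k \<le> 40000 / (real n)\<^sup>2" unfolding x_def .
  qed
qed

lemma eventually_excess_le:
  "\<forall>\<^sub>F n in sequentially. \<forall>k\<in>{3..fact n - 3}. excess n k \<le> 40000 / (real n)\<^sup>2"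
  using eventually_excess_small_le eventually_excess_large_le
proof eventually_elim
  case (elim n)
  have half: "excess n k \<le> 40000 / (real n)\<^sup>2" if "3 \<le> k" "2 * k \<le> fact n" for k
    using elim that by (cases "k \<le> 16 * n\<^sup>2") auto
  show ?case
  proof
    fix k :: nat assume k: "k \<in> {3..fact n - 3}"
    show "excess n k \<le> 40000 / (real n)\<^sup>2"
    proof (cases "2 * k \<le> fact n")
      case True
      then show ?thesis using half k by simp
    next
      case False
      then have "3 \<le> fact n - k" "2 * (fact n - k) \<le> fact n" "k \<le> fact n" using k by auto
      then show ?thesis using half[of "fact n - k"] excess_complement[of k n] by simp
    qed
  qed
qed

section \<open>Lower bounds and the theorem\<close>

lemma card_inv_subsets_ge:
  assumes fin: "finite U"
  shows "(card (fixpts p U) choose k) \<le> card (inv_subsets p U k)"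
proof -
  have "{X. X \<subseteq> fixpts p U \<and> card X = k} \<subseteq> inv_subsets p U k"
  proof
    fix X assume "X \<in> {X. X \<subseteq> fixpts p U \<and> card X = k}"
    then have X: "X \<subseteq> fixpts p U" "card X = k" by auto
    then have "p ` X = X" unfolding fixpts_def by force
    then show "X \<in> inv_subsets p U k" using X unfolding inv_subsets_def fixpts_def by auto
  qed
  then have "card {X. X \<subseteq> fixpts p U \<and> card X = k} \<le> card (inv_subsets p U k)"
    by (intro card_mono finite_inv_subsets fin)
  then show ?thesis using n_subsets[OF finite_fixpts[OF fin]] by simp
qed

lemma excess_ge:
  "(\<Sum>(a, b)\<in>nontriv n. real (nfix n a b choose k)) / real (fact n choose k) \<le> excess n k"
proof -
  have "(\<Sum>(a, b)\<in>nontriv n. real (nfix n a b choose k)) / real (fact n choose k) =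
      (\<Sum>(a, b)\<in>nontriv n. real (nfix n a b choose k) / real (fact n choose k))"
    by (simp add: sum_divide_distrib case_prod_unfold)
  also have "\<dots> \<le> excess n k"
    unfolding excess_def inv_ratio_def using card_inv_subsets_ge[OF finite_perms]
    by (intro sum_mono) (auto intro!: divide_right_mono)
  finally show ?thesis .
qed

text \<open>The factor \<open>real n\<close> is split off to match the form
  \<open>nfix * \<phi> nfix\<close> of \<open>sum_nontriv_nfix_fun\<close>.\<close>

lemma real_choose_2: "real (n choose 2) = real n * ((real n - 1) / 2)"
proof -
  have "2 * (n choose 2) = (n - 1) * n"
    using Suc_times_binomial_Suc[of 1 n] by (simp add: numeral_2_eq_2)
  then have "2 * real (n choose 2) = real (n - 1) * real n" by (metis of_nat_mult of_nat_numeral)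
  then show ?thesis by (cases n) (auto simp: field_simps)
qed

lemma real_choose_3: "real (n choose 3) = real n * ((real n - 1) * (real n - 2) / 6)"
proof (cases "n \<ge> 2")
  case True
  have "3 * (n choose 3) = (n - 2) * (n choose 2)"
    using Suc_times_binomial_Suc[of 2 n] by (simp add: numeral_3_eq_3 numeral_2_eq_2)
  then have "3 * real (n choose 3) = real (n - 2) * real (n choose 2)"
    by (metis of_nat_mult of_nat_numeral)
  then show ?thesis using True unfolding real_choose_2 by (simp add: of_nat_diff field_simps)
next
  case False
  then have "n = 0 \<or> n = 1" by linarith
  then show ?thesis by auto
qed

lemma card_cent_ge_2:
  assumes "a \<in> perms n - {id}"
  shows "2 \<le> card (cent n a)"
proof -
  have "{id, a} \<subseteq> cent n a" using assms perms_id[of n] unfolding centr_def by auto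
  then have "card {id, a} \<le> card (cent n a)" by (intro card_mono finite_centr) auto
  then show ?thesis using assms by auto
qed

text \<open>Each non-trivial element commutes with \<open>id\<close> and with itself. These two
  alone make the non-trivial pairs contribute at least
  \<open>N * (N - 1) / 2 = (N choose 2)\<close>, as much as the trivial pair.\<close>

lemma excess_2_ge:
  assumes n: "n \<ge> 2"
  shows "1 \<le> excess n 2"
proof -
  define N :: real where "N = fact n"
  have "fact 2 \<le> (fact n :: real)" using n by (rule fact_mono)
  then have N2: "N \<ge> 2" unfolding N_def by simp
  have c: "real (card (perms n - {id})) = N - 1"
    using card_Diff_singleton[OF perms_id[of n]] card_perms[of n] unfolding N_def
    by (simp add: of_nat_diff)
  have ch: "real (fact n choose 2) = N * ((N - 1) / 2)" unfolding real_choose_2 N_def by simp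
  have "N * ((N - 1) / 2) = N * (\<Sum>a\<in>perms n - {id}. 1 / 2)" using c by simp
  also have "\<dots> \<le> N * (\<Sum>a\<in>perms n - {id}. (real (card (cent n a)) - 1) / 2)"
  proof (intro mult_left_mono sum_mono)
    fix a assume "a \<in> perms n - {id}"
    then have "2 \<le> real (card (cent n a))" using card_cent_ge_2[of a n] by linarith
    then show "1 / 2 \<le> (real (card (cent n a)) - 1) / 2" by simp
  qed (use N2 in auto)
  also have "\<dots> = (\<Sum>(a, b)\<in>nontriv n. real (nfix n a b choose 2))"
    unfolding real_choose_2 sum_nontriv_nfix_fun[of n "\<lambda>x. (real x - 1) / 2"] N_def ..
  finally have "1 \<le> (\<Sum>(a, b)\<in>nontriv n. real (nfix n a b choose 2)) / real (fact n choose 2)"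
    unfolding ch using N2 by (subst pos_le_divide_eq) auto
  then show ?thesis using excess_ge[of n 2] by linarith
qed

text \<open>Every permutation fixing both \<open>i\<close> and \<open>j\<close> commutes with the
  transposition.\<close>

lemma card_cent_transpose_ge:
  assumes ij: "i \<in> {1..n}" "j \<in> {1..n}" "i \<noteq> j"
  shows "fact (n - 2) \<le> card (cent n (transpose i j))"
proof -
  have "{p. p permutes {1..n} - {i, j}} \<subseteq> cent n (transpose i j)"
  proof
    fix p assume "p \<in> {p. p permutes {1..n} - {i, j}}"
    then have p: "p permutes {1..n} - {i, j}" by simp
    then have pS: "p permutes {1..n}" by (rule permutes_subset) auto
    have fx: "p i = i" "p j = j" using permutes_not_in[OF p] by auto
    have "p \<circ> transpose i j = transpose i j \<circ> p"
    proof
      fix x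
      consider "x = i" | "x = j" | "x \<noteq> i" "x \<noteq> j" by blast
      then show "(p \<circ> transpose i j) x = (transpose i j \<circ> p) x"
      proof cases
        case 3
        then have "p x \<noteq> i" "p x \<noteq> j" using fx injD[OF permutes_inj[OF p]] by metis+
        then show ?thesis using 3 by simp
      qed (use fx in auto)
    qed
    then show "p \<in> cent n (transpose i j)" using pS unfolding centr_def by simp
  qed
  then have "card {p. p permutes {1..n} - {i, j}} \<le> card (cent n (transpose i j))"
    by (intro card_mono finite_centr) auto
  moreover have "card ({1..n} - {i, j}) = n - 2"
    using ij by (subst card_Diff_subset) auto
  ultimately show ?thesis using card_permutations[of "{1..n} - {i, j}" "n - 2"] by simp
qed

text \<open>About \<open>n^2\<close> transpositions have centralizers of order at least
  \<open>fact (n - 2)\<close>, roughly \<open>N / n^2\<close>. Their squared relative orders add up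
  to order \<open>n^2 * n^(-4)\<close>.\<close>

lemma excess_3_ge:
  assumes n: "n \<ge> 6"
  shows "1 / (32 * (real n)\<^sup>2) \<le> excess n 3"
proof -
  define N :: real where "N = fact n"
  define d :: real where "d = fact (n - 2)"
  define x where "x = real n"
  let ?\<phi> = "\<lambda>c::nat. (real c - 1) * (real c - 2) / 6"
  have x6: "x \<ge> 6" using n unfolding x_def by simp
  have "fact 4 \<le> (fact (n - 2) :: real)" using n by (intro fact_mono) auto
  then have d4: "d \<ge> 4" unfolding d_def by (simp add: eval_nat_numeral)
  obtain m' where m': "n = Suc (Suc m')" using that[of "n - 2"] n by simp
  have Nd: "N = x * (x - 1) * d" unfolding N_def x_def d_def m' by (simp add: algebra_simps)
  \<comment> \<open>Taking \<open>i\<close> from the lower and \<open>j\<close> from the upper half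
    makes the transpositions distinct for distinct pairs, at the cost of a constant factor
    only.\<close>
  define m where "m = n div 2"
  define S where "S = {1..m} \<times> {Suc m..n}"
  let ?t = "\<lambda>(i, j). transpose i j :: nat \<Rightarrow> nat"
  have mn: "m \<le> n" unfolding m_def by simp
  have St: "i \<in> {1..n} \<and> j \<in> {1..n} \<and> i \<le> m \<and> m < j" if "(i, j) \<in> S" for i j
    using that mn unfolding S_def by auto
  have inj: "inj_on ?t S"
  proof (rule inj_onI, clarify)
    fix i j k l assume ij: "(i, j) \<in> S" and kl: "(k, l) \<in> S" and eq: "transpose i j = transpose k l"
    have b: "i \<le> m" "m < j" "k \<le> m" "m < l" using St[OF ij] St[OF kl] by auto
    have "j = transpose k l i" using eq by (metis transpose_apply_first)
    then show "i = k \<and> j = l" using b by (auto simp: transpose_def split: if_splits)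
  qed
  have tp: "?t ` S \<subseteq> perms n - {id}"
  proof (rule image_subsetI, clarify)
    fix i j assume ij: "(i, j) \<in> S"
    have "transpose i j \<in> perms n" using St[OF ij] by (simp add: permutes_swap_id)
    moreover have "transpose i j i = j" "i \<noteq> j" using St[OF ij] by auto
    then have "transpose i j \<noteq> id" by (metis id_apply)
    ultimately show "transpose i j \<in> perms n - {id}" by blast
  qed
  have nonneg: "0 \<le> ?\<phi> c" for c
  proof (cases "c \<ge> 2")
    case False
    then have "c = 0 \<or> c = 1" by linarith
    then show ?thesis by auto
  qed simp
  have cS: "x\<^sup>2 / 8 \<le> real (card S)"
  proof -
    have "card S = m * (n - m)" unfolding S_def by simp
    then have "real (card S) = real m * real (n - m)" by simp
    moreover have "x / 4 \<le> real m" "x / 2 \<le> real (n - m)" using n unfolding m_def x_def by linarith+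
    then have "x / 4 * (x / 2) \<le> real m * real (n - m)" using x6 by (intro mult_mono) auto
    ultimately show ?thesis by (simp add: power2_eq_square)
  qed
  have "x\<^sup>2 / 8 * (d\<^sup>2 / 24) \<le> real (card S) * (d\<^sup>2 / 24)" using cS by (rule mult_right_mono) simp
  also have "\<dots> = (\<Sum>p\<in>S. d\<^sup>2 / 24)" by simp
  also have "\<dots> \<le> (\<Sum>p\<in>S. ?\<phi> (card (cent n (?t p))))"
  proof (rule sum_mono, clarify)
    fix i j assume ij: "(i, j) \<in> S"
    have "fact (n - 2) \<le> card (cent n (transpose i j))"
      using St[OF ij] by (intro card_cent_transpose_ge) auto
    then have "real (fact (n - 2)) \<le> real (card (cent n (transpose i j)))" by (simp only: of_nat_le_iff)
    then have c: "d \<le> real (card (cent n (transpose i j)))" unfolding d_def by simp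
    \<comment> \<open>The difference of the two sides is \<open>(d - 4) * 3 * d / 4 + 2\<close>,
      hence the demand \<open>d \<ge> 4\<close>.\<close>
    have "d\<^sup>2 / 4 \<le> (d - 1) * (d - 2)"
    proof -
      have "0 \<le> (d - 4) * (3 * d)" using d4 by simp
      then show ?thesis by (simp add: power2_eq_square algebra_simps)
    qed
    also have "\<dots> \<le> (real (card (cent n (transpose i j))) - 1) * (real (card (cent n (transpose i j))) - 2)"
      using c d4 by (intro mult_mono) auto
    finally show "d\<^sup>2 / 24 \<le> ?\<phi> (card (cent n (transpose i j)))" by simp
  qed
  also have "\<dots> = (\<Sum>a\<in>?t ` S. ?\<phi> (card (cent n a)))"
    by (subst sum.reindex[OF inj]) (simp add: comp_def)
  also have "\<dots> \<le> (\<Sum>a\<in>perms n - {id}. ?\<phi> (card (cent n a)))"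
    using tp finite_perms[of n] nonneg by (intro sum_mono2) auto
  finally have "N * (x\<^sup>2 * d\<^sup>2 / 192) \<le> N * (\<Sum>a\<in>perms n - {id}. ?\<phi> (card (cent n a)))"
    unfolding N_def by (intro mult_left_mono) auto
  also have "\<dots> = (\<Sum>(a, b)\<in>nontriv n. real (nfix n a b choose 3))"
    unfolding real_choose_3 sum_nontriv_nfix_fun[of n ?\<phi>] N_def ..
  finally have 1: "N * (x\<^sup>2 * d\<^sup>2 / 192) / real (fact n choose 3) \<le> excess n 3"
    using excess_ge[of n 3] by (meson divide_right_mono of_nat_0_le_iff order_trans)
  have N3: "N \<ge> 4" unfolding Nd
  proof -
    have "1 * 1 * 4 \<le> x * (x - 1) * d" using x6 d4 by (intro mult_mono) auto
    then show "4 \<le> x * (x - 1) * d" by simp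
  qed
  have ch: "real (fact n choose 3) = N * ((N - 1) * (N - 2) / 6)" unfolding real_choose_3 N_def by simp
  \<comment> \<open>The factor 192 = 8 * 24 collected so far is divided by the 6 in the denominator
    of \<open>N choose 3\<close>.\<close>
  have "1 / (32 * x\<^sup>2) = x\<^sup>2 * d\<^sup>2 / (32 * (x * x * d)\<^sup>2)"
    using x6 d4 by (simp add: power2_eq_square)
  also have "\<dots> \<le> x\<^sup>2 * d\<^sup>2 / (32 * ((N - 1) * (N - 2)))"
  proof (rule divide_left_mono)
    have "N \<le> x * x * d" unfolding Nd using x6 d4 by (intro mult_right_mono mult_left_mono) auto
    then have "(N - 1) * (N - 2) \<le> (x * x * d) * (x * x * d)" using N3 by (intro mult_mono) auto
    then show "32 * ((N - 1) * (N - 2)) \<le> 32 * (x * x * d)\<^sup>2" by (simp add: power2_eq_square)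
    show "0 < 32 * (x * x * d)\<^sup>2 * (32 * ((N - 1) * (N - 2)))" using N3 x6 d4 by simp
  qed simp
  also have "\<dots> = N * (x\<^sup>2 * d\<^sup>2 / 192) / real (fact n choose 3)"
  proof -
    have "N * (x\<^sup>2 * d\<^sup>2 / 192) / (N * ((N - 1) * (N - 2) / 6)) =
        (x\<^sup>2 * d\<^sup>2 / 192) / ((N - 1) * (N - 2) / 6)" using N3 by simp
    then show ?thesis unfolding ch by simp
  qed
  also note 1
  finally show ?thesis unfolding x_def .
qed

lemma not_asymp_equiv_if_excess_ge_1:
  assumes "\<forall>\<^sub>F n in sequentially. k n \<le> fact n" and "\<forall>\<^sub>F n in sequentially. 1 \<le> excess n (k n)"
  shows "\<not> (\<lambda>n. real (T n (k n))) \<sim>[sequentially] (\<lambda>n. Lambda n (k n))"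
proof
  assume "(\<lambda>n. real (T n (k n))) \<sim>[sequentially] (\<lambda>n. Lambda n (k n))"
  then have lim: "(\<lambda>n. if real (T n (k n)) = 0 \<and> Lambda n (k n) = 0 then 1
      else real (T n (k n)) / Lambda n (k n)) \<longlonglongrightarrow> 1"
    unfolding asymp_equiv_def .
  have "\<forall>\<^sub>F n in sequentially. 2 \<le> (if real (T n (k n)) = 0 \<and> Lambda n (k n) = 0 then 1
      else real (T n (k n)) / Lambda n (k n))"
    using assms
  proof eventually_elim
    case (elim n)
    \<comment> \<open>This excludes the value 1 that the definition of asymptotic equivalence
      assigns to the quotient of two zeros; the true quotient is at least 2.\<close>
    have "Lambda n (k n) \<noteq> 0" using elim(1) unfolding Lambda_def by simp
    then show ?case using T_div_Lambda[OF elim(1)] elim(2) by simp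
  qed
  then have "(2::real) \<le> 1" using lim by (intro tendsto_lowerbound[OF lim]) auto
  then show False by simp
qed

lemma Lambda_pos: "k \<le> fact n \<Longrightarrow> Lambda n k > 0"
  unfolding Lambda_def by (simp add: zero_less_binomial)

text \<open>Below \<open>n0\<close> there are only finitely many pairs \<open>(n, k)\<close>. The
  sum of all their nonnegative values \<open>g n k\<close> bounds each of them and is added to the
  constant.\<close>

lemma exists_excess_bound:
  "\<exists>C::real. C > 0 \<and> (\<forall>n\<ge>1. \<forall>k\<in>{3..fact n - 3}. excess n k \<le> C / (real n)\<^sup>2)"
proof -
  obtain n0 where n0: "\<And>n k. n \<ge> n0 \<Longrightarrow> k \<in> {3..fact n - 3} \<Longrightarrow> excess n k \<le> 40000 / (real n)\<^sup>2"
    using eventually_excess_le unfolding eventually_sequentially by blast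
  define g where "g = (\<lambda>n k. (real n)\<^sup>2 * excess n k)"
  define C where "C = 40000 + (\<Sum>n<n0. \<Sum>k\<in>{3..fact n - 3}. g n k)"
  have g0: "g n k \<ge> 0" for n k unfolding g_def using excess_nonneg by simp
  have S0: "(\<Sum>n<n0. \<Sum>k\<in>{3..fact n - 3}. g n k) \<ge> 0" using g0 by (intro sum_nonneg) auto
  have "excess n k \<le> C / (real n)\<^sup>2" if n: "n \<ge> 1" and k: "k \<in> {3..fact n - 3}" for n k
  proof (cases "n \<ge> n0")
    case True
    then have "excess n k \<le> 40000 / (real n)\<^sup>2" using n0 k by blast
    also have "\<dots> \<le> C / (real n)\<^sup>2" unfolding C_def using S0 by (intro divide_right_mono) auto
    finally show ?thesis .
  next
    case False
    have "g n k \<le> (\<Sum>k\<in>{3..fact n - 3}. g n k)" using k g0 by (intro member_le_sum) auto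
    also have "\<dots> \<le> (\<Sum>n<n0. \<Sum>k\<in>{3..fact n - 3}. g n k)"
      using False g0 by (intro member_le_sum[of n "{..<n0}" "\<lambda>n. \<Sum>k\<in>{3..fact n - 3}. g n k"]) (auto intro: sum_nonneg)
    also have "\<dots> \<le> C" unfolding C_def by simp
    finally show ?thesis using n unfolding g_def by (simp add: field_simps)
  qed
  moreover have "C > 0" unfolding C_def using S0 by simp
  ultimately show ?thesis by blast
qed

theorem theorem1p1:
  shows
    "(\<exists>\<delta> :: nat \<Rightarrow> nat \<Rightarrow> real.
        (\<forall>n\<ge>1. \<forall>k\<in>{3..fact n - 3}. real (T n k) = Lambda n k * (1 + \<delta> n k)) \<and>
        (\<forall>\<epsilon>>0. \<forall>\<^sub>F n in sequentially. \<forall>k\<in>{3..fact n - 3}. \<bar>\<delta> n k\<bar> < \<epsilon>))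
     \<and> (\<exists>C::real. C > 0 \<and>
        (\<forall>n\<ge>1. \<forall>k\<in>{3..fact n - 3}.
           \<bar>real (T n k) / Lambda n k - 1\<bar> \<le> C / (real n)\<^sup>2))
     \<and> \<not> (\<lambda>n. real (T n 2)) \<sim>[sequentially] (\<lambda>n. Lambda n 2)
     \<and> \<not> (\<lambda>n. real (T n (fact n - 2))) \<sim>[sequentially] (\<lambda>n. Lambda n (fact n - 2))
     \<and> (\<forall>a::real. a > 2 \<longrightarrow>
        \<not> (\<exists>C::real. C > 0 \<and>
             (\<forall>n\<ge>1. \<forall>k\<in>{3..fact n - 3}.
                \<bar>real (T n k) / Lambda n k - 1\<bar> \<le> C * real n powr (- a))))"
proof (intro conjI allI impI)
  have ratio: "\<bar>real (T n k) / Lambda n k - 1\<bar> = excess n k" if "k \<in> {3..fact n - 3}" for n k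
  proof -
    have "k \<le> fact n" using that by auto
    then show ?thesis using T_div_Lambda excess_nonneg[of n k] by simp
  qed
  show "\<exists>\<delta> :: nat \<Rightarrow> nat \<Rightarrow> real.
      (\<forall>n\<ge>1. \<forall>k\<in>{3..fact n - 3}. real (T n k) = Lambda n k * (1 + \<delta> n k)) \<and>
      (\<forall>\<epsilon>>0. \<forall>\<^sub>F n in sequentially. \<forall>k\<in>{3..fact n - 3}. \<bar>\<delta> n k\<bar> < \<epsilon>)"
  proof (intro exI[of _ excess] conjI allI impI ballI)
    fix n k :: nat assume "k \<in> {3..fact n - 3}"
    then have "k \<le> fact n" by auto
    then show "real (T n k) = Lambda n k * (1 + excess n k)"
      using T_div_Lambda[of k n] Lambda_pos[of k n] by (simp add: field_simps)
  next
    fix \<epsilon> :: real assume "\<epsilon> > 0"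
    then have "\<forall>\<^sub>F n in sequentially. 40000 / (real n)\<^sup>2 < \<epsilon>" by real_asymp
    then show "\<forall>\<^sub>F n in sequentially. \<forall>k\<in>{3..fact n - 3}. \<bar>excess n k\<bar> < \<epsilon>"
      using eventually_excess_le
    proof eventually_elim
      case (elim n)
      show ?case
      proof
        fix k :: nat assume "k \<in> {3..fact n - 3}"
        then have "excess n k \<le> 40000 / (real n)\<^sup>2" using elim(2) by blast
        then show "\<bar>excess n k\<bar> < \<epsilon>" using elim(1) excess_nonneg[of n k] by linarith
      qed
    qed
  qed
  show "\<exists>C::real. C > 0 \<and> (\<forall>n\<ge>1. \<forall>k\<in>{3..fact n - 3}.
      \<bar>real (T n k) / Lambda n k - 1\<bar> \<le> C / (real n)\<^sup>2)"
    using exists_excess_bound ratio by simp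
  have fact2: "(2::nat) \<le> fact n" if "n \<ge> 2" for n
    using fact_mono[OF that, where 'a = nat] by simp
  show "\<not> (\<lambda>n. real (T n 2)) \<sim>[sequentially] (\<lambda>n. Lambda n 2)"
  proof (rule not_asymp_equiv_if_excess_ge_1)
    show "\<forall>\<^sub>F n in sequentially. (2::nat) \<le> fact n"
      using eventually_ge_at_top[of 2] by eventually_elim (rule fact2)
    show "\<forall>\<^sub>F n in sequentially. 1 \<le> excess n 2"
      using eventually_ge_at_top[of 2] by eventually_elim (rule excess_2_ge)
  qed
  show "\<not> (\<lambda>n. real (T n (fact n - 2))) \<sim>[sequentially] (\<lambda>n. Lambda n (fact n - 2))"
  proof (rule not_asymp_equiv_if_excess_ge_1)
    show "\<forall>\<^sub>F n in sequentially. (fact n :: nat) - 2 \<le> fact n" by simp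
    show "\<forall>\<^sub>F n in sequentially. 1 \<le> excess n (fact n - 2)"
      using eventually_ge_at_top[of 2]
    proof eventually_elim
      case (elim n)
      then show ?case using excess_2_ge[OF elim] excess_complement[OF fact2[OF elim]] by simp
    qed
  qed
  fix a :: real assume a: "a > 2"
  show "\<not> (\<exists>C::real. C > 0 \<and> (\<forall>n\<ge>1. \<forall>k\<in>{3..fact n - 3}.
      \<bar>real (T n k) / Lambda n k - 1\<bar> \<le> C * real n powr (- a)))"
  proof
    assume "\<exists>C::real. C > 0 \<and> (\<forall>n\<ge>1. \<forall>k\<in>{3..fact n - 3}.
      \<bar>real (T n k) / Lambda n k - 1\<bar> \<le> C * real n powr (- a))"
    then obtain C :: real where C: "\<And>n k. n \<ge> 1 \<Longrightarrow> k \<in> {3..fact n - 3} \<Longrightarrow>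
      \<bar>real (T n k) / Lambda n k - 1\<bar> \<le> C * real n powr (- a)" by blast
    \<comment> \<open>Already \<open>k = 3\<close> contradicts a faster rate:
      \<open>1 / (32 * n^2) \<le> C * n powr (- a)\<close> would bound \<open>n powr (a - 2)\<close>
      by \<open>32 * C\<close>.\<close>
    have "filterlim (\<lambda>n. real n powr (a - 2)) at_top sequentially" using a by real_asymp
    then have "\<forall>\<^sub>F n in sequentially. 32 * C < real n powr (a - 2)"
      unfolding filterlim_at_top_dense by blast
    then have "\<forall>\<^sub>F n in sequentially. False" using eventually_ge_at_top[of 6]
    proof eventually_elim
      case (elim n)
      have "(fact 6 :: nat) \<le> fact n" using elim(2) by (rule fact_mono)
      then have 3: "3 \<in> {3..fact n - 3 :: nat}" by (simp add: eval_nat_numeral)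
      have "1 / (32 * (real n)\<^sup>2) \<le> excess n 3" using elim(2) by (rule excess_3_ge)
      also have "\<dots> \<le> C * real n powr (- a)" using C[OF _ 3] ratio[OF 3] elim(2) by simp
      finally have "1 / (32 * (real n)\<^sup>2) * real n powr a \<le> C * real n powr (- a) * real n powr a"
        by (rule mult_right_mono) simp
      also have "\<dots> = C" using elim(2) by (simp add: powr_minus)
      finally have "real n powr a / (real n)\<^sup>2 \<le> 32 * C" by simp
      moreover have "real n powr (a - 2) = real n powr a / (real n)\<^sup>2"
        using elim(2) by (simp add: powr_diff)
      ultimately show False using elim(1) by simp
    qed
    then show False by simp
  qed
qed

end
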